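(* Let $X$ be the standard Dyck shift. Then both ergodic measures of maximal entropy of $X$ are computable.
   Context: Dyck shift. The alphabet is $\mathcal{A}=\{(\,,\,)\,,\,[\,,\,]\}$ (two types of brackets). Define recursively $W_1=\{(),[\,]\}$ and, for $n\ge2$, $W_n=\{(w),[w]: w \text{ is a concatenation of words from } \bigcup_{k=1}^{n-1}W_k \text{ and } |w|=2n-2\}$. Let $\mathcal{G}=\bigcup_{n\ge1}W_n$. The standard Dyck shift $X\subset\mathcal{A}^{\mathbb{Z}}$ is the closure of the set of all bi-infinite concatenations (in all shifted positions) of elements of $\mathcal{G}$, with the left shift $\sigma$. A measure of maximal entropy is a shift-invariant Borel probability measure on $X$ whose measure-theoretic entropy equals $h_{\rm top}(X)$. It is known that $X$ has exactly two ergodic measures of maximal entropy. Computability of measures. $X$ carries the metric $d(x,y)=2^{-\min\{|k|:x_k\ne y_k\}}$. Fix a dense sequence $(s_i)_{i\in\mathbb{N}}$ in $X$ (ideal points) for which a Turing machine outputs, on input $(i,m)$, the $m$-th coordinate of $s_i$ (for example, the shifts of periodic points $w^\infty$ with $w$ a finite concatenation of generators; the notion does not depend on the choice). Let $(\mu_i)_{i\in\mathbb{N}}$ be an effective enumeration of the finite sums $\sum_i q_i\delta_{s_i}$ with positive rational weights summing to $1$, and $W_1(\mu,\nu)=\sup_f|\int f\,d\mu-\int f\,d\nu|$ over all $f:X\to\mathbb{R}$ with Lipschitz constant $1$. A Borel probability measure $\mu$ on $X$ is computable if there is a Turing machine which on input $n\in\mathbb{N}$ outputs $\chi(n)\in\mathbb{N}$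 with $W_1(\mu,\mu_{\chi(n)})<2^{-n}$. *)

theory Defs
  imports "HOL-Probability.Probability" "HOL-Library.Nat_Bijection"
begin

section \<open>Bi-infinite sequences of brackets\<close>

datatype bracket = LPar | RPar | LBrk | RBrk

text \<open>With the discrete topology on the alphabet, the library's topology on
  \<^typ>\<open>int \<Rightarrow> bracket\<close> is the product topology.\<close>

instantiation bracket :: discrete_topology
begin
definition open_bracket :: "bracket set \<Rightarrow> bool" where "open_bracket U = True"
instance by standard (simp_all add: open_bracket_def)
end

type_synonym biseq = "int \<Rightarrow> bracket"

definition shift :: "biseq \<Rightarrow> biseq" where
  "shift x = (\<lambda>k. x (k + 1))"

definition factor :: "biseq \<Rightarrow> int \<Rightarrow> int \<Rightarrow> bracket list" where
  "factor x a b = map x [a..b - 1]"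

definition biseq_dist :: "biseq \<Rightarrow> biseq \<Rightarrow> real" where
  "biseq_dist x y =
     (if x = y then 0 else (1 / 2) ^ (LEAST n. \<exists>k. n = nat \<bar>k\<bar> \<and> x k \<noteq> y k))"


section \<open>The Dyck shift\<close>

fun dyck_words :: "nat \<Rightarrow> bracket list set" where
  "dyck_words n =
     (if n = 0 then {}
      else if n = 1 then {[LPar, RPar], [LBrk, RBrk]}
      else (\<Union>w \<in> {w \<in> concat ` lists (\<Union>k\<in>{1..<n}. dyck_words k). length w = 2 * n - 2}.
              {LPar # w @ [RPar], LBrk # w @ [RBrk]}))"

declare dyck_words.simps [simp del]

definition dyck_generators :: "bracket list set" where
  "dyck_generators = (\<Union>n\<in>{1..}. dyck_words n)"

text \<open>A bi-infinite concatenation is given by its cut points \<open>p i\<close>. As \<open>p 0\<close> is an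
  arbitrary integer, all shifted positions are included.\<close>

definition biinfinite_concatenations :: "bracket list set \<Rightarrow> biseq set" where
  "biinfinite_concatenations G =
     {x. \<exists>p :: int \<Rightarrow> int. \<forall>i. p i < p (i + 1) \<and> factor x (p i) (p (i + 1)) \<in> G}"

definition dyck_shift :: "biseq set" where
  "dyck_shift = closure (biinfinite_concatenations dyck_generators)"


section \<open>Entropy and measures of maximal entropy\<close>

definition language :: "biseq set \<Rightarrow> nat \<Rightarrow> bracket list set" where
  "language X n = {factor x a (a + int n) | x a. x \<in> X}"

definition top_entropy :: "biseq set \<Rightarrow> real" where
  "top_entropy X = lim (\<lambda>n. ln (real (card (language X n))) / real n)"

definition subshift_algebra :: "biseq set \<Rightarrow> biseq measure" where
  "subshift_algebra X = restrict_space borel X"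

definition borel_prob_on :: "biseq set \<Rightarrow> biseq measure \<Rightarrow> bool" where
  "borel_prob_on X M \<longleftrightarrow> prob_space M \<and> sets M = sets (subshift_algebra X)"

definition invariant_prob_on :: "biseq set \<Rightarrow> biseq measure \<Rightarrow> bool" where
  "invariant_prob_on X M \<longleftrightarrow>
     borel_prob_on X M \<and> (\<forall>A\<in>sets M. emeasure M (shift -` A \<inter> space M) = emeasure M A)"

definition ergodic :: "biseq measure \<Rightarrow> bool" where
  "ergodic M \<longleftrightarrow>
     (\<forall>A\<in>sets M. shift -` A \<inter> space M = A \<longrightarrow> measure M A = 0 \<or> measure M A = 1)"

definition finite_partition :: "biseq measure \<Rightarrow> biseq set set \<Rightarrow> bool" where
  "finite_partition M P \<longleftrightarrow> finite P \<and> P \<subseteq> sets M \<and> partition_on (space M) P"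

definition partition_entropy :: "biseq measure \<Rightarrow> biseq set set \<Rightarrow> real" where
  "partition_entropy M P = (\<Sum>A\<in>P. - measure M A * ln (measure M A))"

text \<open>The common refinement of the preimages of \<open>P\<close> under the first \<open>n\<close> iterates of the
  shift, \<open>0\<close> included. It may contain the empty set, which contributes nothing to the entropy.\<close>

definition iterated_join :: "biseq measure \<Rightarrow> biseq set set \<Rightarrow> nat \<Rightarrow> biseq set set" where
  "iterated_join M P n =
     {space M \<inter> (\<Inter>i<n. (shift ^^ i) -` A i) | A. \<forall>i<n. A i \<in> P}"

definition entropy_wrt :: "biseq measure \<Rightarrow> biseq set set \<Rightarrow> real" where
  "entropy_wrt M P = lim (\<lambda>n. partition_entropy M (iterated_join M P n) / real n)"

definition measure_entropy :: "biseq measure \<Rightarrow> ereal" where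
  "measure_entropy M = (SUP P\<in>{P. finite_partition M P}. ereal (entropy_wrt M P))"

definition max_entropy_measure :: "biseq set \<Rightarrow> biseq measure \<Rightarrow> bool" where
  "max_entropy_measure X M \<longleftrightarrow>
     invariant_prob_on X M \<and> measure_entropy M = ereal (top_entropy X)"


section \<open>Turing machines\<close>

text \<open>Deterministic machines with finitely many two-way infinite tapes. States and tape
  symbols are initial segments of the natural numbers: state \<open>0\<close> is initial, state \<open>1\<close> is the
  halting state, symbol \<open>0\<close> is the blank and symbol \<open>1\<close> the stroke of the unary notation.
  The transition function matters only on the finitely many arguments
  that \<open>wf_tm\<close> mentions.\<close>

datatype head_move = MoveLeft | Stay | MoveRight

record tm =
  num_tapes :: nat
  num_states :: nat
  num_symbols :: nat
  transition :: "nat \<Rightarrow> nat list \<Rightarrow> nat \<times> (nat \<times> head_move) list"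

definition wf_tm :: "tm \<Rightarrow> bool" where
  "wf_tm T \<longleftrightarrow>
     num_tapes T \<ge> 1 \<and> num_states T \<ge> 2 \<and> num_symbols T \<ge> 2 \<and>
     (\<forall>q as q' acts.
        q < num_states T \<longrightarrow> length as = num_tapes T \<longrightarrow> set as \<subseteq> {..<num_symbols T} \<longrightarrow>
        transition T q as = (q', acts) \<longrightarrow>
        q' < num_states T \<and> length acts = num_tapes T \<and> fst ` set acts \<subseteq> {..<num_symbols T})"

text \<open>A tape consists of its contents and the position of the head.\<close>

type_synonym tape = "(int \<Rightarrow> nat) \<times> int"

fun tape_update :: "tape \<Rightarrow> nat \<times> head_move \<Rightarrow> tape" where
  "tape_update (c, h) (a, m) =
     (c(h := a), case m of MoveLeft \<Rightarrow> h - 1 | Stay \<Rightarrow> h | MoveRight \<Rightarrow> h + 1)"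

fun tm_step :: "tm \<Rightarrow> nat \<times> tape list \<Rightarrow> nat \<times> tape list" where
  "tm_step T (q, ts) =
     (if q = 1 then (q, ts)
      else let (q', acts) = transition T q (map (\<lambda>(c, h). c h) ts)
           in (q', map2 tape_update ts acts))"

definition unary :: "nat \<Rightarrow> int \<Rightarrow> nat" where
  "unary n k = (if 0 \<le> k \<and> k < int n then 1 else 0)"

definition tm_init :: "tm \<Rightarrow> nat \<Rightarrow> nat \<times> tape list" where
  "tm_init T n = (0, (unary n, 0) # replicate (num_tapes T - 1) (\<lambda>_. 0, 0))"

text \<open>The first tape carries both the input and the output.\<close>

definition tm_outputs :: "tm \<Rightarrow> nat \<Rightarrow> nat \<Rightarrow> bool" where
  "tm_outputs T n m \<longleftrightarrow>
     (\<exists>t h ts. (tm_step T ^^ t) (tm_init T n) = (1, (unary m, h) # ts))"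

definition turing_computable :: "(nat \<Rightarrow> nat) \<Rightarrow> bool" where
  "turing_computable f \<longleftrightarrow> (\<exists>T. wf_tm T \<and> (\<forall>n. tm_outputs T n (f n)))"


section \<open>Computable measures\<close>

fun bracket_code :: "bracket \<Rightarrow> nat" where
  "bracket_code LPar = 0"
| "bracket_code RPar = 1"
| "bracket_code LBrk = 2"
| "bracket_code RBrk = 3"

text \<open>The input \<open>(i, m)\<close> is passed to the machine as the natural number
  \<open>prod_encode (i, int_encode m)\<close>.\<close>

definition ideal_points :: "biseq set \<Rightarrow> (nat \<Rightarrow> biseq) \<Rightarrow> bool" where
  "ideal_points X s \<longleftrightarrow>
     range s \<subseteq> X \<and> X \<subseteq> closure (range s) \<and>
     (\<exists>f. turing_computable f \<and>
          (\<forall>i m. f (prod_encode (i, int_encode m)) = bracket_code (s i m)))"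

text \<open>The number \<open>i\<close> encodes a nonempty list of pairs \<open>(j, a)\<close>; the measure is the sum of the
  point masses at the points \<open>s j\<close> with weights proportional to \<open>a + 1\<close>. As \<open>i\<close> varies, these
  are all finite sums of point masses with positive rational weights of total \<open>1\<close>.\<close>

definition ideal_list :: "nat \<Rightarrow> (nat \<times> nat) list" where
  "ideal_list i = (case prod_decode i of (h, t) \<Rightarrow> map prod_decode (h # list_decode t))"

definition ideal_measure :: "biseq set \<Rightarrow> (nat \<Rightarrow> biseq) \<Rightarrow> nat \<Rightarrow> biseq measure" where
  "ideal_measure X s i =
     (let xs = ideal_list i; total = (\<Sum>(j, a)\<leftarrow>xs. a + 1) in
      measure_of (space (subshift_algebra X)) (sets (subshift_algebra X))
        (\<lambda>A. \<Sum>(j, a)\<leftarrow>xs.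
           ennreal (real (a + 1) / real total) * emeasure (return (subshift_algebra X) (s j)) A))"

definition wasserstein :: "biseq set \<Rightarrow> biseq measure \<Rightarrow> biseq measure \<Rightarrow> real" where
  "wasserstein X M N =
     (SUP f \<in> {f :: biseq \<Rightarrow> real. \<forall>x\<in>X. \<forall>y\<in>X. \<bar>f x - f y\<bar> \<le> biseq_dist x y}.
        \<bar>integral\<^sup>L M f - integral\<^sup>L N f\<bar>)"

definition computable_measure :: "biseq set \<Rightarrow> (nat \<Rightarrow> biseq) \<Rightarrow> biseq measure \<Rightarrow> bool" where
  "computable_measure X s M \<longleftrightarrow>
     borel_prob_on X M \<and>
     (\<exists>g. turing_computable g \<and>
          (\<forall>n. wasserstein X M (ideal_measure X s (g n)) < (1 / 2) ^ n))"

end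

theory Submission
  imports Defs
begin

text \<open>Write \<open>\<pi>\<close> for the coding of bracket sequences by three letters that forgets the type of the
  closing brackets, or, symmetrically, that of the opening ones. An unmatched opening bracket
  can have no unmatched closing bracket to its right, so by ergodicity almost surely either all
  closing or all opening brackets are matched. In that case the corresponding coding determines
  the point almost surely, and the entropy is at most that of the image of the measure on the
  full shift over three letters. As the language of the Dyck shift grows like \<open>3 ^ n\<close>, the image
  has the maximal entropy \<open>ln 3\<close>, so it gives the mass \<open>3 ^ -L\<close> to each word of length \<open>L\<close>.

  To approximate the measure, choose for each word of length \<open>L = 2 N + 1\<close> the first ideal point
  whose \<open>\<pi>\<close>-image shows this word in the window \<open>[-N, N]\<close>, and take the uniform
  distribution on these points. All brackets whose partner is forced to lie in the window are
  reconstructed correctly, and the probability of the contrary decays exponentially by a Chernoff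
  bound. The selection is computable because the coordinates of the ideal points are. To
  run a given machine as a subroutine, register programs are compiled to Turing machines.\<close>


section \<open>Computability on Turing machines\<close>

subsection \<open>Structured programs on tapes\<close>

text \<open>A matched bracket copies the type of its partner, so the coding loses nothing. It is a
  walk with two letters that go up and one that goes down, and under the uniform distribution its
  drift is 1/3. This is why partners are found fast, and why a precision \<open>n\<close> translates
  into the explicit window length \<open>54 * n + 109\<close>.

  The obstacle is that the coding is injective only up to null sets, and that its inverse looks for
  partners at unbounded distance. Entropies are therefore compared through partitions that a finite
  window of the coding decides, corrected by a function that is constant with high probability. For
  the distance of measures, the uniform distribution on the selected ideal points is exactly, not
  only approximately, the image of the measure under the map that replaces a point by the selected
  one with the same window. The mean displacement under this map bounds the difference of the
  integrals for all Lipschitz functions at once.\<close>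

type_synonym act = "nat \<times> head_move"

text \<open>Tests and actions are arbitrary functions of all scanned symbols, so a single
  \<open>Act\<close> can perform a whole step of a simulated machine. Such programs denote finite
  machines because \<open>wf_com\<close> keeps the symbols below \<open>B\<close>.\<close>

datatype com =
    Act "nat list \<Rightarrow> act list"
  | Seq com com
  | While "nat list \<Rightarrow> bool" com

definition heads :: "tape list \<Rightarrow> nat list" where
  "heads ts = map (\<lambda>(c, h). c h) ts"

definition stay :: "nat list \<Rightarrow> act list" where
  "stay as = map (\<lambda>a. (a, Stay)) as"

inductive big :: "com \<Rightarrow> tape list \<Rightarrow> tape list \<Rightarrow> bool" where
  Act: "big (Act f) ts (map2 tape_update ts (f (heads ts)))"
| Seq: "big c ts us \<Longrightarrow> big d us vs \<Longrightarrow> big (Seq c d) ts vs"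
| WhileF: "\<not> p (heads ts) \<Longrightarrow> big (While p c) ts ts"
| WhileT: "p (heads ts) \<Longrightarrow> big c ts us \<Longrightarrow> big (While p c) us vs \<Longrightarrow> big (While p c) ts vs"

type_synonym instr = "nat list \<Rightarrow> nat \<times> act list"

fun len :: "com \<Rightarrow> nat" where
  "len (Act f) = 1"
| "len (Seq c d) = len c + len d"
| "len (While p c) = len c + 2"

text \<open>Jump targets are absolute, hence the base address \<open>b\<close>. A loop takes two
  instructions besides its body, the test and the jump back, and is left at the address behind
  both.\<close>

fun code :: "com \<Rightarrow> nat \<Rightarrow> instr list" where
  "code (Act f) b = [\<lambda>as. (b + 1, f as)]"
| "code (Seq c d) b = code c b @ code d (b + len c)"
| "code (While p c) b =
     (\<lambda>as. (if p as then b + 1 else b + len c + 2, stay as)) # code c (b + 1)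
       @ [\<lambda>as. (b, stay as)]"

fun wf_com :: "nat \<Rightarrow> nat \<Rightarrow> com \<Rightarrow> bool" where
  "wf_com K B (Act f) = (\<forall>as. length as = K \<longrightarrow> set as \<subseteq> {..<B} \<longrightarrow>
     length (f as) = K \<and> fst ` set (f as) \<subseteq> {..<B})"
| "wf_com K B (Seq c d) = (wf_com K B c \<and> wf_com K B d)"
| "wf_com K B (While p c) = wf_com K B c"

lemma length_code [simp]: "length (code c b) = len c"
  by (induction c arbitrary: b) auto

lemma len_pos [simp]: "0 < len c" "len c \<noteq> 0"
  by (induction c) auto

lemma length_stay [simp]: "length (stay as) = length as"
  by (simp add: stay_def)

lemma fst_stay: "fst ` set (stay as) = set as"
  by (force simp: stay_def)

lemma stay_bounded: "set as \<subseteq> {..<B} \<Longrightarrow> x \<in> set (stay as) \<Longrightarrow> fst x < B"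
  by (auto simp: stay_def)

lemma tape_update_stay: "map2 tape_update ts (stay (heads ts)) = ts"
  by (induction ts) (auto simp: stay_def heads_def)

lemma code_target_le:
  "ins \<in> set (code c b) \<Longrightarrow> fst (ins as) \<le> b + len c"
proof (induction c arbitrary: b)
  case (Seq c d)
  then consider "ins \<in> set (code c b)" | "ins \<in> set (code d (b + len c))" by auto
  then show ?case using Seq.IH(1)[of b] Seq.IH(2)[of "b + len c"] by cases auto
next
  case (While p c)
  then consider "ins = (\<lambda>as. (if p as then b + 1 else b + len c + 2, stay as))"
    | "ins \<in> set (code c (b + 1))" | "ins = (\<lambda>as. (b, stay as))" by auto
  then show ?case using While.IH[of "b + 1"] by cases auto
qed simp

lemma code_wf:
  assumes "wf_com K B c" "length as = K" "set as \<subseteq> {..<B}" "ins \<in> set (code c b)"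
  shows "length (snd (ins as)) = K \<and> fst ` set (snd (ins as)) \<subseteq> {..<B}"
  using assms by (induction c arbitrary: b) (auto dest: stay_bounded)

section \<open>Execution of jump code\<close>

fun istep :: "instr list \<Rightarrow> nat \<times> tape list \<Rightarrow> nat \<times> tape list" where
  "istep P (pc, ts) = (let (pc', acts) = (P ! pc) (heads ts) in (pc', map2 tape_update ts acts))"

inductive isteps :: "instr list \<Rightarrow> nat \<times> tape list \<Rightarrow> nat \<times> tape list \<Rightarrow> bool" for P where
  isteps_refl: "isteps P x x"
| isteps_step: "fst x < length P \<Longrightarrow> isteps P (istep P x) y \<Longrightarrow> isteps P x y"

lemma isteps_trans: "isteps P x y \<Longrightarrow> isteps P y z \<Longrightarrow> isteps P x z"
  by (induction rule: isteps.induct) (auto intro: isteps.intros)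

text \<open>The surroundings \<open>xs\<close> and \<open>ys\<close> are arbitrary because the parts
  of a sequence or a loop run inside the code of the whole. After one round of a loop, the rest of
  the derivation concerns the same code at the same address.\<close>

lemma isteps_code:
  assumes "big c ts us" "P = xs @ code c (length xs) @ ys"
  shows "isteps P (length xs, ts) (length xs + len c, us)"
  using assms
proof (induction arbitrary: P xs ys rule: big.induct)
  case (Act f ts)
  then show ?case
    by - (rule isteps_step, auto intro: isteps_refl)
next
  case (Seq c ts us d vs)
  have "isteps P (length xs, ts) (length xs + len c, us)"
    by (rule Seq.IH(1)[of _ xs "code d (length xs + len c) @ ys"]) (use Seq.prems in simp)
  moreover have "isteps P (length (xs @ code c (length xs)), us) (length (xs @ code c (length xs)) + len d, vs)"
    by (rule Seq.IH(2)[of _ _ ys]) (use Seq.prems in simp)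
  ultimately show ?case
    using isteps_trans by (simp add: add.assoc)
next
  case (WhileF p ts c)
  then show ?case
    by - (rule isteps_step, auto intro: isteps_refl simp: tape_update_stay)
next
  case (WhileT p ts c us vs)
  let ?e = "\<lambda>as. (length xs, stay as)"
  let ?h = "(\<lambda>as. (if p as then length xs + 1 else length xs + len c + 2, stay as))"
  have P: "P = (xs @ [?h]) @ code c (length (xs @ [?h])) @ ?e # ys"
    using WhileT.prems by simp
  have "isteps P (length (xs @ [?h]), ts) (length (xs @ [?h]) + len c, us)"
    by (rule WhileT.IH(1)[OF P])
  moreover have "isteps P (length (xs @ [?h]) + len c, us) (length xs, us)"
  proof -
    have e: "P = ((xs @ [?h]) @ code c (length (xs @ [?h]))) @ ?e # ys" by (simp add: P)
    have "P ! (length (xs @ [?h]) + len c) = ?e"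
      by (subst e, subst nth_append_right) simp_all
    then show ?thesis
      by - (rule isteps_step, auto intro: isteps_refl simp: tape_update_stay P)
  qed
  moreover have "isteps P (length xs, us) (length xs + len (While p c), vs)"
    by (rule WhileT.IH(2)[OF WhileT.prems])
  ultimately have "isteps P (length (xs @ [?h]), ts) (length xs + len (While p c), vs)"
    by (blast intro: isteps_trans)
  moreover have "istep P (length xs, ts) = (length (xs @ [?h]), ts)"
    using WhileT.hyps by (simp add: P tape_update_stay nth_append)
  ultimately show ?case
    by - (rule isteps_step, auto simp: P)
qed

text \<open>The entry address and the exit address have to become the fixed states 0 and 1; the
  addresses in between move up by one to make room.\<close>

definition enc_pc :: "nat \<Rightarrow> nat \<Rightarrow> nat" where
  "enc_pc l pc = (if pc = 0 then 0 else if pc = l then 1 else pc + 1)"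

text \<open>Truncated subtraction inverts \<open>enc_pc\<close>: state 0 stands for address 0, and a
  state \<open>q \<ge> 2\<close> for \<open>q - 1\<close>.\<close>

definition machine :: "nat \<Rightarrow> nat \<Rightarrow> com \<Rightarrow> tm" where
  "machine K B c = \<lparr>num_tapes = K, num_states = len c + 2, num_symbols = B,
     transition = (\<lambda>q as. if q = 1 \<or> q > len c then (1, stay as)
        else (let (pc, acts) = (code c 0 ! (q - 1)) as in (enc_pc (len c) pc, acts)))\<rparr>"

lemma wf_machine:
  assumes "wf_com K B c" "K \<ge> 1" "B \<ge> 2"
  shows "wf_tm (machine K B c)"
  unfolding wf_tm_def
proof (intro conjI allI impI)
  fix q as q' acts
  assume *: "q < num_states (machine K B c)" "length as = num_tapes (machine K B c)"
    "set as \<subseteq> {..<num_symbols (machine K B c)}" "transition (machine K B c) q as = (q', acts)"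
  have "q' < len c + 2 \<and> length acts = K \<and> fst ` set acts \<subseteq> {..<B}"
  proof (cases "q = 1 \<or> q > len c")
    case True
    then show ?thesis using * by (auto simp: machine_def dest: stay_bounded)
  next
    case False
    let ?i = "code c 0 ! (q - 1)"
    have "q - 1 < len c" using False len_pos[of c] by linarith
    then have "?i \<in> set (code c 0)"
      by simp
    from code_target_le[OF this, of as] code_wf[OF assms(1) _ _ this, of as]
    show ?thesis using False * by (auto simp: machine_def enc_pc_def Let_def split: prod.splits)
  qed
  then show "q' < num_states (machine K B c)" "length acts = num_tapes (machine K B c)"
    "fst ` set acts \<subseteq> {..<num_symbols (machine K B c)}"
    by (simp_all add: machine_def)
qed (use assms in \<open>simp_all add: machine_def\<close>)

lemma machine_steps:
  assumes "isteps (code c 0) x y" "fst y = len c"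
  shows "\<exists>t. (tm_step (machine K B c) ^^ t) (enc_pc (len c) (fst x), snd x) = (1, snd y)"
  using assms
proof (induction rule: isteps.induct)
  case (isteps_refl x)
  have "((tm_step (machine K B c) ^^ 0) (enc_pc (len c) (fst x), snd x)) = (1, snd x)"
    using isteps_refl len_pos[of c] by (simp add: enc_pc_def)
  then show ?case by blast
next
  case (isteps_step x y)
  obtain pc ts where x: "x = (pc, ts)" by force
  have pc: "pc < len c" using isteps_step x by simp
  have "tm_step (machine K B c) (enc_pc (len c) pc, ts) =
     (enc_pc (len c) (fst (istep (code c 0) x)), snd (istep (code c 0) x))"
    using pc by (cases "pc = 0") (simp_all add: x machine_def enc_pc_def heads_def Let_def split: prod.splits)
  then show ?case
    using isteps_step.IH[OF isteps_step.prems] by (metis funpow_simps_right(2) comp_apply fst_conv snd_conv x)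
qed

lemma machine_run:
  assumes "big c (snd (tm_init (machine K B c) n)) ts"
  shows "\<exists>t. (tm_step (machine K B c) ^^ t) (tm_init (machine K B c) n) = (1, ts)"
proof -
  have "isteps (code c 0) (0, snd (tm_init (machine K B c) n)) (len c, ts)"
    using isteps_code[OF assms, of "code c 0" "[]" "[]"] by simp
  from machine_steps[OF this] show ?thesis
    by (simp add: tm_init_def enc_pc_def)
qed

subsection \<open>Tapes as unary registers\<close>

text \<open>The head of a register stands on its leftmost stroke, so that incrementing and
  decrementing move the left end.\<close>

definition reg :: "nat \<Rightarrow> tape \<Rightarrow> bool" where
  "reg n t \<longleftrightarrow> (\<forall>i. fst t i = (if snd t \<le> i \<and> i < snd t + int n then 1 else 0))"

definition on :: "nat \<Rightarrow> (nat \<Rightarrow> act) \<Rightarrow> com" where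
  "on j f = Act (\<lambda>as. (stay as)[j := f (as ! j)])"

definition loop :: "nat \<Rightarrow> (nat \<Rightarrow> bool) \<Rightarrow> com \<Rightarrow> com" where
  "loop j p c = While (\<lambda>as. p (as ! j)) c"

abbreviation under :: "tape \<Rightarrow> nat" where
  "under t \<equiv> fst t (snd t)"

lemma length_heads [simp]: "length (heads ts) = length ts"
  by (simp add: heads_def)

lemma nth_heads [simp]: "j < length ts \<Longrightarrow> heads ts ! j = under (ts ! j)"
  by (simp add: heads_def case_prod_beta)

lemma nth_stay [simp]: "j < length as \<Longrightarrow> stay as ! j = (as ! j, Stay)"
  by (simp add: stay_def)

lemma tape_update_under [simp]: "tape_update t (under t, Stay) = t"
  by (cases t) simp

lemma big_on:
  assumes "j < length ts"
  shows "big (on j f) ts (ts[j := tape_update (ts ! j) (f (under (ts ! j)))])"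
proof -
  have 1: "map2 tape_update ts ((stay (heads ts))[j := a]) = ts[j := tape_update (ts ! j) a]" for a
  proof (rule nth_equalityI)
    fix i assume "i < length (map2 tape_update ts ((stay (heads ts))[j := a]))"
    then show "map2 tape_update ts ((stay (heads ts))[j := a]) ! i = (ts[j := tape_update (ts ! j) a]) ! i"
      by (cases "i = j") simp_all
  qed simp
  have "heads ts ! j = under (ts ! j)" using assms by simp
  then show ?thesis
    using big.Act[of "\<lambda>as. (stay as)[j := f (as ! j)]" ts] unfolding on_def 1 by simp
qed

lemma wf_on: assumes *: "\<And>a. a < B \<Longrightarrow> fst (f a) < B" "j < K" shows "wf_com K B (on j f)"
proof (unfold on_def wf_com.simps, intro allI impI conjI)
  fix as :: "nat list"
  assume **: "length as = K" "set as \<subseteq> {..<B}"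
  then have 1: "as ! j < B" using * by (metis lessThan_iff nth_mem subsetD)
  show "fst ` set ((stay as)[j := f (as ! j)]) \<subseteq> {..<B}"
  proof (intro image_subsetI)
    fix x assume "x \<in> set ((stay as)[j := f (as ! j)])"
    then have "x = f (as ! j) \<or> x \<in> set (stay as)"
      by (meson insertE set_update_subset_insert subsetD)
    then show "fst x \<in> {..<B}" using stay_bounded[OF **(2), of x] *(1)[OF 1] by auto
  qed
qed simp

lemma wf_loop [simp]: "wf_com K B (loop j p c) = wf_com K B c"
  by (simp add: loop_def)

lemma big_loop_False: "j < length ts \<Longrightarrow> \<not> p (under (ts ! j)) \<Longrightarrow> big (loop j p c) ts ts"
  unfolding loop_def by (rule big.WhileF) simp

lemma big_loop_True:
  "j < length ts \<Longrightarrow> p (under (ts ! j)) \<Longrightarrow> big c ts us \<Longrightarrow> big (loop j p c) us vs \<Longrightarrow>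
    big (loop j p c) ts vs"
  unfolding loop_def by (rule big.WhileT) simp

definition inc :: "nat \<Rightarrow> com" where
  "inc j = Seq (on j (\<lambda>a. (a, MoveLeft))) (on j (\<lambda>_. (1, Stay)))"

definition dec :: "nat \<Rightarrow> com" where
  "dec j = on j (\<lambda>_. (0, MoveRight))"

lemma reg_under: "reg n t \<Longrightarrow> under t = 0 \<longleftrightarrow> n = 0"
  by (auto simp: reg_def)

lemma reg_inc: "reg n t \<Longrightarrow>
    reg (Suc n) (tape_update (tape_update t (under t, MoveLeft)) (1, Stay))"
  by (cases t) (auto simp: reg_def)

lemma reg_dec: "reg n t \<Longrightarrow> reg (n - 1) (tape_update t (0, MoveRight))"
  by (cases t) (auto simp: reg_def)

lemma big_inc:
  assumes "j < length ts" "reg n (ts ! j)"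
  obtains t where "big (inc j) ts (ts[j := t])" "reg (Suc n) t"
proof -
  let ?t = "tape_update (ts ! j) (under (ts ! j), MoveLeft)"
  have "big (inc j) ts (ts[j := tape_update ?t (1, Stay)])"
    unfolding inc_def
    using big.Seq[OF big_on[of j ts "\<lambda>a. (a, MoveLeft)"] big_on[of j _ "\<lambda>_. (1, Stay)"]] assms(1)
    by simp
  then show thesis using reg_inc[OF assms(2)] that by blast
qed

text \<open>Tape \<open>0\<close> is reserved for input and output.\<close>

definition rel :: "nat \<Rightarrow> tape \<Rightarrow> (nat \<Rightarrow> nat) \<Rightarrow> tape list \<Rightarrow> bool" where
  "rel K t v ts \<longleftrightarrow> length ts = K \<and> 0 < K \<and> ts ! 0 = t \<and> (\<forall>j. 0 < j \<and> j < K \<longrightarrow> reg (v j) (ts ! j))"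

lemma rel_update:
  "rel K t v ts \<Longrightarrow> 0 < j \<Longrightarrow> j < K \<Longrightarrow> reg n u \<Longrightarrow> rel K t (v(j := n)) (ts[j := u])"
  by (auto simp: rel_def nth_list_update)

lemma rel_update_0: "rel K t v ts \<Longrightarrow> rel K u v (ts[0 := u])"
  by (auto simp: rel_def nth_list_update)

lemma rel_inc:
  assumes "rel K t v ts" "0 < j" "j < K"
  obtains us where "big (inc j) ts us" "rel K t (v(j := Suc (v j))) us"
  by (rule big_inc[of j ts "v j"]) (use assms in \<open>auto simp: rel_def intro: that rel_update[OF assms]\<close>)

lemma rel_dec:
  assumes "rel K t v ts" "0 < j" "j < K"
  obtains us where "big (dec j) ts us" "rel K t (v(j := v j - 1)) us"
proof (rule that)
  show "big (dec j) ts (ts[j := tape_update (ts ! j) (0, MoveRight)])"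
    using big_on[of j ts "\<lambda>_. (0, MoveRight)"] assms by (auto simp: rel_def dec_def)
  have "reg (v j) (ts ! j)" using assms by (simp add: rel_def)
  then show "rel K t (v(j := v j - 1)) (ts[j := tape_update (ts ! j) (0, MoveRight)])"
    by (intro rel_update[OF assms] reg_dec)
qed

lemma rel_on_0:
  assumes "rel K t v ts"
  obtains us where "big (on 0 f) ts us" "rel K (tape_update t (f (under t))) v us"
proof (rule that)
  show "big (on 0 f) ts (ts[0 := tape_update t (f (under t))])"
    using big_on[of 0 ts f] assms by (auto simp: rel_def)
qed (rule rel_update_0[OF assms])

abbreviation nz :: "nat \<Rightarrow> bool" where "nz \<equiv> (\<lambda>a. a \<noteq> 0)"

lemma rel_under: "rel K t v ts \<Longrightarrow> 0 < j \<Longrightarrow> j < K \<Longrightarrow> under (ts ! j) = 0 \<longleftrightarrow> v j = 0"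
  using reg_under by (auto simp: rel_def)

definition transfer :: "nat \<Rightarrow> nat \<Rightarrow> com" where
  "transfer i j = loop i nz (Seq (dec i) (inc j))"

lemma rel_transfer:
  assumes "rel K t v ts" "0 < i" "i < K" "0 < j" "j < K" "i \<noteq> j"
  shows "\<exists>us. big (transfer i j) ts us \<and> rel K t (v(i := 0, j := v j + v i)) us"
  using assms(1)
proof (induction "v i" arbitrary: v ts)
  case 0
  then have "big (transfer i j) ts ts"
    unfolding transfer_def using rel_under[OF 0(2) assms(2,3)] assms
    by (intro big_loop_False) (auto simp: rel_def)
  moreover have "v(i := 0, j := v j + v i) = v" using 0 by auto
  ultimately show ?case using 0 by metis
next
  case (Suc n)
  obtain us where us: "big (dec i) ts us" "rel K t (v(i := v i - 1)) us"
    using rel_dec[OF Suc.prems assms(2,3)] .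
  obtain vs where vs: "big (inc j) us vs" "rel K t (v(i := v i - 1, j := Suc (v j))) vs"
    by (rule rel_inc[OF us(2) assms(4,5)]) (use assms(6) in simp)
  let ?w = "v(i := v i - 1, j := Suc (v j))"
  have "n = ?w i" using Suc.hyps(2) assms(6) by simp
  from Suc.hyps(1)[OF this vs(2)] obtain ws where
    ws: "big (transfer i j) vs ws" "rel K t (?w(i := 0, j := ?w j + ?w i)) ws" by blast
  have "?w(i := 0, j := ?w j + ?w i) = v(i := 0, j := v j + v i)"
    using Suc.hyps(2) assms(6) by (auto simp: fun_eq_iff)
  moreover have "big (transfer i j) ts ws"
    using ws(1) rel_under[OF Suc.prems assms(2,3)] Suc.hyps(2) Suc.prems assms(3)
    unfolding transfer_def
    by (intro big_loop_True[OF _ _ big.Seq[OF us(1) vs(1)]]) (auto simp: rel_def)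
  ultimately show ?case using ws(2) by metis
qed

subsection \<open>Erasing a visited region\<close>

text \<open>The invariant that makes a used tape erasable: if the nonblank cells form an interval
  around the head, both ends are found by looking for a blank.\<close>

definition visited :: "tape \<Rightarrow> bool" where
  "visited t \<longleftrightarrow> (\<exists>l r. l \<le> snd t \<and> snd t < r \<and> (\<forall>i. fst t i \<noteq> 0 \<longleftrightarrow> l \<le> i \<and> i < r))"

definition rewind :: "nat \<Rightarrow> com" where
  "rewind j = Seq (loop j nz (on j (\<lambda>a. (a, MoveLeft)))) (on j (\<lambda>a. (a, MoveRight)))"

lemma big_rewind_aux:
  assumes "j < length ts" "ts ! j = (c, h)" "l - 1 \<le> h" "h < r" "\<forall>i. c i \<noteq> 0 \<longleftrightarrow> l \<le> i \<and> i < r"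
  shows "big (loop j nz (on j (\<lambda>a. (a, MoveLeft)))) ts (ts[j := (c, l - 1)])"
  using assms
proof (induction "nat (h + 1 - l)" arbitrary: h ts)
  case 0
  then have "h = l - 1" by simp
  with 0 have "ts[j := (c, l - 1)] = ts" by (metis list_update_id)
  moreover have "\<not> nz (under (ts ! j))" using 0 by auto
  ultimately show ?case using big_loop_False[of j ts nz] 0 by simp
next
  case (Suc n)
  have "l \<le> h" using Suc by auto
  then have nz: "nz (under (ts ! j))" using Suc by auto
  have "big (on j (\<lambda>a. (a, MoveLeft))) ts (ts[j := (c, h - 1)])"
    using big_on[of j ts "\<lambda>a. (a, MoveLeft)"] Suc.prems by simp
  moreover have "big (loop j nz (on j (\<lambda>a. (a, MoveLeft)))) (ts[j := (c, h - 1)])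
      (ts[j := (c, h - 1), j := (c, l - 1)])"
    by (rule Suc.hyps(1)[of "h - 1"]) (use Suc.hyps(2) Suc.prems \<open>l \<le> h\<close> in auto)
  ultimately show ?case
    using big_loop_True[of j ts nz, OF _ nz] Suc.prems by simp
qed

lemma big_rewind:
  assumes "j < length ts" "visited (ts ! j)"
  obtains c h r where "big (rewind j) ts (ts[j := (c, h)])" "c = fst (ts ! j)"
    "h < r" "\<forall>i. c i \<noteq> 0 \<longleftrightarrow> h \<le> i \<and> i < r"
proof -
  obtain c h where ch: "ts ! j = (c, h)" by force
  with assms obtain l r where lr: "l \<le> h" "h < r" "\<forall>i. c i \<noteq> 0 \<longleftrightarrow> l \<le> i \<and> i < r"
    by (auto simp: visited_def)
  have "big (loop j nz (on j (\<lambda>a. (a, MoveLeft)))) ts (ts[j := (c, l - 1)])"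
    by (rule big_rewind_aux) (use assms ch lr in auto)
  from big.Seq[OF this big_on[of j _ "\<lambda>a. (a, MoveRight)"]]
  have "big (rewind j) ts (ts[j := (c, l)])"
    using assms(1) by (simp add: rewind_def)
  from that[OF this _ _ lr(3)] show thesis using ch lr by simp
qed

text \<open>The inner loop runs at most once, because it overwrites the stroke by the symbol \<open>2\<close>.\<close>

definition count :: "nat \<Rightarrow> nat \<Rightarrow> com" where
  "count j i = loop j nz (Seq (loop j (\<lambda>a. a = 1) (Seq (inc i) (on j (\<lambda>_. (2, Stay)))))
     (on j (\<lambda>_. (0, MoveRight))))"

lemma count_step:
  assumes "j < length ts" "i < length ts" "i \<noteq> j" "ts ! j = (c, h)" "reg n (ts ! i)"
  shows "\<exists>u. big (Seq (loop j (\<lambda>a. a = 1) (Seq (inc i) (on j (\<lambda>_. (2, Stay)))))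
     (on j (\<lambda>_. (0, MoveRight)))) ts (ts[j := (c(h := 0), h + 1), i := u]) \<and>
     reg (n + of_bool (c h = 1)) u"
proof (cases "c h = 1")
  case False
  then have "big (loop j (\<lambda>a. a = 1) (Seq (inc i) (on j (\<lambda>_. (2, Stay))))) ts ts"
    using assms by (intro big_loop_False) auto
  from big.Seq[OF this big_on[of j ts "\<lambda>_. (0, MoveRight)"]] show ?thesis
    using False assms by (intro exI[of _ "ts ! i"]) (simp add: list_update_swap)
next
  case True
  obtain u where u: "big (inc i) ts (ts[i := u])" "reg (Suc n) u"
    by (rule big_inc[OF assms(2,5)])
  let ?us = "ts[i := u, j := (c(h := 2), h)]"
  have 1: "big (Seq (inc i) (on j (\<lambda>_. (2, Stay)))) ts ?us"
    using big.Seq[OF u(1) big_on[of j _ "\<lambda>_. (2, Stay)"]] assms by simp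
  have "big (loop j (\<lambda>a. a = 1) (Seq (inc i) (on j (\<lambda>_. (2, Stay))))) ?us ?us"
    using assms by (intro big_loop_False) auto
  then have "big (loop j (\<lambda>a. a = 1) (Seq (inc i) (on j (\<lambda>_. (2, Stay))))) ts ?us"
    using assms True by (intro big_loop_True[OF _ _ 1]) auto
  from big.Seq[OF this big_on[of j ?us "\<lambda>_. (0, MoveRight)"]] show ?thesis
    using True assms u(2) by (intro exI[of _ u]) (simp add: list_update_swap)
qed

text \<open>The output of a simulated machine is recovered as its number of strokes, which depends
  neither on where the word stands on the tape nor on the other symbols around it.\<close>

lemma big_count:
  assumes "j < length ts" "i < length ts" "i \<noteq> j" "ts ! j = (c, h)" "reg n (ts ! i)"
    "h \<le> r" "\<forall>i. c i \<noteq> 0 \<longleftrightarrow> h \<le> i \<and> i < r"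
  shows "\<exists>t u. big (count j i) ts (ts[j := t, i := u]) \<and> reg 0 t \<and> reg (n + card {k. c k = 1}) u"
  using assms
proof (induction "nat (r - h)" arbitrary: h ts c n)
  case 0
  then have "h = r" by simp
  then have "c k = 0" for k using 0 by (metis linorder_not_le)
  then have c0: "c = (\<lambda>_. 0)" by blast
  then have "big (count j i) ts ts" unfolding count_def using 0
    by (intro big_loop_False) auto
  moreover have "ts[j := ts ! j, i := ts ! i] = ts" by simp
  moreover have "reg 0 (ts ! j)" using 0 c0 by (simp add: reg_def)
  ultimately show ?case using 0 c0 by (metis (mono_tags, lifting) Collect_empty_eq add_0_right card.empty zero_neq_one)
next
  case (Suc m)
  obtain u where u: "big (Seq (loop j (\<lambda>a. a = 1) (Seq (inc i) (on j (\<lambda>_. (2, Stay)))))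
     (on j (\<lambda>_. (0, MoveRight)))) ts (ts[j := (c(h := 0), h + 1), i := u])"
     "reg (n + of_bool (c h = 1)) u"
    using count_step[OF Suc.prems(1-5)] by blast
  let ?us = "ts[j := (c(h := 0), h + 1), i := u]"
  have "\<exists>t w. big (count j i) ?us ((?us)[j := t, i := w]) \<and> reg 0 t \<and>
      reg (n + of_bool (c h = 1) + card {k. (c(h := 0)) k = 1}) w"
  proof (rule Suc.hyps(1)[of "h + 1"])
    show "\<forall>k. (c(h := 0)) k \<noteq> 0 \<longleftrightarrow> h + 1 \<le> k \<and> k < r"
    proof
      fix k
      show "(c(h := 0)) k \<noteq> 0 \<longleftrightarrow> h + 1 \<le> k \<and> k < r"
        using Suc.prems(7)[rule_format, of k] by (cases "k = h") auto
    qed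
  qed (use Suc.prems(1-5) Suc.hyps(2) u(2) in \<open>simp_all add: fun_upd_def\<close>)
  then obtain t w where t: "big (count j i) ?us ((?us)[j := t, i := w])" "reg 0 t"
      "reg (n + of_bool (c h = 1) + card {k. (c(h := 0)) k = 1}) w" by blast
  have "finite {k. c k = 1}"
  proof (rule finite_subset)
    show "{k. c k = 1} \<subseteq> {h..<r}"
      using Suc.prems(7) by (metis (mono_tags, lifting) atLeastLessThan_iff mem_Collect_eq one_neq_zero subsetI)
  qed simp
  then have "card {k. c k = 1} = (if c h = 1 then Suc (card ({k. c k = 1} - {h})) else card {k. c k = 1})"
    using card.remove[of "{k. c k = 1}" h] by simp
  moreover have "{k. (c(h := 0)) k = 1} = {k. c k = 1} - {h}" by auto
  ultimately have "of_bool (c h = 1) + card {k. (c(h := 0)) k = 1} = card {k. c k = 1}"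
    by (cases "c h = 1") simp_all
  then have "reg (n + card {k. c k = 1}) w" using t(3) by (simp add: add.assoc)
  moreover have "nz (under (ts ! j))" using Suc.prems Suc.hyps(2) by auto
  then have "big (count j i) ts ((?us)[j := t, i := w])"
    using t(1) Suc.prems(1) unfolding count_def by (intro big_loop_True[OF _ _ u(1)])
  moreover have "(?us)[j := t, i := w] = ts[j := t, i := w]"
    using Suc.prems(3) by (simp add: list_update_swap)
  ultimately show ?case using t(2) by metis
qed

definition erase :: "nat \<Rightarrow> com" where
  "erase j = Seq (rewind j) (loop j nz (on j (\<lambda>_. (0, MoveRight))))"

lemma big_erase_aux:
  assumes "j < length ts" "ts ! j = (c, h)" "h \<le> r" "\<forall>i. c i \<noteq> 0 \<longleftrightarrow> h \<le> i \<and> i < r"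
  shows "\<exists>t. big (loop j nz (on j (\<lambda>_. (0, MoveRight)))) ts (ts[j := t]) \<and> reg 0 t"
  using assms
proof (induction "nat (r - h)" arbitrary: h ts c)
  case 0
  then have "h = r" by simp
  then have "c k = 0" for k using 0 by (metis linorder_not_le)
  then have c0: "c = (\<lambda>_. 0)" by blast
  then have "big (loop j nz (on j (\<lambda>_. (0, MoveRight)))) ts ts" using 0
    by (intro big_loop_False) auto
  moreover have "reg 0 (ts ! j)" using 0 c0 by (simp add: reg_def)
  ultimately show ?case by (intro exI[of _ "ts ! j"]) (simp only: list_update_id simp_thms)
next
  case (Suc m)
  have 1: "big (on j (\<lambda>_. (0, MoveRight))) ts (ts[j := (c(h := 0), h + 1)])"
    using big_on[of j ts "\<lambda>_. (0, MoveRight)"] Suc.prems by simp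
  have "\<exists>t. big (loop j nz (on j (\<lambda>_. (0, MoveRight)))) (ts[j := (c(h := 0), h + 1)])
       (ts[j := (c(h := 0), h + 1), j := t]) \<and> reg 0 t"
  proof (rule Suc.hyps(1)[of "h + 1"])
    show "\<forall>k. (c(h := 0)) k \<noteq> 0 \<longleftrightarrow> h + 1 \<le> k \<and> k < r"
    proof
      fix k
      show "(c(h := 0)) k \<noteq> 0 \<longleftrightarrow> h + 1 \<le> k \<and> k < r"
        using Suc.prems(4)[rule_format, of k] by (cases "k = h") auto
    qed
  qed (use Suc.prems(1-2) Suc.hyps(2) in \<open>simp_all add: fun_upd_def\<close>)
  moreover have "nz (under (ts ! j))" using Suc.prems Suc.hyps(2) by auto
  ultimately show ?case
    using big_loop_True[of j ts nz, OF Suc.prems(1) _ 1] by auto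
qed

lemma big_erase:
  assumes "j < length ts" "visited (ts ! j)"
  obtains t where "big (erase j) ts (ts[j := t])" "reg 0 t"
proof -
  obtain c h r where 1: "big (rewind j) ts (ts[j := (c, h)])"
    "h < r" "\<forall>i. c i \<noteq> 0 \<longleftrightarrow> h \<le> i \<and> i < r" by (rule big_rewind[OF assms])
  have "\<exists>t. big (loop j nz (on j (\<lambda>_. (0, MoveRight)))) (ts[j := (c, h)])
      (ts[j := (c, h), j := t]) \<and> reg 0 t"
    by (rule big_erase_aux) (use assms(1) 1 in auto)
  then obtain t where t: "big (loop j nz (on j (\<lambda>_. (0, MoveRight)))) (ts[j := (c, h)])
      (ts[j := (c, h), j := t])" "reg 0 t" by blast
  show thesis
    by (rule that[of t]) (use big.Seq[OF 1(1) t(1)] t(2) in \<open>simp_all add: erase_def\<close>)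
qed

definition erase_all :: "nat list \<Rightarrow> com" where
  "erase_all js = foldr (\<lambda>j. Seq (erase j)) js (Act stay)"

lemma big_erase_all:
  assumes "distinct js" "\<And>j. j \<in> set js \<Longrightarrow> j < length ts \<and> visited (ts ! j)"
  shows "\<exists>us. big (erase_all js) ts us \<and> length us = length ts \<and>
     (\<forall>j\<in>set js. reg 0 (us ! j)) \<and> (\<forall>j. j \<notin> set js \<longrightarrow> us ! j = ts ! j)"
  using assms
proof (induction js arbitrary: ts)
  case Nil
  show ?case using big.Act[of stay ts] tape_update_stay by (intro exI[of _ ts]) (simp add: erase_all_def)
next
  case (Cons j js)
  obtain t where t: "big (erase j) ts (ts[j := t])" "reg 0 t"
    using big_erase[of j ts] Cons.prems(2)[of j] by auto
  have "\<exists>us. big (erase_all js) (ts[j := t]) us \<and> length us = length (ts[j := t]) \<and>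
     (\<forall>i\<in>set js. reg 0 (us ! i)) \<and> (\<forall>i. i \<notin> set js \<longrightarrow> us ! i = (ts[j := t]) ! i)"
  proof (rule Cons.IH)
    fix i assume "i \<in> set js"
    then show "i < length (ts[j := t]) \<and> visited ((ts[j := t]) ! i)"
      using Cons.prems(1) Cons.prems(2)[of i] by (cases "i = j") auto
  qed (use Cons.prems in auto)
  then obtain us where us: "big (erase_all js) (ts[j := t]) us" "length us = length ts"
     "\<forall>i\<in>set js. reg 0 (us ! i)" "\<forall>i. i \<notin> set js \<longrightarrow> us ! i = (ts[j := t]) ! i" by auto
  have "big (erase_all (j # js)) ts us"
    using big.Seq[OF t(1) us(1)] by (simp add: erase_all_def)
  moreover have "reg 0 (us ! j)" using us(4) Cons.prems t(2) by simp
  ultimately show ?case using us by (intro exI[of _ us]) auto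
qed

subsection \<open>Simulating a machine on part of the tapes\<close>

text \<open>A called machine leaves arbitrary contents on its tapes. To be able to erase them, the
  simulation never writes the blank but a fresh symbol \<open>S\<close> in its place; then the visited
  cells are exactly the nonblank ones.\<close>

definition sim :: "nat \<Rightarrow> tape \<Rightarrow> tape \<Rightarrow> bool" where
  "sim S t u \<longleftrightarrow> visited u \<and> (\<exists>d. snd u = snd t + d \<and>
     (\<forall>i. fst t i < S \<and> fst u (i + d) = (if fst t i = 0 then fst u (i + d) else fst t i) \<and>
          (fst t i = 0 \<longrightarrow> fst u (i + d) = 0 \<or> fst u (i + d) = S)))"

definition unmask :: "nat \<Rightarrow> nat \<Rightarrow> nat" where
  "unmask S a = (if a = S then 0 else a)"

definition mask :: "nat \<Rightarrow> nat \<Rightarrow> nat" where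
  "mask S a = (if a = 0 then S else a)"

text \<open>A move may lead to a cell that was never seen before. Marking it at once keeps the
  nonblank cells an interval that contains the head.\<close>

definition mark :: "nat \<Rightarrow> tape \<Rightarrow> tape" where
  "mark S t = tape_update t (mask S (under t), Stay)"

lemma sim_under: "sim S t u \<Longrightarrow> unmask S (under u) = under t \<and> under t < S"
  unfolding sim_def unmask_def by (metis order_less_irrefl)

text \<open>Registers drift along their tapes as they change, so a simulated tape is represented
  only up to a displacement; at the start this is the position of the register.\<close>

lemma sim_mark:
  assumes "reg n u" "1 < S"
  shows "sim S (unary n, 0) (mark S u)"
proof -
  obtain c h where u: "u = (c, h)" by force
  have c: "c i = (if h \<le> i \<and> i < h + int n then 1 else 0)" for i
    using assms(1) by (auto simp: reg_def u)
  have m: "mark S u = (c(h := mask S (c h)), h)" by (simp add: mark_def u)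
  have "visited (mark S u)"
    unfolding visited_def m
    by (rule exI[of _ h], rule exI[of _ "max (h + int n) (h + 1)"]) (use assms(2) in \<open>auto simp: c mask_def\<close>)
  then show ?thesis
    unfolding sim_def m
    by (intro conjI exI[of _ h]) (use assms(2) in \<open>auto simp: c mask_def unary_def\<close>)
qed

text \<open>A move leaves the interval of nonblank cells by at most one cell, which is then marked.
  Inside the interval no gap arises, since the written symbol is not blank.\<close>

lemma visited_move:
  assumes "visited (c, h)" "a \<noteq> 0" "0 < S"
  shows "visited (mark S (tape_update (c, h) (a, m)))"
proof -
  from assms(1) obtain l r where lr: "l \<le> h" "h < r" "\<And>i. c i \<noteq> 0 \<longleftrightarrow> l \<le> i \<and> i < r"
    by (auto simp: visited_def)
  define h' where "h' = (case m of MoveLeft \<Rightarrow> h - 1 | Stay \<Rightarrow> h | MoveRight \<Rightarrow> h + 1)"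
  define c' where "c' = c(h := a)"
  have h': "h - 1 \<le> h'" "h' \<le> h + 1" by (auto simp: h'_def split: head_move.splits)
  have c': "c' i \<noteq> 0 \<longleftrightarrow> l \<le> i \<and> i < r" for i
    using lr assms(2) by (auto simp: c'_def)
  have "mark S (tape_update (c, h) (a, m)) = (c'(h' := mask S (c' h')), h')"
    by (simp add: mark_def h'_def c'_def)
  moreover have "(c'(h' := mask S (c' h'))) i \<noteq> 0 \<longleftrightarrow> min l h' \<le> i \<and> i < max r (h' + 1)" for i
  proof (cases "i = h'")
    case True
    then show ?thesis using assms(3) by (simp add: mask_def less_max_iff_disj)
  next
    case False
    then show ?thesis using c'[of i] h' lr(1,2) by auto
  qed
  ultimately show ?thesis
    unfolding visited_def by (intro exI[of _ "min l h'"] exI[of _ "max r (h' + 1)"]) simp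
qed

lemma sim_step:
  assumes "sim S t u" "a < S"
  shows "sim S (tape_update t (a, m)) (mark S (tape_update u (mask S a, m)))"
proof -
  obtain c h c' h' where tu: "t = (c, h)" "u = (c', h')" by force
  from assms(1) obtain d where d: "h' = h + d"
    "\<And>i. c i < S" "\<And>i. c i \<noteq> 0 \<Longrightarrow> c' (i + d) = c i"
    "\<And>i. c i = 0 \<Longrightarrow> c' (i + d) = 0 \<or> c' (i + d) = S"
    unfolding sim_def tu by (metis fst_conv snd_conv)
  have S: "0 < S" using assms(2) by simp
  have v: "visited (mark S (tape_update (c', h') (mask S a, m)))"
    using assms(1) S by (intro visited_move) (auto simp: sim_def tu mask_def)
  define k where "k = (case m of MoveLeft \<Rightarrow> h - 1 | Stay \<Rightarrow> h | MoveRight \<Rightarrow> h + 1)"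
  have k: "(case m of MoveLeft \<Rightarrow> h' - 1 | Stay \<Rightarrow> h' | MoveRight \<Rightarrow> h' + 1) = k + d"
    by (auto simp: k_def d(1) split: head_move.splits)
  define b where "b = c'(h' := mask S a)"
  have m: "mark S (tape_update (c', h') (mask S a, m)) = (b(k + d := mask S (b (k + d))), k + d)"
    by (simp add: mark_def k b_def)
  have b: "b (i + d) = (if (c(h := a)) i = 0 then b (i + d) else (c(h := a)) i) \<and>
      ((c(h := a)) i = 0 \<longrightarrow> b (i + d) = 0 \<or> b (i + d) = S)" for i
    using d(3,4)[of i] by (auto simp: b_def mask_def d(1))
  show ?thesis
    unfolding sim_def tu
  proof (intro conjI exI[of _ d] allI)
    fix i
    show "fst (tape_update (c, h) (a, m)) i < S" using d(2) assms(2) by simp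
    define x where "x = fst (tape_update (c, h) (a, m)) i"
    define y where "y = fst (mark S (tape_update (c', h') (mask S a, m))) (i + d)"
    have "y = (if i = k then mask S (b (k + d)) else b (i + d))" unfolding y_def m by simp
    moreover have "(c(h := a)) i = x" by (simp add: x_def)
    moreover define z where "z = b (i + d)"
    ultimately have "y = z \<or> y = mask S z" "x \<noteq> 0 \<Longrightarrow> z = x" "x = 0 \<Longrightarrow> z = 0 \<or> z = S"
      using b[of i] by (auto split: if_splits)
    then have "y = (if x = 0 then y else x)" "x = 0 \<longrightarrow> y = 0 \<or> y = S"
      by (cases "x = 0"; auto simp: mask_def)+
    then show "fst (mark S (tape_update (c', h') (mask S a, m))) (i + d) =
      (if fst (tape_update (c, h) (a, m)) i = 0
       then fst (mark S (tape_update (c', h') (mask S a, m))) (i + d)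
       else fst (tape_update (c, h) (a, m)) i)"
      and "fst (tape_update (c, h) (a, m)) i = 0 \<longrightarrow>
        fst (mark S (tape_update (c', h') (mask S a, m))) (i + d) = 0 \<or>
        fst (mark S (tape_update (c', h') (mask S a, m))) (i + d) = S"
      unfolding x_def y_def .
  qed (use v m in \<open>simp_all add: k_def\<close>)
qed

text \<open>Tape \<open>1\<close> holds the state of the simulated machine, tapes \<open>2, \<dots>, k + 1\<close> are its tapes.\<close>

definition sim_act :: "tm \<Rightarrow> nat list \<Rightarrow> act list" where
  "sim_act T as = (let k = num_tapes T; S = num_symbols T;
      bs = map (unmask S) (take k (drop 2 as)); (q, acts) = transition T (as ! 1) bs
    in if as ! 1 < num_states T \<and> set bs \<subseteq> {..<S}
       then (as ! 0, Stay) # (q, Stay) # map (\<lambda>(a, m). (mask S a, m)) acts @ stay (drop (k + 2) as)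
       else stay as)"

definition mark_act :: "tm \<Rightarrow> nat list \<Rightarrow> act list" where
  "mark_act T as = (let k = num_tapes T; S = num_symbols T
    in (as ! 0, Stay) # (as ! 1, Stay) # map (\<lambda>a. (mask S a, Stay)) (take k (drop 2 as)) @
       stay (drop (k + 2) as))"

text \<open>The whole state is one symbol in one cell. State 0 is the blank, so an empty register
  already represents the initial state of the simulated machine.\<close>

definition state_tape :: "int \<Rightarrow> nat \<Rightarrow> tape" where
  "state_tape h q = ((\<lambda>_. 0)(h := q), h)"

lemma heads_append: "heads (ts @ us) = heads ts @ heads us"
  by (simp add: heads_def)

lemma heads_Cons: "heads (t # us) = under t # heads us"
  by (simp add: heads_def case_prod_beta)

lemma big_mark_act:
  assumes "length us = num_tapes T"
  shows "big (Act (mark_act T)) (t # q # us @ rs) (t # q # map (mark (num_symbols T)) us @ rs)"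
proof -
  let ?S = "num_symbols T"
  have 1: "mark_act T (heads (t # q # us @ rs)) = (under t, Stay) # (under q, Stay) #
      map (\<lambda>a. (mask ?S a, Stay)) (heads us) @ stay (heads rs)"
    using assms by (simp add: mark_act_def heads_append heads_Cons Let_def numeral_2_eq_2)
  have 2: "map2 tape_update us (map (\<lambda>a. (mask ?S a, Stay)) (heads us)) = map (mark ?S) us"
    by (rule nth_equalityI) (simp_all add: mark_def)
  show ?thesis
    using big.Act[of "mark_act T" "t # q # us @ rs"] unfolding 1
    by (simp add: 2 tape_update_stay)
qed

lemma big_sim_act:
  assumes "wf_tm T" "length us = num_tapes T" "list_all2 (sim (num_symbols T)) vs us"
    "q < num_states T" "transition T q (heads vs) = (q', acts)"
  shows "big (Act (sim_act T)) (t # state_tape h q # us @ rs) (t # state_tape h q' #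
      map2 tape_update us (map (\<lambda>(a, m). (mask (num_symbols T) a, m)) acts) @ rs)"
proof -
  let ?S = "num_symbols T"
  have len: "length vs = length us" using assms(3) by (simp add: list_all2_lengthD)
  have heads: "map (unmask ?S) (heads us) = heads vs"
    by (rule nth_equalityI) (use assms(3) len in \<open>auto simp: list_all2_conv_all_nth dest: sim_under\<close>)
  have im: "unmask ?S ` set (heads us) = set (heads vs)"
    using arg_cong[OF heads, of set] by (simp only: list.set_map)
  have "set (heads vs) \<subseteq> {..<?S}"
    using assms(3) len by (fastforce simp: list_all2_conv_all_nth in_set_conv_nth dest: sim_under)
  then have 1: "sim_act T (heads (t # state_tape h q # us @ rs)) =
     (under t, Stay) # (q', Stay) # map (\<lambda>(a, m). (mask ?S a, m)) acts @ stay (heads rs)"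
    using assms(2,4,5) heads im
    by (simp add: sim_act_def heads_append heads_Cons Let_def numeral_2_eq_2 state_tape_def)
  have "length acts = length us"
    using assms(1,2,4,5) len \<open>set (heads vs) \<subseteq> {..<?S}\<close> unfolding wf_tm_def
    by (metis length_heads)
  then show ?thesis
    using big.Act[of "sim_act T" "t # state_tape h q # us @ rs"] unfolding 1
    by (simp add: tape_update_stay state_tape_def)
qed

definition sim_loop :: "tm \<Rightarrow> com" where
  "sim_loop T = loop 1 (\<lambda>a. a \<noteq> 1) (Seq (Act (sim_act T)) (Act (mark_act T)))"

lemma big_sim_loop:
  assumes "wf_tm T" "length us = num_tapes T" "list_all2 (sim (num_symbols T)) vs us"
    "q < num_states T" "(tm_step T ^^ n) (q, vs) = (1, ws)"
  shows "\<exists>us'. big (sim_loop T) (t # state_tape h q # us @ rs) (t # state_tape h 1 # us' @ rs) \<and>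
     length us' = num_tapes T \<and> list_all2 (sim (num_symbols T)) ws us'"
  using assms(2-)
proof (induction n arbitrary: q vs us)
  case 0
  then have "big (sim_loop T) (t # state_tape h q # us @ rs) (t # state_tape h 1 # us @ rs)"
    unfolding sim_loop_def by (auto intro!: big_loop_False simp: state_tape_def)
  then show ?case using 0 by auto
next
  case (Suc n)
  let ?S = "num_symbols T"
  show ?case
  proof (cases "q = 1")
    case True
    \<comment> \<open>Halting configurations are fixed points, so the remaining steps of
      \<open>T\<close> are idle.\<close>
    have "(tm_step T ^^ m) (1, vs) = (1, vs)" for m by (induction m) simp_all
    with Suc.prems(4) True have "ws = vs" by (metis prod.inject)
    moreover have "big (sim_loop T) (t # state_tape h q # us @ rs) (t # state_tape h 1 # us @ rs)"
      unfolding sim_loop_def True by (auto intro!: big_loop_False simp: state_tape_def)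
    ultimately show ?thesis using Suc.prems by auto
  next
    case False
    obtain q' acts where tr: "transition T q (heads vs) = (q', acts)" by force
    let ?vs = "map2 tape_update vs acts"
    let ?us = "map2 tape_update us (map (\<lambda>(a, m). (mask ?S a, m)) acts)"
    have len: "length vs = length us" using Suc.prems(2) by (simp add: list_all2_lengthD)
    have "set (heads vs) \<subseteq> {..<?S}"
      using Suc.prems(2) len by (fastforce simp: list_all2_conv_all_nth in_set_conv_nth dest: sim_under)
    then have wf: "q' < num_states T" "length acts = length us" "fst ` set acts \<subseteq> {..<?S}"
      using assms(1) Suc.prems(1,3) tr len unfolding wf_tm_def by (metis length_heads)+
    have sims: "list_all2 (sim ?S) ?vs (map (mark ?S) ?us)"
      unfolding list_all2_conv_all_nth
    proof (intro conjI allI impI)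
      fix i assume "i < length ?vs"
      then have i: "i < length us" by (simp add: len wf(2))
      then have "fst (acts ! i) < ?S" using wf(2,3) by (metis image_subset_iff lessThan_iff nth_mem)
      moreover have "sim ?S (vs ! i) (us ! i)"
        using Suc.prems(2) i len by (simp add: list_all2_conv_all_nth)
      ultimately show "sim ?S (?vs ! i) (map (mark ?S) ?us ! i)"
        using sim_step[of ?S "vs ! i" "us ! i" "fst (acts ! i)" "snd (acts ! i)"] i wf(2) len
        by (simp add: case_prod_beta)
    qed (simp add: len wf(2))
    have "tm_step T (q, vs) = (q', ?vs)"
      using False tr by (simp add: heads_def)
    then have "(tm_step T ^^ n) (q', ?vs) = (1, ws)"
      using Suc.prems(4) by (simp add: funpow_swap1 del: tm_step.simps)
    from Suc.IH[OF _ sims wf(1) this] obtain us' where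
      us': "big (sim_loop T) (t # state_tape h q' # map (mark ?S) ?us @ rs) (t # state_tape h 1 # us' @ rs)"
      "length us' = num_tapes T" "list_all2 (sim ?S) ws us'"
      using Suc.prems(1) wf(2) by auto
    have body: "big (Seq (Act (sim_act T)) (Act (mark_act T))) (t # state_tape h q # us @ rs)
       (t # state_tape h q' # map (mark ?S) ?us @ rs)"
      by (rule big.Seq[OF big_sim_act[OF assms(1) Suc.prems(1,2,3) tr] big_mark_act])
         (use Suc.prems(1) wf(2) in simp)
    have "big (sim_loop T) (t # state_tape h q # us @ rs) (t # state_tape h 1 # us' @ rs)"
      unfolding sim_loop_def
      by (rule big_loop_True[of 1 _ "\<lambda>a. a \<noteq> 1", OF _ _ body us'(1)[unfolded sim_loop_def]])
         (use False in \<open>simp_all add: state_tape_def\<close>)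
    with us' show ?thesis by blast
  qed
qed

definition call :: "tm \<Rightarrow> nat \<Rightarrow> com" where
  "call T r = Seq (transfer r 2) (Seq (Act (mark_act T)) (Seq (sim_loop T)
     (Seq (on 1 (\<lambda>_. (0, Stay))) (Seq (rewind 2) (Seq (count 2 r) (erase_all [3..<num_tapes T + 2]))))))"

text \<open>The tapes from 1 to \<open>num_tapes T + 1\<close> are blank before the call and blank
  again after it; this is what allows calls to be repeated.\<close>

lemma rel_call:
  assumes T: "wf_tm T" "tm_outputs T (v r) m"
    and v: "rel K t v ts" "\<And>j. 0 < j \<Longrightarrow> j < num_tapes T + 2 \<Longrightarrow> v j = 0"
    and r: "num_tapes T + 2 \<le> r" "r < K"
  shows "\<exists>us. big (call T r) ts us \<and> rel K t (v(r := m)) us"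
proof -
  let ?k = "num_tapes T" and ?S = "num_symbols T"
  have k: "1 \<le> ?k" and S: "2 \<le> ?S" and q: "2 \<le> num_states T" using T(1) by (auto simp: wf_tm_def)
  obtain us where us: "big (transfer r 2) ts us" "rel K t (v(r := 0, 2 := v r)) us"
    using rel_transfer[OF v(1), of r 2] r k v(2)[of 2] by auto
  define w where "w = v(r := 0, 2 := v r)"
  have us_reg: "reg (w j) (us ! j)" if "0 < j" "j < K" for j
    using us(2) that by (simp add: rel_def w_def)
  have len: "length us = K" "us ! 0 = t" using us(2) by (auto simp: rel_def)
  obtain h where h: "us ! 1 = state_tape h 0"
  proof -
    have "reg 0 (us ! 1)" using us_reg[of 1] r k v(2)[of 1] by (simp add: w_def)
    then have "us ! 1 = state_tape (snd (us ! 1)) 0"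
      by (intro prod_eqI ext) (simp_all add: reg_def state_tape_def)
    then show thesis by (rule that)
  qed
  define xs where "xs = take ?k (drop 2 us)"
  define rs where "rs = drop (?k + 2) us"
  have us_eq: "us = t # state_tape h 0 # xs @ rs"
  proof -
    have "rs = drop ?k (drop 2 us)" by (simp add: rs_def)
    then have "xs @ rs = drop 2 us" by (simp only: xs_def append_take_drop_id)
    then have "us = take 2 us @ xs @ rs" by simp
    moreover have "take 2 us = [us ! 0, us ! 1]"
      using len r k by (simp add: numeral_2_eq_2 take_Suc_conv_app_nth)
    ultimately show ?thesis using h len by simp
  qed
  have lxs: "length xs = ?k" and lrs: "length rs = K - (?k + 2)"
    using len r by (auto simp: xs_def rs_def)
  have m1: "big (Act (mark_act T)) us (t # state_tape h 0 # map (mark ?S) xs @ rs)"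
    unfolding us_eq by (rule big_mark_act[OF lxs])
  have init: "tm_init T (v r) = (0, (unary (v r), 0) # replicate (?k - 1) (\<lambda>_. 0, 0))"
    by (simp add: tm_init_def)
  have sims: "list_all2 (sim ?S) ((unary (v r), 0) # replicate (?k - 1) (\<lambda>_. 0, 0)) (map (mark ?S) xs)"
    unfolding list_all2_conv_all_nth
  proof (intro conjI allI impI)
    fix i assume "i < length ((unary (v r), 0::int) # replicate (?k - 1) (\<lambda>_. 0::nat, 0))"
    then have i: "i < ?k" using k by simp
    have "xs ! i = us ! (i + 2)" using i len r by (simp add: xs_def add.commute)
    moreover have "w (i + 2) = (if i = 0 then v r else 0)"
      using i v(2)[of "i + 2"] r by (auto simp: w_def)
    ultimately have "reg (if i = 0 then v r else 0) (xs ! i)"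
      using us_reg[of "i + 2"] i r by auto
    from sim_mark[OF this, of ?S] S have "sim ?S (unary (if i = 0 then v r else 0), 0) (mark ?S (xs ! i))"
      by simp
    moreover have "unary 0 = (\<lambda>_. 0)" by (auto simp: unary_def)
    ultimately show "sim ?S (((unary (v r), 0) # replicate (?k - 1) (\<lambda>_. 0, 0)) ! i) (map (mark ?S) xs ! i)"
      using i lxs by (cases i) auto
  qed (use k lxs in simp)
  from T(2) obtain n z zs where n: "(tm_step T ^^ n) (0, (unary (v r), 0) # replicate (?k - 1) (\<lambda>_. 0, 0)) =
     (1, (unary m, z) # zs)"
    unfolding tm_outputs_def init by blast
  obtain ys where ys: "big (sim_loop T) (t # state_tape h 0 # map (mark ?S) xs @ rs)
      (t # state_tape h 1 # ys @ rs)" "length ys = ?k" "list_all2 (sim ?S) ((unary m, z) # zs) ys"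
    using big_sim_loop[OF T(1) _ sims _ n, of t h rs] lxs q by (auto simp del: One_nat_def)
  define A where "A = t # state_tape h 0 # ys @ rs"
  have m3: "big (on 1 (\<lambda>_. (0, Stay))) (t # state_tape h 1 # ys @ rs) A"
    using big_on[of 1 "t # state_tape h 1 # ys @ rs" "\<lambda>_. (0, Stay)"] by (simp add: state_tape_def A_def)
  have la: "length A = K" using r by (simp add: ys(2) lrs A_def)
  have A0: "A ! 0 = t" and A1: "A ! 1 = state_tape h 0" by (simp_all add: A_def)
  have ay: "A ! (i + 2) = ys ! i" if "i < ?k" for i using that ys(2) by (simp add: nth_append A_def)
  have ar: "A ! j = us ! j" if "?k + 2 \<le> j" "j < K" for j
  proof -
    have "\<not> j - 2 < ?k" using that by linarith
    then show ?thesis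
      using that ys(2) lxs by (simp add: us_eq nth_append nth_Cons' numeral_2_eq_2 A_def)
  qed
  have vis: "visited (ys ! i)" if "i < ?k" for i
    using ys(2,3) that by (auto simp: list_all2_conv_all_nth sim_def)
  have sim0: "sim ?S (unary m, z) (ys ! 0)"
    using ys(2,3) k by (auto simp: list_all2_Cons1)
  have a2: "A ! 2 = ys ! 0" using ay[of 0] k by (simp add: numeral_2_eq_2)
  have v2: "visited (A ! 2)" unfolding a2 using vis k by simp
  have l2: "2 < length A" using la r k by linarith
  obtain c g e where c: "big (rewind 2) A (A[2 := (c, g)])" "c = fst (A ! 2)" "g < e"
      "\<forall>i. c i \<noteq> 0 \<longleftrightarrow> g \<le> i \<and> i < e"
    by (rule big_rewind[OF l2 v2], rule that)
  have card: "card {i. c i = 1} = m"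
  proof -
    \<comment> \<open>Substituted blanks carry the symbol \<open>?S\<close>, which is at least 2, so
      the cells with symbol 1 are those of \<open>unary m\<close>, displaced by
      \<open>d\<close>.\<close>
    from sim0 obtain d where d: "\<And>i. fst (ys ! 0) (i + d) = (if unary m i = 0 then fst (ys ! 0) (i + d) else unary m i)"
         "\<And>i. unary m i = 0 \<Longrightarrow> fst (ys ! 0) (i + d) = 0 \<or> fst (ys ! 0) (i + d) = ?S"
      unfolding sim_def fst_conv by blast
    have "c (i + d) = 1 \<longleftrightarrow> unary m i = 1" for i
      using d(1,2)[of i] S c(2) a2 by (auto simp: unary_def split: if_splits)
    from this[of "i - d" for i] have "{i. c i = 1} = {d..<d + int m}"
      by (auto simp: unary_def split: if_splits)
    then show ?thesis by simp
  qed
  have "\<exists>x u. big (count 2 r) (A[2 := (c, g)]) (A[2 := (c, g), 2 := x, r := u]) \<and> reg 0 x \<and>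
      reg (0 + card {k. c k = 1}) u"
  proof (rule big_count[where c = c and h = g and r = e])
    show "2 < length (A[2 := (c, g)])" "r < length (A[2 := (c, g)])" using l2 la r by simp_all
    show "(A[2 := (c, g)]) ! 2 = (c, g)" by (rule nth_list_update_eq[OF l2])
    show "r \<noteq> 2" using r k by linarith
    show "reg 0 ((A[2 := (c, g)]) ! r)"
    proof -
      have "r \<noteq> 2" using r k by linarith
      then have "(A[2 := (c, g)]) ! r = us ! r"
        using ar[OF r] by (metis nth_list_update_neq)
      then show ?thesis using us_reg[of r] r k by (simp add: w_def)
    qed
  qed (use c in simp_all)
  then obtain x u where xu: "big (count 2 r) (A[2 := (c, g)]) (A[2 := x, r := u])"
      "reg 0 x" "reg m u" unfolding card list_update_overwrite add_0 by blast
  define B where "B = A[2 := x, r := u]"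
  have lb: "length B = K" by (simp add: B_def la)
  have r2: "r \<noteq> 2" "r \<noteq> 0" "r \<noteq> 1" using r k by linarith+
  have B: "B ! 2 = x" "B ! r = u" "\<And>j. j \<noteq> 2 \<Longrightarrow> j \<noteq> r \<Longrightarrow> B ! j = A ! j"
    using l2 la r r2 by (simp_all add: B_def)
  have "\<exists>us'. big (erase_all [3..<?k + 2]) B us' \<and> length us' = length B \<and>
     (\<forall>j\<in>set [3..<?k + 2]. reg 0 (us' ! j)) \<and> (\<forall>j. j \<notin> set [3..<?k + 2] \<longrightarrow> us' ! j = B ! j)"
  proof (rule big_erase_all)
    fix j assume "j \<in> set [3..<?k + 2]"
    then have j: "3 \<le> j" "j < ?k + 2" "j - 2 < ?k" by auto
    then have "j = j - 2 + 2" by linarith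
    then have "A ! j = ys ! (j - 2)" using ay[OF j(3)] by metis
    with j show "j < length B \<and> visited (B ! j)"
      using r lb B(3)[of j] vis[of "j - 2"] by simp
  qed simp
  then obtain fs where fs: "big (erase_all [3..<?k + 2]) B fs" "length fs = K"
     "\<And>j. 3 \<le> j \<Longrightarrow> j < ?k + 2 \<Longrightarrow> reg 0 (fs ! j)"
     "\<And>j. \<not> (3 \<le> j \<and> j < ?k + 2) \<Longrightarrow> fs ! j = B ! j"
    unfolding lb set_upt Ball_def atLeastLessThan_iff by blast
  have "big (call T r) ts fs"
    unfolding call_def
    by (rule big.Seq[OF us(1) big.Seq[OF m1 big.Seq[OF ys(1) big.Seq[OF m3 big.Seq[OF c(1)
        big.Seq[OF xu(1) fs(1)[unfolded B_def]]]]]]])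
  moreover have "rel K t (v(r := m)) fs"
    unfolding rel_def
  proof (intro conjI allI impI)
    show "fs ! 0 = t" using fs(4)[of 0] r2 B(3)[of 0] A0 by simp
    fix j assume j: "0 < j \<and> j < K"
    consider "j = 1" | "j = 2" | "3 \<le> j" "j < ?k + 2" | "j = r" | "?k + 2 \<le> j" "j \<noteq> r"
      using j k by linarith
    then show "reg ((v(r := m)) j) (fs ! j)"
    proof cases
      case 1
      have "reg 0 (state_tape h 0)" by (simp add: reg_def state_tape_def)
      then show ?thesis using fs(4)[of 1] r2 B(3)[of 1] A1 1 v(2)[of 1] by simp
    next
      case 2
      then show ?thesis using fs(4)[of 2] r2 B(1) k xu(2) v(2)[of 2] by simp
    next
      case 3
      then show ?thesis using fs(3)[of j] r v(2)[of j] by simp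
    next
      case 4
      then show ?thesis using fs(4)[of j] r B(2) xu(3) by simp
    next
      case 5
      then show ?thesis using fs(4)[of j] ar[of j] B(3)[of j] us_reg[of j] j k by (simp add: w_def)
    qed
  qed (use fs(2) r in simp_all)
  ultimately show ?thesis by blast
qed

subsection \<open>A register language\<close>

text \<open>\<open>RCall\<close> queries the fixed function \<open>f\<close> as an oracle. At this
  level no tape and no head is visible any more.\<close>

datatype rcom = RInc nat | RDec nat | RSeq rcom rcom | RWhile nat rcom | RCall nat

inductive rbig :: "(nat \<Rightarrow> nat) \<Rightarrow> rcom \<Rightarrow> (nat \<Rightarrow> nat) \<Rightarrow> (nat \<Rightarrow> nat) \<Rightarrow> bool" for f where
  RInc: "rbig f (RInc i) \<sigma> (\<sigma>(i := Suc (\<sigma> i)))"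
| RDec: "rbig f (RDec i) \<sigma> (\<sigma>(i := \<sigma> i - 1))"
| RSeq: "rbig f c \<sigma> \<sigma>' \<Longrightarrow> rbig f d \<sigma>' \<sigma>'' \<Longrightarrow> rbig f (RSeq c d) \<sigma> \<sigma>''"
| RWhileF: "\<sigma> i = 0 \<Longrightarrow> rbig f (RWhile i c) \<sigma> \<sigma>"
| RWhileT: "\<sigma> i \<noteq> 0 \<Longrightarrow> rbig f c \<sigma> \<sigma>' \<Longrightarrow> rbig f (RWhile i c) \<sigma>' \<sigma>'' \<Longrightarrow>
    rbig f (RWhile i c) \<sigma> \<sigma>''"
| RCall: "rbig f (RCall i) \<sigma> (\<sigma>(i := f (\<sigma> i)))"

text \<open>Any strict upper bound for the register indices can fix the number of tapes; sums serve
  as well as maxima and keep the side conditions linear.\<close>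

fun bound :: "rcom \<Rightarrow> nat" where
  "bound (RInc i) = Suc i"
| "bound (RDec i) = Suc i"
| "bound (RSeq c d) = bound c + bound d"
| "bound (RWhile i c) = Suc i + bound c"
| "bound (RCall i) = Suc i"

fun translate :: "tm \<Rightarrow> rcom \<Rightarrow> com" where
  "translate T (RInc i) = inc (num_tapes T + 2 + i)"
| "translate T (RDec i) = dec (num_tapes T + 2 + i)"
| "translate T (RSeq c d) = Seq (translate T c) (translate T d)"
| "translate T (RWhile i c) = loop (num_tapes T + 2 + i) nz (translate T c)"
| "translate T (RCall i) = call T (num_tapes T + 2 + i)"

definition val :: "tm \<Rightarrow> (nat \<Rightarrow> nat) \<Rightarrow> nat \<Rightarrow> nat" where
  "val T \<sigma> j = (if j < num_tapes T + 2 then 0 else \<sigma> (j - (num_tapes T + 2)))"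

lemma val_update: "val T (\<sigma>(i := n)) = (val T \<sigma>)(num_tapes T + 2 + i := n)"
  by (auto simp: val_def fun_eq_iff)

lemma val_reg [simp]: "val T \<sigma> (num_tapes T + 2 + i) = \<sigma> i"
  by (simp add: val_def)

lemma rbig_translate:
  assumes "wf_tm T" "\<And>n. tm_outputs T n (f n)"
    and "rbig f c \<sigma> \<sigma>'" "num_tapes T + 2 + bound c \<le> K" "rel K t (val T \<sigma>) ts"
  shows "\<exists>us. big (translate T c) ts us \<and> rel K t (val T \<sigma>') us"
  using assms(3-)
proof (induction arbitrary: ts rule: rbig.induct)
  case (RInc i \<sigma>)
  then show ?case
    using rel_inc[of K t "val T \<sigma>" ts "num_tapes T + 2 + i"]
    unfolding val_update val_reg translate.simps bound.simps by (metis Suc_le_eq add_Suc_right add_gr_0 zero_less_numeral)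
next
  case (RDec i \<sigma>)
  then show ?case
    using rel_dec[of K t "val T \<sigma>" ts "num_tapes T + 2 + i"]
    unfolding val_update val_reg translate.simps bound.simps by (metis Suc_le_eq add_Suc_right add_gr_0 zero_less_numeral)
next
  case (RSeq c \<sigma> \<sigma>' d \<sigma>'')
  obtain us where us: "big (translate T c) ts us" "rel K t (val T \<sigma>') us"
    using RSeq.IH(1)[of ts] RSeq.prems by auto
  obtain vs where "big (translate T d) us vs" "rel K t (val T \<sigma>'') vs"
    using RSeq.IH(2)[of us] RSeq.prems us by auto
  with us(1) show ?case by (auto intro: big.Seq)
next
  case (RWhileF \<sigma> i c)
  then have "big (translate T (RWhile i c)) ts ts"
    using rel_under[OF RWhileF.prems(2), of "num_tapes T + 2 + i"]
    unfolding val_reg translate.simps by (intro big_loop_False) (auto simp: rel_def)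
  with RWhileF show ?case by blast
next
  case (RWhileT \<sigma> i c \<sigma>' \<sigma>'')
  obtain us where us: "big (translate T c) ts us" "rel K t (val T \<sigma>') us"
    using RWhileT.IH(1)[of ts] RWhileT.prems by auto
  obtain vs where vs: "big (translate T (RWhile i c)) us vs" "rel K t (val T \<sigma>'') vs"
    using RWhileT.IH(2)[of us] RWhileT.prems us by auto
  have "under (ts ! (num_tapes T + 2 + i)) = 0 \<longleftrightarrow> \<sigma> i = 0"
    using rel_under[OF RWhileT.prems(2), of "num_tapes T + 2 + i"] RWhileT.prems(1)
    unfolding val_reg by simp
  then have nz: "nz (under (ts ! (num_tapes T + 2 + i)))" using RWhileT.hyps(1) by blast
  have "big (translate T (RWhile i c)) ts vs"
    unfolding translate.simps
    by (rule big_loop_True[of _ _ nz, OF _ nz us(1) vs(1)[unfolded translate.simps]])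
       (use RWhileT.prems in \<open>simp add: rel_def\<close>)
  with vs show ?case by blast
next
  case (RCall i \<sigma>)
  show ?case
    unfolding val_update translate.simps
    by (rule rel_call[OF assms(1) _ RCall.prems(2)])
       (use assms(2)[of "\<sigma> i"] RCall.prems(1) in \<open>simp_all add: val_def\<close>)
qed

section \<open>Input and output on the first tape\<close>

definition read_input :: "nat \<Rightarrow> com" where
  "read_input r = Seq (loop 0 nz (Seq (inc r) (on 0 (\<lambda>a. (a, MoveRight)))))
     (Seq (on 0 (\<lambda>a. (a, MoveLeft))) (Seq (loop 0 nz (on 0 (\<lambda>_. (0, MoveLeft))))
        (on 0 (\<lambda>a. (a, MoveRight)))))"

definition write_output :: "nat \<Rightarrow> com" where
  "write_output r = loop r nz (Seq (dec r) (on 0 (\<lambda>_. (1, MoveRight))))"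

lemma rel_read_aux1:
  assumes "rel K (unary n, int m) v ts" "m \<le> n" "0 < r" "r < K"
  shows "\<exists>us. big (loop 0 nz (Seq (inc r) (on 0 (\<lambda>a. (a, MoveRight))))) ts us \<and>
     rel K (unary n, int n) (v(r := v r + (n - m))) us"
  using assms
proof (induction "n - m" arbitrary: m v ts)
  case 0
  then have "big (loop 0 nz (Seq (inc r) (on 0 (\<lambda>a. (a, MoveRight))))) ts ts"
    by (intro big_loop_False) (auto simp: rel_def unary_def)
  then show ?case using 0 by (intro exI[of _ ts]) simp
next
  case (Suc d)
  obtain us where us: "big (inc r) ts us" "rel K (unary n, int m) (v(r := Suc (v r))) us"
    using rel_inc[OF Suc.prems(1,3,4)] .
  obtain vs where vs: "big (on 0 (\<lambda>a. (a, MoveRight))) us vs"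
      "rel K (tape_update (unary n, int m) (under (unary n, int m), MoveRight)) (v(r := Suc (v r))) vs"
    using rel_on_0[OF us(2)] by blast
  have "rel K (unary n, int (Suc m)) (v(r := Suc (v r))) vs"
    using vs(2) by (simp add: add.commute)
  moreover have "d = n - Suc m" "Suc m \<le> n" using Suc.hyps(2) by linarith+
  ultimately obtain ws where ws:
    "big (loop 0 nz (Seq (inc r) (on 0 (\<lambda>a. (a, MoveRight))))) vs ws"
    "rel K (unary n, int n) ((v(r := Suc (v r)))(r := (v(r := Suc (v r))) r + (n - Suc m))) ws"
    using Suc.hyps(1)[of "Suc m" "v(r := Suc (v r))" vs] Suc.prems(3,4) by blast
  have e: "(v(r := Suc (v r)))(r := (v(r := Suc (v r))) r + (n - Suc m)) = v(r := v r + (n - m))"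
  proof -
    have "Suc (v r) + (n - Suc m) = v r + (n - m)" using Suc.hyps(2) by linarith
    then show ?thesis by (simp only: fun_upd_upd fun_upd_same)
  qed
  have "big (loop 0 nz (Seq (inc r) (on 0 (\<lambda>a. (a, MoveRight))))) ts ws"
    by (rule big_loop_True[of _ _ nz, OF _ _ big.Seq[OF us(1) vs(1)] ws(1)])
       (use Suc.prems(1) Suc.hyps(2) in \<open>auto simp: rel_def unary_def\<close>)
  then show ?case using ws(2) unfolding e by blast
qed

lemma rel_read_aux2:
  assumes "rel K (unary m, int m - 1) v ts"
  shows "\<exists>us. big (loop 0 nz (on 0 (\<lambda>_. (0, MoveLeft)))) ts us \<and> rel K (unary 0, -1) v us"
  using assms
proof (induction m arbitrary: ts)
  case 0
  then have "big (loop 0 nz (on 0 (\<lambda>_. (0, MoveLeft)))) ts ts"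
    by (intro big_loop_False) (auto simp: rel_def unary_def)
  then show ?case using 0 by auto
next
  case (Suc m)
  obtain vs where vs: "big (on 0 (\<lambda>_. (0, MoveLeft))) ts vs"
      "rel K (tape_update (unary (Suc m), int (Suc m) - 1) (0, MoveLeft)) v vs"
    using rel_on_0[OF Suc.prems] by blast
  have "(unary (Suc m))(int m := 0) = unary m" by (auto simp: unary_def)
  then have "rel K (unary m, int m - 1) v vs" using vs(2) by simp
  from Suc.IH[OF this] obtain ws where ws:
    "big (loop 0 nz (on 0 (\<lambda>_. (0, MoveLeft)))) vs ws" "rel K (unary 0, -1) v ws" by blast
  have "big (loop 0 nz (on 0 (\<lambda>_. (0, MoveLeft)))) ts ws"
    by (rule big_loop_True[of _ _ nz, OF _ _ vs(1) ws(1)])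
       (use Suc.prems(1) in \<open>auto simp: rel_def unary_def\<close>)
  then show ?case using ws(2) by blast
qed

text \<open>The output has to start at the absolute cell 0. The input is therefore erased on the way
  back from its right end, which stops at the blank in cell -1, one step to the left of the
  start.\<close>

lemma rel_read_input:
  assumes "rel K (unary n, 0) v ts" "0 < r" "r < K" "v r = 0"
  shows "\<exists>us. big (read_input r) ts us \<and> rel K (unary 0, 0) (v(r := n)) us"
proof -
  obtain us where us: "big (loop 0 nz (Seq (inc r) (on 0 (\<lambda>a. (a, MoveRight))))) ts us"
     "rel K (unary n, int n) (v(r := n)) us"
    using rel_read_aux1[of K n 0 v ts r] assms by auto
  obtain vs where vs: "big (on 0 (\<lambda>a. (a, MoveLeft))) us vs"
      "rel K (tape_update (unary n, int n) (under (unary n, int n), MoveLeft)) (v(r := n)) vs"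
    using rel_on_0[OF us(2)] by blast
  then obtain ws where ws: "big (loop 0 nz (on 0 (\<lambda>_. (0, MoveLeft)))) vs ws"
     "rel K (unary 0, -1) (v(r := n)) ws"
    using rel_read_aux2[of K n "v(r := n)" vs] by auto
  obtain xs where xs: "big (on 0 (\<lambda>a. (a, MoveRight))) ws xs"
      "rel K (tape_update (unary 0, -1) (under (unary 0, -1), MoveRight)) (v(r := n)) xs"
    using rel_on_0[OF ws(2)] by blast
  have "big (read_input r) ts xs"
    unfolding read_input_def by (intro big.Seq[OF us(1)] big.Seq[OF vs(1)] big.Seq[OF ws(1)] xs(1))
  with xs(2) show ?thesis by auto
qed

lemma rel_write_output:
  assumes "rel K (unary m, int m) v ts" "0 < r" "r < K"
  shows "\<exists>us. big (write_output r) ts us \<and> rel K (unary (m + v r), int (m + v r)) (v(r := 0)) us"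
  using assms
proof (induction "v r" arbitrary: m v ts)
  case 0
  then have "big (write_output r) ts ts"
    using rel_under[OF 0(2-4)] unfolding write_output_def
    by (intro big_loop_False) (auto simp: rel_def)
  moreover have "v(r := 0) = v" using 0 by auto
  ultimately show ?case using 0 by (intro exI[of _ ts]) simp
next
  case (Suc d)
  obtain us where us: "big (dec r) ts us" "rel K (unary m, int m) (v(r := v r - 1)) us"
    using rel_dec[OF Suc.prems] .
  obtain vs where vs: "big (on 0 (\<lambda>_. (1, MoveRight))) us vs"
      "rel K (tape_update (unary m, int m) (1, MoveRight)) (v(r := v r - 1)) vs"
    using rel_on_0[OF us(2)] by blast
  have "(unary m)(int m := 1) = unary (Suc m)" by (auto simp: unary_def)
  then have "rel K (unary (Suc m), int (Suc m)) (v(r := v r - 1)) vs"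
    using vs(2) by (simp add: add.commute)
  moreover define w where "w = v(r := v r - 1)"
  ultimately have "rel K (unary (Suc m), int (Suc m)) w vs" by simp
  moreover have w: "d = w r" "w(r := 0) = v(r := 0)" using Suc.hyps(2) by (simp_all add: w_def)
  ultimately obtain ws where ws:
    "big (write_output r) vs ws" "rel K (unary (Suc m + d), int (Suc m + d)) (v(r := 0)) ws"
    using Suc.hyps(1)[of w "Suc m" vs] Suc.prems(2,3) by metis
  have "big (write_output r) ts ws"
    using Suc.prems Suc.hyps(2) rel_under[OF Suc.prems] unfolding write_output_def
    by (intro big_loop_True[of _ _ nz, OF _ _ big.Seq[OF us(1) vs(1)] ws(1)[unfolded write_output_def]])
       (auto simp: rel_def)
  then show ?case using ws(2) Suc.hyps(2) by (metis add_Suc_shift)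
qed

lemma wf_inc: "2 \<le> B \<Longrightarrow> j < K \<Longrightarrow> wf_com K B (inc j)"
  by (auto simp: inc_def intro!: wf_on)

lemma wf_dec: "2 \<le> B \<Longrightarrow> j < K \<Longrightarrow> wf_com K B (dec j)"
  by (auto simp: dec_def intro!: wf_on)

text \<open>The guard of \<open>sim_act\<close> matters here: \<open>transition T\<close> is
  constrained only on legal states and symbols, whereas a wellformed action must stay bounded on all
  vectors of symbols below \<open>B\<close>.\<close>

lemma wf_sim_act:
  assumes "wf_tm T" "num_states T \<le> B" "num_symbols T < B" "num_tapes T + 2 \<le> K"
  shows "wf_com K B (Act (sim_act T))"
  unfolding wf_com.simps
proof (intro allI impI)
  fix as :: "nat list"
  assume as: "length as = K" "set as \<subseteq> {..<B}"
  let ?S = "num_symbols T" and ?k = "num_tapes T"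
  let ?bs = "map (unmask ?S) (take ?k (drop 2 as))"
  obtain q acts where tr: "transition T (as ! 1) ?bs = (q, acts)" by force
  show "length (sim_act T as) = K \<and> fst ` set (sim_act T as) \<subseteq> {..<B}"
  proof (cases "as ! 1 < num_states T \<and> set ?bs \<subseteq> {..<?S}")
    case False
    then have "sim_act T as = stay as" unfolding sim_act_def Let_def tr prod.case by (rule if_not_P)
    then show ?thesis using as stay_bounded[OF as(2)] by auto
  next
    case True
    then have wf: "q < num_states T" "length acts = ?k" "fst ` set acts \<subseteq> {..<?S}"
      using assms(1,4) tr as(1) unfolding wf_tm_def by (metis length_map length_take length_drop min.absorb2 add_le_imp_le_diff)+
    have eq: "sim_act T as = (as ! 0, Stay) # (q, Stay) # map (\<lambda>(a, m). (mask ?S a, m)) acts @ stay (drop (?k + 2) as)"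
      using True unfolding sim_act_def Let_def tr prod.case by (rule if_P)
    have "0 < length as" using as assms(4) by linarith
    then have "as ! 0 < B" using as(2) nth_mem by blast
    moreover have "set (drop (?k + 2) as) \<subseteq> {..<B}" using as(2) set_drop_subset by fast
    moreover have "fst ` set (map (\<lambda>(a, m). (mask ?S a, m)) acts) \<subseteq> {..<B}"
    proof -
      have "mask ?S a < B" if "a < ?S" for a using that assms(3) by (simp add: mask_def)
      then show ?thesis using wf(3) by auto
    qed
    moreover have "q < B" using wf(1) assms(2) by linarith
    moreover have "length (sim_act T as) = K"
      unfolding eq using wf(2) assms(4) as(1) by simp
    ultimately show ?thesis
      unfolding eq by (simp add: image_Un fst_stay)
  qed
qed

lemma wf_mark_act:
  assumes "num_symbols T < B" "num_tapes T + 2 \<le> K"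
  shows "wf_com K B (Act (mark_act T))"
  unfolding wf_com.simps
proof (intro allI impI)
  fix as :: "nat list"
  assume as: "length as = K" "set as \<subseteq> {..<B}"
  let ?S = "num_symbols T" and ?k = "num_tapes T"
  have "0 < length as" "1 < length as" using as assms(2) by linarith+
  then have "as ! 0 < B" "as ! 1 < B" using as(2) nth_mem by blast+
  moreover have "set (drop (?k + 2) as) \<subseteq> {..<B}" "set (take ?k (drop 2 as)) \<subseteq> {..<B}"
    using as(2) set_drop_subset set_take_subset by fast+
  ultimately show "length (mark_act T as) = K \<and> fst ` set (mark_act T as) \<subseteq> {..<B}"
    using as(1) assms by (auto simp: mark_act_def Let_def mask_def image_Un fst_stay)
qed

lemma wf_erase_all:
  "2 \<le> B \<Longrightarrow> (\<And>j. j \<in> set js \<Longrightarrow> j < K) \<Longrightarrow> wf_com K B (erase_all js)"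
proof (induction js)
  case Nil
  show ?case by (auto simp: erase_all_def dest: stay_bounded)
next
  case (Cons j js)
  then show ?case by (auto simp: erase_all_def erase_def rewind_def intro!: wf_on)
qed

lemma wf_call:
  assumes "wf_tm T" "num_states T \<le> B" "num_symbols T < B" "num_tapes T + 2 \<le> r" "r < K"
  shows "wf_com K B (call T r)"
proof -
  have "3 \<le> B" "3 \<le> r" using assms by (auto simp: wf_tm_def)
  then show ?thesis
    unfolding call_def transfer_def sim_loop_def rewind_def count_def wf_com.simps(2) wf_loop
    using assms by (intro conjI wf_dec wf_inc wf_on wf_sim_act wf_mark_act wf_erase_all) auto
qed

lemma wf_translate:
  assumes "wf_tm T" "num_states T \<le> B" "num_symbols T < B" "num_tapes T + 2 + bound c \<le> K"
  shows "wf_com K B (translate T c)"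
  using assms(4)
proof (induction c)
  case (RCall i)
  then show ?case using assms by (auto intro!: wf_call)
qed (use assms in \<open>auto simp: wf_tm_def intro!: wf_inc wf_dec\<close>)

theorem turing_computable_rcom:
  assumes "turing_computable f"
    and "\<And>n. \<exists>\<sigma>. rbig f c ((\<lambda>_. 0)(0 := n)) \<sigma> \<and> \<sigma> r = F n"
  shows "turing_computable F"
proof -
  obtain T where T: "wf_tm T" "\<And>n. tm_outputs T n (f n)"
    using assms(1) unfolding turing_computable_def by blast
  define k where "k = num_tapes T + 2"
  define K where "K = k + max (Suc r) (bound c)"
  \<comment> \<open>States of \<open>T\<close> are written as symbols on tape 1, and the symbol
    \<open>num_symbols T\<close> replaces the blank.\<close>
  define B where "B = max (num_states T) (Suc (num_symbols T))"
  define P where "P = Seq (read_input k) (Seq (translate T c) (write_output (k + r)))"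
  have B: "num_states T \<le> B" "num_symbols T < B" "2 \<le> B"
    using T(1) by (auto simp: B_def wf_tm_def)
  have K: "k < K" "k + r < K" "k + bound c \<le> K" "0 < k" by (auto simp: K_def k_def)
  have "wf_com K B P"
    unfolding P_def read_input_def write_output_def wf_com.simps(2) wf_loop
    using K B by (intro conjI wf_inc wf_dec wf_on wf_translate[OF T(1) B(1,2), folded k_def]) auto
  then have wf: "wf_tm (machine K B P)"
    using K B by (intro wf_machine) auto
  have "tm_outputs (machine K B P) n (F n)" for n
  proof -
    obtain \<sigma> where \<sigma>: "rbig f c ((\<lambda>_. 0)(0 := n)) \<sigma>" "\<sigma> r = F n" using assms(2) by blast
    let ?ts = "snd (tm_init (machine K B P) n)"
    have "rel K (unary n, 0) (\<lambda>_. 0) ?ts"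
      using K by (auto simp: tm_init_def rel_def machine_def reg_def nth_Cons')
    from rel_read_input[OF this _ K(1)] K(4) obtain us where us:
      "big (read_input k) ?ts us" "rel K (unary 0, 0) ((\<lambda>_. 0)(k := n)) us" by auto
    have "(\<lambda>_. 0)(k := n) = val T ((\<lambda>_. 0)(0 := n))"
      by (auto simp: val_def k_def fun_eq_iff)
    then have "rel K (unary 0, 0) (val T ((\<lambda>_. 0)(0 := n))) us" using us(2) by simp
    from rbig_translate[OF T \<sigma>(1) K(3)[unfolded k_def] this] obtain vs where vs:
      "big (translate T c) us vs" "rel K (unary 0, 0) (val T \<sigma>) vs" by blast
    have "val T \<sigma> (k + r) = F n" using \<sigma>(2) unfolding k_def by (simp only: val_reg)
    with rel_write_output[of K 0 "val T \<sigma>" vs "k + r"] vs(2) K obtain ws where ws: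
      "big (write_output (k + r)) vs ws" "rel K (unary (F n), int (F n)) ((val T \<sigma>)(k + r := 0)) ws"
      by auto
    have "big (Seq (read_input k) (Seq (translate T c) (write_output (k + r)))) ?ts ws"
      by (intro big.Seq[OF us(1)] big.Seq[OF vs(1)] ws(1))
    then have "big P ?ts ws" by (simp only: P_def[symmetric])
    from machine_run[OF this] obtain t where
      "(tm_step (machine K B P) ^^ t) (tm_init (machine K B P) n) = (1, ws)" by blast
    moreover have "ws = (unary (F n), int (F n)) # tl ws"
      using ws(2) by (cases ws) (auto simp: rel_def)
    ultimately show ?thesis unfolding tm_outputs_def by metis
  qed
  with wf show ?thesis unfolding turing_computable_def by blast
qed

subsection \<open>Closure properties of computable functions of the registers\<close>

text \<open>A function that depends on finitely many registers leaves room for intermediate results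
  that it cannot see.\<close>

definition local_upto :: "nat \<Rightarrow> ((nat \<Rightarrow> nat) \<Rightarrow> nat) \<Rightarrow> bool" where
  "local_upto N F \<longleftrightarrow> (\<forall>\<sigma> \<tau>. (\<forall>i<N. \<sigma> i = \<tau> i) \<longrightarrow> F \<sigma> = F \<tau>)"

text \<open>The result goes to register \<open>n\<close> and everything below survives, so
  subprograms are combined by giving them increasing output registers.\<close>

definition implements :: "(nat \<Rightarrow> nat) \<Rightarrow> rcom \<Rightarrow> nat \<Rightarrow> ((nat \<Rightarrow> nat) \<Rightarrow> nat) \<Rightarrow> bool" where
  "implements f c n F \<longleftrightarrow> (\<forall>\<sigma>. \<exists>\<tau>. rbig f c \<sigma> \<tau> \<and> (\<forall>i<n. \<tau> i = \<sigma> i) \<and> \<tau> n = F \<sigma>)"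

text \<open>The registers above the output register are scratch space and may contain anything.\<close>

definition rcomputable :: "(nat \<Rightarrow> nat) \<Rightarrow> ((nat \<Rightarrow> nat) \<Rightarrow> nat) \<Rightarrow> bool" where
  "rcomputable f F \<longleftrightarrow> (\<exists>N. local_upto N F \<and> (\<forall>n\<ge>N. \<exists>c. implements f c n F))"

lemma local_uptoD: "local_upto N F \<Longrightarrow> (\<And>i. i < N \<Longrightarrow> \<sigma> i = \<tau> i) \<Longrightarrow> F \<sigma> = F \<tau>"
  unfolding local_upto_def by blast

lemma implementsE:
  assumes "implements f c n F"
  obtains \<tau> where "rbig f c \<sigma> \<tau>" "\<And>i. i < n \<Longrightarrow> \<tau> i = \<sigma> i" "\<tau> n = F \<sigma>"
  using assms unfolding implements_def by blast

definition clear :: "nat \<Rightarrow> rcom" where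
  "clear i = RWhile i (RDec i)"

lemma rbig_clear: "rbig f (clear i) \<sigma> (\<sigma>(i := 0))"
proof (induction "\<sigma> i" arbitrary: \<sigma>)
  case 0
  then have "\<sigma>(i := 0) = \<sigma>" by auto
  then show ?case unfolding clear_def using rbig.RWhileF[of \<sigma> i f "RDec i"] 0 by simp
next
  case (Suc n)
  have "rbig f (clear i) (\<sigma>(i := \<sigma> i - 1)) ((\<sigma>(i := \<sigma> i - 1))(i := 0))"
    using Suc.hyps(2) by (intro Suc.hyps(1)) simp
  then show ?case
    unfolding clear_def using rbig.RWhileT[OF _ rbig.RDec, of \<sigma> i f] Suc.hyps(2) by simp
qed

definition copy :: "nat \<Rightarrow> nat \<Rightarrow> nat \<Rightarrow> rcom" where
  "copy i j t = RSeq (clear j) (RSeq (clear t)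
     (RSeq (RWhile i (RSeq (RDec i) (RSeq (RInc j) (RInc t)))) (RWhile t (RSeq (RDec t) (RInc i)))))"

lemma rbig_move2:
  assumes "i \<noteq> j" "t \<noteq> i" "t \<noteq> j"
  shows "rbig f (RWhile i (RSeq (RDec i) (RSeq (RInc j) (RInc t)))) \<sigma>
     (\<sigma>(i := 0, j := \<sigma> j + \<sigma> i, t := \<sigma> t + \<sigma> i))"
proof (induction "\<sigma> i" arbitrary: \<sigma>)
  case 0
  then have "\<sigma>(i := 0, j := \<sigma> j + \<sigma> i, t := \<sigma> t + \<sigma> i) = \<sigma>" by auto
  then show ?case using rbig.RWhileF[of \<sigma> i f] 0 by metis
next
  case (Suc n)
  define \<tau> where "\<tau> = \<sigma>(i := \<sigma> i - 1, j := Suc (\<sigma> j), t := Suc (\<sigma> t))"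
  have 1: "rbig f (RSeq (RDec i) (RSeq (RInc j) (RInc t))) \<sigma> \<tau>"
    using rbig.RSeq[OF rbig.RDec[of f i \<sigma>] rbig.RSeq[OF rbig.RInc[of f j] rbig.RInc[of f t]]] assms
    by (simp add: \<tau>_def)
  have 2: "rbig f (RWhile i (RSeq (RDec i) (RSeq (RInc j) (RInc t)))) \<tau>
      (\<tau>(i := 0, j := \<tau> j + \<tau> i, t := \<tau> t + \<tau> i))"
    by (rule Suc.hyps(1)) (use Suc.hyps(2) assms in \<open>simp add: \<tau>_def\<close>)
  have "\<tau>(i := 0, j := \<tau> j + \<tau> i, t := \<tau> t + \<tau> i) = \<sigma>(i := 0, j := \<sigma> j + \<sigma> i, t := \<sigma> t + \<sigma> i)"
    using Suc.hyps(2) assms by (auto simp: \<tau>_def fun_eq_iff)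
  with rbig.RWhileT[OF _ 1 2] Suc.hyps(2) show ?case by simp
qed

lemma rbig_move1:
  assumes "i \<noteq> t"
  shows "rbig f (RWhile t (RSeq (RDec t) (RInc i))) \<sigma> (\<sigma>(t := 0, i := \<sigma> i + \<sigma> t))"
proof (induction "\<sigma> t" arbitrary: \<sigma>)
  case 0
  then have "\<sigma>(t := 0, i := \<sigma> i + \<sigma> t) = \<sigma>" by auto
  then show ?case using rbig.RWhileF[of \<sigma> t f] 0 by metis
next
  case (Suc n)
  define \<tau> where "\<tau> = \<sigma>(t := \<sigma> t - 1, i := Suc (\<sigma> i))"
  have 1: "rbig f (RSeq (RDec t) (RInc i)) \<sigma> \<tau>"
    using rbig.RSeq[OF rbig.RDec[of f t \<sigma>] rbig.RInc[of f i]] assms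
    by (simp add: \<tau>_def)
  have 2: "rbig f (RWhile t (RSeq (RDec t) (RInc i))) \<tau> (\<tau>(t := 0, i := \<tau> i + \<tau> t))"
    by (rule Suc.hyps(1)) (use Suc.hyps(2) assms in \<open>simp add: \<tau>_def\<close>)
  have "\<tau>(t := 0, i := \<tau> i + \<tau> t) = \<sigma>(t := 0, i := \<sigma> i + \<sigma> t)"
    using Suc.hyps(2) assms by (auto simp: \<tau>_def fun_eq_iff)
  with rbig.RWhileT[OF _ 1 2] Suc.hyps(2) show ?case by simp
qed

lemma rbig_copy:
  assumes "i \<noteq> j" "t \<noteq> i" "t \<noteq> j"
  shows "rbig f (copy i j t) \<sigma> (\<sigma>(j := \<sigma> i, t := 0))"
proof -
  let ?\<tau> = "\<sigma>(j := 0, t := 0)"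
  let ?\<rho> = "?\<tau>(i := 0, j := ?\<tau> j + ?\<tau> i, t := ?\<tau> t + ?\<tau> i)"
  have "?\<rho>(t := 0, i := ?\<rho> i + ?\<rho> t) = \<sigma>(j := \<sigma> i, t := 0)"
    using assms by (auto simp: fun_eq_iff)
  then show ?thesis
    unfolding copy_def
    using rbig.RSeq[OF rbig_clear rbig.RSeq[OF rbig_clear
        rbig.RSeq[OF rbig_move2[OF assms, of f ?\<tau>] rbig_move1[of i t f ?\<rho>]]]] assms by simp
qed

lemma rcomputable_var: "rcomputable f (\<lambda>\<sigma>. \<sigma> a)"
  unfolding rcomputable_def
proof (intro exI[of _ "Suc a"] conjI allI impI)
  show "local_upto (Suc a) (\<lambda>\<sigma>. \<sigma> a)" by (simp add: local_upto_def)
  fix n assume "Suc a \<le> n"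
  then have "rbig f (copy a n (Suc n)) \<sigma> (\<sigma>(n := \<sigma> a, Suc n := 0))" for \<sigma>
    by (intro rbig_copy) auto
  moreover have "(\<sigma>(n := \<sigma> a, Suc n := 0)) i = \<sigma> i" if "i < n" for \<sigma> :: "nat \<Rightarrow> nat" and i using that by simp
  ultimately have "implements f (copy a n (Suc n)) n (\<lambda>\<sigma>. \<sigma> a)"
    unfolding implements_def by (metis fun_upd_other fun_upd_same n_not_Suc_n)
  then show "\<exists>c. implements f c n (\<lambda>\<sigma>. \<sigma> a)" ..
qed

lemma rcomputable_0: "rcomputable f (\<lambda>\<sigma>. 0)"
  unfolding rcomputable_def
proof (intro exI[of _ 0] conjI allI impI)
  fix n
  have "implements f (clear n) n (\<lambda>\<sigma>. 0)"
    unfolding implements_def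
  proof
    fix \<sigma>
    show "\<exists>\<tau>. rbig f (clear n) \<sigma> \<tau> \<and> (\<forall>i<n. \<tau> i = \<sigma> i) \<and> \<tau> n = 0"
      by (intro exI[of _ "\<sigma>(n := 0)"] conjI rbig_clear) auto
  qed
  then show "\<exists>c. implements f c n (\<lambda>\<sigma>. 0)" ..
qed (simp add: local_upto_def)

lemma rcomputable_after:
  assumes "rcomputable f F" "\<And>n \<sigma>. rbig f (d n) \<sigma> (\<sigma>(n := h (\<sigma> n)))"
  shows "rcomputable f (\<lambda>\<sigma>. h (F \<sigma>))"
proof -
  from assms(1) obtain N where N: "local_upto N F" "\<And>n. N \<le> n \<Longrightarrow> \<exists>c. implements f c n F"
    unfolding rcomputable_def by blast
  have "\<exists>c. implements f c n (\<lambda>\<sigma>. h (F \<sigma>))" if n: "N \<le> n" for n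
  proof -
    obtain c where c: "implements f c n F" using N(2)[OF n] by blast
    have "implements f (RSeq c (d n)) n (\<lambda>\<sigma>. h (F \<sigma>))"
      unfolding implements_def
    proof
      fix \<sigma>
      obtain \<tau> where \<tau>: "rbig f c \<sigma> \<tau>" "\<And>i. i < n \<Longrightarrow> \<tau> i = \<sigma> i" "\<tau> n = F \<sigma>"
        by (rule implementsE[OF c, where \<sigma> = "\<sigma>"]) blast
      then show "\<exists>\<tau>. rbig f (RSeq c (d n)) \<sigma> \<tau> \<and> (\<forall>i<n. \<tau> i = \<sigma> i) \<and> \<tau> n = h (F \<sigma>)"
        by (intro exI[of _ "\<tau>(n := h (\<tau> n))"] conjI rbig.RSeq[OF \<tau>(1) assms(2)]) auto
    qed
    then show ?thesis ..
  qed
  moreover have "local_upto N (\<lambda>\<sigma>. h (F \<sigma>))"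
    using N(1) unfolding local_upto_def by metis
  ultimately show ?thesis unfolding rcomputable_def by blast
qed

lemma rcomputable_Suc: "rcomputable f F \<Longrightarrow> rcomputable f (\<lambda>\<sigma>. Suc (F \<sigma>))"
  by (rule rcomputable_after[where d = RInc and h = Suc, OF _ rbig.RInc])

lemma rcomputable_pred: "rcomputable f F \<Longrightarrow> rcomputable f (\<lambda>\<sigma>. F \<sigma> - 1)"
  by (rule rcomputable_after[where d = RDec and h = "\<lambda>x. x - 1", OF _ rbig.RDec])

lemma rcomputable_call: "rcomputable f F \<Longrightarrow> rcomputable f (\<lambda>\<sigma>. f (F \<sigma>))"
  by (rule rcomputable_after[where d = RCall and h = f, OF _ rbig.RCall])

text \<open>A variable is bound by overwriting register \<open>a\<close> during the evaluation of
  \<open>G\<close> and restoring it afterwards.\<close>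

lemma rcomputable_let:
  assumes "rcomputable f F" "rcomputable f G"
  shows "rcomputable f (\<lambda>\<sigma>. G (\<sigma>(a := F \<sigma>)))"
proof -
  from assms(1) obtain M where M: "local_upto M F" "\<And>n. M \<le> n \<Longrightarrow> \<exists>c. implements f c n F"
    unfolding rcomputable_def by blast
  from assms(2) obtain N where N: "local_upto N G" "\<And>n. N \<le> n \<Longrightarrow> \<exists>c. implements f c n G"
    unfolding rcomputable_def by blast
  define R where "R = Suc a + M + N"
  have "\<exists>c. implements f c n (\<lambda>\<sigma>. G (\<sigma>(a := F \<sigma>)))" if n: "R \<le> n" for n
  proof -
    obtain c where c: "implements f c n F" using M(2)[of n] n by (auto simp: R_def)
    obtain d where d: "implements f d (n + 3) G" using N(2)[of "n + 3"] n by (auto simp: R_def)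
    have an: "a < n" using n by (simp add: R_def)
    \<comment> \<open>Register \<open>n + 1\<close> saves the old content of \<open>a\<close>,
      \<open>n + 2\<close> is the scratch register of \<open>copy\<close>, and \<open>n + 3\<close>
      receives the value of \<open>G\<close>.\<close>
    define p where "p = RSeq c (RSeq (copy a (n + 1) (n + 2)) (RSeq (copy n a (n + 2))
      (RSeq d (RSeq (copy (n + 1) a (n + 2)) (copy (n + 3) n (n + 2))))))"
    have "implements f p n (\<lambda>\<sigma>. G (\<sigma>(a := F \<sigma>)))"
      unfolding implements_def
    proof
      fix \<sigma>
      obtain \<tau> where \<tau>: "rbig f c \<sigma> \<tau>" "\<And>i. i < n \<Longrightarrow> \<tau> i = \<sigma> i" "\<tau> n = F \<sigma>"
        by (rule implementsE[OF c, where \<sigma> = "\<sigma>"]) blast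
      define \<tau>1 where "\<tau>1 = \<tau>(n + 1 := \<tau> a, n + 2 := 0)"
      define \<tau>2 where "\<tau>2 = \<tau>1(a := \<tau>1 n, n + 2 := 0)"
      obtain \<tau>3 where \<tau>3: "rbig f d \<tau>2 \<tau>3" "\<And>i. i < n + 3 \<Longrightarrow> \<tau>3 i = \<tau>2 i" "\<tau>3 (n + 3) = G \<tau>2"
        by (rule implementsE[OF d, where \<sigma> = "\<tau>2"]) blast
      define \<tau>4 where "\<tau>4 = \<tau>3(a := \<tau>3 (n + 1), n + 2 := 0)"
      define \<tau>5 where "\<tau>5 = \<tau>4(n := \<tau>4 (n + 3), n + 2 := 0)"
      have c: "rbig f (copy a (n + 1) (n + 2)) \<tau> \<tau>1" "rbig f (copy n a (n + 2)) \<tau>1 \<tau>2"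
        "rbig f (copy (n + 1) a (n + 2)) \<tau>3 \<tau>4" "rbig f (copy (n + 3) n (n + 2)) \<tau>4 \<tau>5"
        unfolding \<tau>1_def \<tau>2_def \<tau>4_def \<tau>5_def using an by - ((rule rbig_copy; simp)+)
      have "rbig f p \<sigma> \<tau>5"
        unfolding p_def
        by (rule rbig.RSeq[OF \<tau>(1) rbig.RSeq[OF c(1) rbig.RSeq[OF c(2) rbig.RSeq[OF \<tau>3(1) rbig.RSeq[OF c(3,4)]]]]])
      moreover have "G \<tau>2 = G (\<sigma>(a := F \<sigma>))"
        by (rule local_uptoD[OF N(1)]) (use an n \<tau>(2,3) in \<open>auto simp: \<tau>2_def \<tau>1_def R_def\<close>)
      then have "\<tau>5 n = G (\<sigma>(a := F \<sigma>))" using an \<tau>3(3) by (simp add: \<tau>5_def \<tau>4_def)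
      moreover have "\<forall>i<n. \<tau>5 i = \<sigma> i"
        using an \<tau>3(2) \<tau>(2) by (auto simp: \<tau>5_def \<tau>4_def \<tau>2_def \<tau>1_def)
      ultimately show "\<exists>\<tau>. rbig f p \<sigma> \<tau> \<and> (\<forall>i<n. \<tau> i = \<sigma> i) \<and> \<tau> n = G (\<sigma>(a := F \<sigma>))" by blast
    qed
    then show ?thesis ..
  qed
  moreover have "local_upto R (\<lambda>\<sigma>. G (\<sigma>(a := F \<sigma>)))"
    unfolding local_upto_def
  proof (intro allI impI)
    fix \<sigma> \<tau> :: "nat \<Rightarrow> nat" assume e: "\<forall>i<R. \<sigma> i = \<tau> i"
    have "F \<sigma> = F \<tau>" by (rule local_uptoD[OF M(1)]) (use e in \<open>auto simp: R_def\<close>)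
    then show "G (\<sigma>(a := F \<sigma>)) = G (\<tau>(a := F \<tau>))"
      by (intro local_uptoD[OF N(1)]) (use e in \<open>auto simp: R_def\<close>)
  qed
  ultimately show ?thesis unfolding rcomputable_def by blast
qed

lemma rcomputable_cong: "rcomputable f F \<Longrightarrow> (\<And>\<sigma>. F \<sigma> = G \<sigma>) \<Longrightarrow> rcomputable f G"
  by (metis ext)

text \<open>Binding register 0 to \<open>F\<close> directly would change what \<open>G\<close> sees.
  The arguments are therefore renamed to register 2 and to a register \<open>x\<close> beyond the
  reach of \<open>G\<close>, and \<open>F\<close> is bound to the latter.\<close>

lemma rcomputable_subst2:
  assumes "rcomputable f (\<lambda>\<sigma>. h (\<sigma> 0) (\<sigma> 1))" "rcomputable f F" "rcomputable f G"
  shows "rcomputable f (\<lambda>\<sigma>. h (F \<sigma>) (G \<sigma>))"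
proof -
  from assms(3) obtain N where N: "local_upto N G" unfolding rcomputable_def by blast
  define x where "x = N + 3"
  have x: "x \<noteq> 0" "x \<noteq> 1" "x \<noteq> 2" by (simp_all add: x_def)
  have "rcomputable f (\<lambda>\<sigma>. h (\<sigma> x) (\<sigma> 1))"
    by (rule rcomputable_cong[OF rcomputable_let[OF rcomputable_var[of f x] assms(1), where a = 0]]) simp
  then have "rcomputable f (\<lambda>\<sigma>. h (\<sigma> x) (\<sigma> 2))"
    by (rule rcomputable_cong[OF rcomputable_let[OF rcomputable_var[of f 2], where a = 1]]) (use x in simp)
  then have "rcomputable f (\<lambda>\<sigma>. h (\<sigma> x) (G \<sigma>))"
    by (rule rcomputable_cong[OF rcomputable_let[OF assms(3), where a = 2]]) (use x in simp)
  then show ?thesis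
  proof (rule rcomputable_cong[OF rcomputable_let[OF assms(2), where a = x]])
    fix \<sigma>
    have "G (\<sigma>(x := F \<sigma>)) = G \<sigma>" by (rule local_uptoD[OF N]) (simp add: x_def)
    then show "h ((\<sigma>(x := F \<sigma>)) x) (G (\<sigma>(x := F \<sigma>))) = h (F \<sigma>) (G \<sigma>)" by simp
  qed
qed

lemma rcomputable_subst1: "rcomputable f (\<lambda>\<sigma>. h (\<sigma> 0)) \<Longrightarrow> rcomputable f F \<Longrightarrow> rcomputable f (\<lambda>\<sigma>. h (F \<sigma>))"
  using rcomputable_subst2[where h = "\<lambda>x _. h x"] by blast

lemma rcomputable_rec:
  assumes "rcomputable f A" "rcomputable f B" "rcomputable f C" "a \<noteq> b"
  shows "rcomputable f (\<lambda>\<sigma>. rec_nat (A \<sigma>) (\<lambda>k r. B (\<sigma>(a := k, b := r))) (C \<sigma>))"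
    (is "rcomputable f ?F")
proof -
  from assms(1) obtain NA where NA: "local_upto NA A" "\<And>n. NA \<le> n \<Longrightarrow> \<exists>c. implements f c n A"
    unfolding rcomputable_def by blast
  from assms(2) obtain NB where NB: "local_upto NB B" "\<And>n. NB \<le> n \<Longrightarrow> \<exists>c. implements f c n B"
    unfolding rcomputable_def by blast
  from assms(3) obtain NC where NC: "local_upto NC C" "\<And>n. NC \<le> n \<Longrightarrow> \<exists>c. implements f c n C"
    unfolding rcomputable_def by blast
  define R where "R = Suc a + Suc b + NA + NB + NC"
  have "\<exists>c. implements f c n ?F" if n: "R \<le> n" for n
  proof -
    obtain cC where cC: "implements f cC n C" using NC(2)[of n] n by (auto simp: R_def)
    obtain cA where cA: "implements f cA (n + 1) A" using NA(2)[of "n + 1"] n by (auto simp: R_def)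
    obtain cB where cB: "implements f cB (n + 5) B" using NB(2)[of "n + 5"] n by (auto simp: R_def)
    have ab: "a < n" "b < n" using n by (simp_all add: R_def)
    \<comment> \<open>Register \<open>n\<close> counts down from the value of \<open>C\<close>;
      \<open>n + 1\<close> holds the start value, \<open>n + 2\<close> and \<open>n + 3\<close> the
      saved contents of \<open>a\<close> and \<open>b\<close>, \<open>n + 4\<close> is the scratch
      register of \<open>copy\<close>, and \<open>n + 5\<close> receives the value of
      \<open>B\<close>.\<close>
    define body where "body = RSeq (RDec n) (RSeq cB (RSeq (copy (n + 5) b (n + 4)) (RInc a)))"
    define p where "p = RSeq cC (RSeq cA (RSeq (copy a (n + 2) (n + 4)) (RSeq (copy b (n + 3) (n + 4))
      (RSeq (clear a) (RSeq (copy (n + 1) b (n + 4)) (RSeq (RWhile n body) (RSeq (copy b n (n + 4))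
      (RSeq (copy (n + 2) a (n + 4)) (copy (n + 3) b (n + 4))))))))))"
    have "implements f p n ?F"
      unfolding implements_def
    proof
      fix \<sigma>
      define r where "r = rec_nat (A \<sigma>) (\<lambda>k r. B (\<sigma>(a := k, b := r)))"
      define inv where "inv j \<tau> \<longleftrightarrow> \<tau> a = j \<and> \<tau> b = r j \<and> \<tau> (n + 2) = \<sigma> a \<and> \<tau> (n + 3) = \<sigma> b \<and>
        (\<forall>i<n. i \<noteq> a \<longrightarrow> i \<noteq> b \<longrightarrow> \<tau> i = \<sigma> i)" for j \<tau>
      have loop: "\<exists>\<rho>. rbig f (RWhile n body) \<tau> \<rho> \<and> inv (j + \<tau> n) \<rho>" if "inv j \<tau>" for j \<tau>
        using that
      proof (induction "\<tau> n" arbitrary: j \<tau>)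
        case 0
        then show ?case using rbig.RWhileF[of \<tau> n f body] by force
      next
        case (Suc m)
        let ?\<tau>1 = "\<tau>(n := \<tau> n - 1)"
        obtain \<tau>2 where \<tau>2: "rbig f cB ?\<tau>1 \<tau>2" "\<And>i. i < n + 5 \<Longrightarrow> \<tau>2 i = ?\<tau>1 i" "\<tau>2 (n + 5) = B ?\<tau>1"
          by (rule implementsE[OF cB, where \<sigma> = "?\<tau>1"]) blast
        have B: "B ?\<tau>1 = r (Suc j)"
        proof -
          have "B ?\<tau>1 = B (\<sigma>(a := j, b := r j))"
            by (rule local_uptoD[OF NB(1)]) (use Suc.prems n assms(4) in \<open>auto simp: inv_def R_def\<close>)
          then show ?thesis by (simp add: r_def)
        qed
        define \<tau>3 where "\<tau>3 = \<tau>2(b := \<tau>2 (n + 5), n + 4 := 0)"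
        define \<tau>4 where "\<tau>4 = \<tau>3(a := Suc (\<tau>3 a))"
        have "rbig f (copy (n + 5) b (n + 4)) \<tau>2 \<tau>3" unfolding \<tau>3_def using ab by (intro rbig_copy) auto
        then have body: "rbig f body \<tau> \<tau>4"
          unfolding body_def \<tau>4_def by (intro rbig.RSeq[OF rbig.RDec] rbig.RSeq[OF \<tau>2(1)] rbig.RSeq[OF _ rbig.RInc])
        have "inv (Suc j) \<tau>4"
          using Suc.prems ab assms(4) \<tau>2(2) \<tau>2(3) B unfolding inv_def by (auto simp: \<tau>4_def \<tau>3_def)
        moreover have m: "m = \<tau>4 n" using Suc.hyps(2) ab \<tau>2(2)[of n] by (simp add: \<tau>4_def \<tau>3_def)
        ultimately obtain \<rho> where \<rho>: "rbig f (RWhile n body) \<tau>4 \<rho>" "inv (Suc j + \<tau>4 n) \<rho>"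
          using Suc.hyps(1) by blast
        have "rbig f (RWhile n body) \<tau> \<rho>"
          by (rule rbig.RWhileT[OF _ body \<rho>(1)]) (use Suc.hyps(2) in simp)
        moreover have "Suc j + \<tau>4 n = j + \<tau> n" using m Suc.hyps(2) by simp
        ultimately show ?case using \<rho>(2) by metis
      qed
      obtain \<tau> where \<tau>: "rbig f cC \<sigma> \<tau>" "\<And>i. i < n \<Longrightarrow> \<tau> i = \<sigma> i" "\<tau> n = C \<sigma>"
        by (rule implementsE[OF cC, where \<sigma> = "\<sigma>"]) blast
      obtain \<tau>1 where \<tau>1: "rbig f cA \<tau> \<tau>1" "\<And>i. i < n + 1 \<Longrightarrow> \<tau>1 i = \<tau> i" "\<tau>1 (n + 1) = A \<tau>"
        by (rule implementsE[OF cA, where \<sigma> = "\<tau>"]) blast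
      have A: "A \<tau> = A \<sigma>" by (rule local_uptoD[OF NA(1)]) (use n \<tau>(2) in \<open>auto simp: R_def\<close>)
      define \<tau>2 where "\<tau>2 = \<tau>1(n + 2 := \<tau>1 a, n + 4 := 0)"
      define \<tau>3 where "\<tau>3 = \<tau>2(n + 3 := \<tau>2 b, n + 4 := 0)"
      define \<tau>4 where "\<tau>4 = \<tau>3(a := 0)"
      define \<tau>5 where "\<tau>5 = \<tau>4(b := \<tau>4 (n + 1), n + 4 := 0)"
      have "inv 0 \<tau>5"
        using ab assms(4) \<tau>(2) \<tau>1(2,3) A
        by (auto simp: inv_def \<tau>5_def \<tau>4_def \<tau>3_def \<tau>2_def r_def)
      moreover have "\<tau>5 n = C \<sigma>" using ab \<tau>(3) \<tau>1(2)[of n] by (simp add: \<tau>5_def \<tau>4_def \<tau>3_def \<tau>2_def)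
      ultimately obtain \<rho> where \<rho>: "rbig f (RWhile n body) \<tau>5 \<rho>" "inv (C \<sigma>) \<rho>"
        using loop[of 0 \<tau>5] by auto
      define \<rho>1 where "\<rho>1 = \<rho>(n := \<rho> b, n + 4 := 0)"
      define \<rho>2 where "\<rho>2 = \<rho>1(a := \<rho>1 (n + 2), n + 4 := 0)"
      define \<rho>3 where "\<rho>3 = \<rho>2(b := \<rho>2 (n + 3), n + 4 := 0)"
      have c: "rbig f (copy a (n + 2) (n + 4)) \<tau>1 \<tau>2" "rbig f (copy b (n + 3) (n + 4)) \<tau>2 \<tau>3"
        "rbig f (copy (n + 1) b (n + 4)) \<tau>4 \<tau>5" "rbig f (copy b n (n + 4)) \<rho> \<rho>1"
        "rbig f (copy (n + 2) a (n + 4)) \<rho>1 \<rho>2" "rbig f (copy (n + 3) b (n + 4)) \<rho>2 \<rho>3"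
        unfolding \<tau>2_def \<tau>3_def \<tau>5_def \<rho>1_def \<rho>2_def \<rho>3_def using ab by - ((rule rbig_copy; simp)+)
      have "rbig f p \<sigma> \<rho>3"
        unfolding p_def using rbig_clear[of f a \<tau>3, folded \<tau>4_def]
        by (intro rbig.RSeq[OF \<tau>(1)] rbig.RSeq[OF \<tau>1(1)] rbig.RSeq[OF c(1)] rbig.RSeq[OF c(2)]
            rbig.RSeq[OF _ rbig.RSeq[OF c(3) rbig.RSeq[OF \<rho>(1) rbig.RSeq[OF c(4) rbig.RSeq[OF c(5) c(6)]]]]])
      moreover have "\<forall>i<n. \<rho>3 i = \<sigma> i"
        using ab \<rho>(2) by (auto simp: \<rho>3_def \<rho>2_def \<rho>1_def inv_def)
      moreover have "\<rho>3 n = r (C \<sigma>)"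
        using ab \<rho>(2) by (auto simp: \<rho>3_def \<rho>2_def \<rho>1_def inv_def)
      ultimately show "\<exists>\<tau>. rbig f p \<sigma> \<tau> \<and> (\<forall>i<n. \<tau> i = \<sigma> i) \<and> \<tau> n = ?F \<sigma>" unfolding r_def by blast
    qed
    then show ?thesis ..
  qed
  moreover have "local_upto R ?F"
    unfolding local_upto_def
  proof (intro allI impI)
    fix \<sigma> \<tau> :: "nat \<Rightarrow> nat" assume e: "\<forall>i<R. \<sigma> i = \<tau> i"
    have "A \<sigma> = A \<tau>" by (rule local_uptoD[OF NA(1)]) (use e in \<open>auto simp: R_def\<close>)
    moreover have "C \<sigma> = C \<tau>" by (rule local_uptoD[OF NC(1)]) (use e in \<open>auto simp: R_def\<close>)
    moreover have "B (\<sigma>(a := k, b := r)) = B (\<tau>(a := k, b := r))" for k r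
      by (rule local_uptoD[OF NB(1)]) (use e in \<open>auto simp: R_def\<close>)
    ultimately show "?F \<sigma> = ?F \<tau>" by simp
  qed
  ultimately show ?thesis unfolding rcomputable_def by blast
qed

text \<open>Unbounded search, the one construction here beyond primitive recursion. The existence
  hypothesis makes the loop end for every content of the registers.\<close>

lemma rcomputable_Least:
  assumes "rcomputable f P" "\<And>\<sigma>. \<exists>k. P (\<sigma>(a := k)) = 0"
  shows "rcomputable f (\<lambda>\<sigma>. LEAST k. P (\<sigma>(a := k)) = 0)" (is "rcomputable f ?F")
proof -
  from assms(1) obtain N where N: "local_upto N P" "\<And>n. N \<le> n \<Longrightarrow> \<exists>c. implements f c n P"
    unfolding rcomputable_def by blast
  define R where "R = Suc a + N"
  have "\<exists>c. implements f c n ?F" if n: "R \<le> n" for n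
  proof -
    obtain d where d: "implements f d (n + 3) P" using N(2)[of "n + 3"] n by (auto simp: R_def)
    have an: "a < n" using n by (simp add: R_def)
    define p where "p = RSeq (copy a (n + 1) (n + 2)) (RSeq (clear a) (RSeq d
      (RSeq (RWhile (n + 3) (RSeq (RInc a) d)) (RSeq (copy a n (n + 2)) (copy (n + 1) a (n + 2))))))"
    have "implements f p n ?F"
      unfolding implements_def
    proof
      fix \<sigma>
      define L where "L = ?F \<sigma>"
      have L: "P (\<sigma>(a := L)) = 0" "\<And>k. P (\<sigma>(a := k)) = 0 \<Longrightarrow> L \<le> k"
        unfolding L_def using LeastI_ex[OF assms(2)[of \<sigma>]] by (auto intro: Least_le)
      define inv where "inv j \<tau> \<longleftrightarrow> \<tau> a = j \<and> \<tau> (n + 1) = \<sigma> a \<and> \<tau> (n + 3) = P (\<sigma>(a := j)) \<and>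
        (\<forall>i<n. i \<noteq> a \<longrightarrow> \<tau> i = \<sigma> i)" for j \<tau>
      have step: "\<exists>\<rho>. rbig f d \<tau> \<rho> \<and> inv (\<tau> a) \<rho>"
        if "\<tau> (n + 1) = \<sigma> a" "\<forall>i<n. i \<noteq> a \<longrightarrow> \<tau> i = \<sigma> i" for \<tau>
      proof -
        obtain \<rho> where \<rho>: "rbig f d \<tau> \<rho>" "\<And>i. i < n + 3 \<Longrightarrow> \<rho> i = \<tau> i" "\<rho> (n + 3) = P \<tau>"
          by (rule implementsE[OF d, where \<sigma> = "\<tau>"]) blast
        have "P \<tau> = P (\<sigma>(a := \<tau> a))"
          by (rule local_uptoD[OF N(1)]) (use n that in \<open>auto simp: R_def\<close>)
        then have "inv (\<tau> a) \<rho>" using that \<rho>(2,3) an by (auto simp: inv_def)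
        with \<rho>(1) show ?thesis by blast
      qed
      have loop: "\<exists>\<rho>. rbig f (RWhile (n + 3) (RSeq (RInc a) d)) \<tau> \<rho> \<and> inv L \<rho>" if "inv j \<tau>" "j \<le> L" for j \<tau>
        using that
      proof (induction "L - j" arbitrary: j \<tau>)
        case 0
        then have "\<tau> (n + 3) = 0" "j = L" using L(1) by (auto simp: inv_def)
        then show ?case using rbig.RWhileF[of \<tau> "n + 3" f] 0 by blast
      next
        case (Suc m)
        then have "P (\<sigma>(a := j)) \<noteq> 0" using L(2)[of j] by fastforce
        then have nz: "\<tau> (n + 3) \<noteq> 0" using Suc.prems(1) by (simp add: inv_def)
        let ?\<tau> = "\<tau>(a := Suc (\<tau> a))"
        have "?\<tau> (n + 1) = \<sigma> a" "\<forall>i<n. i \<noteq> a \<longrightarrow> ?\<tau> i = \<sigma> i" "?\<tau> a = Suc j"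
          using Suc.prems(1) an by (auto simp: inv_def)
        with step[of ?\<tau>] obtain \<tau>' where \<tau>': "rbig f d ?\<tau> \<tau>'" "inv (Suc j) \<tau>'" by auto
        have "m = L - Suc j" "Suc j \<le> L" using Suc.hyps(2) by linarith+
        then obtain \<rho> where \<rho>: "rbig f (RWhile (n + 3) (RSeq (RInc a) d)) \<tau>' \<rho>" "inv L \<rho>"
          using Suc.hyps(1)[of "Suc j" \<tau>'] \<tau>'(2) by blast
        show ?case
          using rbig.RWhileT[OF nz rbig.RSeq[OF rbig.RInc \<tau>'(1)] \<rho>(1)] \<rho>(2) by blast
      qed
      define \<tau>1 where "\<tau>1 = \<sigma>(n + 1 := \<sigma> a, n + 2 := 0)"
      define \<tau>2 where "\<tau>2 = \<tau>1(a := 0)"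
      have "\<tau>2 (n + 1) = \<sigma> a" "\<forall>i<n. i \<noteq> a \<longrightarrow> \<tau>2 i = \<sigma> i" "\<tau>2 a = 0"
        using an by (auto simp: \<tau>2_def \<tau>1_def)
      with step[of \<tau>2] obtain \<tau>3 where \<tau>3: "rbig f d \<tau>2 \<tau>3" "inv 0 \<tau>3" by auto
      obtain \<rho> where \<rho>: "rbig f (RWhile (n + 3) (RSeq (RInc a) d)) \<tau>3 \<rho>" "inv L \<rho>"
        using loop[OF \<tau>3(2)] by auto
      define \<rho>1 where "\<rho>1 = \<rho>(n := \<rho> a, n + 2 := 0)"
      define \<rho>2 where "\<rho>2 = \<rho>1(a := \<rho>1 (n + 1), n + 2 := 0)"
      have c: "rbig f (copy a (n + 1) (n + 2)) \<sigma> \<tau>1" "rbig f (copy a n (n + 2)) \<rho> \<rho>1"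
        "rbig f (copy (n + 1) a (n + 2)) \<rho>1 \<rho>2"
        unfolding \<tau>1_def \<rho>1_def \<rho>2_def using an by - ((rule rbig_copy; simp)+)
      have "rbig f p \<sigma> \<rho>2"
        unfolding p_def using rbig_clear[of f a \<tau>1, folded \<tau>2_def]
        by (intro rbig.RSeq[OF c(1)] rbig.RSeq[OF _ rbig.RSeq[OF \<tau>3(1) rbig.RSeq[OF \<rho>(1) rbig.RSeq[OF c(2) c(3)]]]])
      moreover have "\<forall>i<n. \<rho>2 i = \<sigma> i" using an \<rho>(2) by (auto simp: \<rho>2_def \<rho>1_def inv_def)
      moreover have "\<rho>2 n = L" using an \<rho>(2) by (auto simp: \<rho>2_def \<rho>1_def inv_def)
      ultimately show "\<exists>\<tau>. rbig f p \<sigma> \<tau> \<and> (\<forall>i<n. \<tau> i = \<sigma> i) \<and> \<tau> n = ?F \<sigma>" unfolding L_def by blast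
    qed
    then show ?thesis ..
  qed
  moreover have "local_upto R ?F"
    unfolding local_upto_def
  proof (intro allI impI)
    fix \<sigma> \<tau> :: "nat \<Rightarrow> nat" assume e: "\<forall>i<R. \<sigma> i = \<tau> i"
    have "P (\<sigma>(a := k)) = P (\<tau>(a := k))" for k
      by (rule local_uptoD[OF N(1)]) (use e in \<open>auto simp: R_def\<close>)
    then show "?F \<sigma> = ?F \<tau>" by simp
  qed
  ultimately show ?thesis unfolding rcomputable_def by blast
qed

theorem turing_computable_rcomputable:
  assumes "turing_computable f" "rcomputable f (\<lambda>\<sigma>. F (\<sigma> 0))"
  shows "turing_computable F"
proof -
  from assms(2) obtain n c where "implements f c n (\<lambda>\<sigma>. F (\<sigma> 0))" unfolding rcomputable_def by blast
  then have "\<exists>\<tau>. rbig f c ((\<lambda>_. 0)(0 := m)) \<tau> \<and> \<tau> n = F m" for m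
    unfolding implements_def by (metis fun_upd_same)
  then show ?thesis by (rule turing_computable_rcom[OF assms(1)])
qed

subsection \<open>The computable selection of ideal points\<close>

lemma rcomputable_const: "rcomputable f (\<lambda>_. k)"
  by (induction k) (auto intro: rcomputable_0 rcomputable_Suc[of f "\<lambda>_. _"])

lemma rcomputable_add: "rcomputable f F \<Longrightarrow> rcomputable f G \<Longrightarrow> rcomputable f (\<lambda>\<sigma>. F \<sigma> + G \<sigma>)"
proof (rule rcomputable_subst2[where h = "(+)"])
  have "rec_nat y (\<lambda>k r. Suc r) x = x + y" for x y :: nat by (induction x) auto
  then show "rcomputable f (\<lambda>\<sigma>. \<sigma> 0 + \<sigma> 1)"
    by (intro rcomputable_cong[OF rcomputable_rec[OF rcomputable_var[of f 1] rcomputable_Suc[OF rcomputable_var[of f 3]] rcomputable_var[of f 0], of 2 3]]) auto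
qed

lemma rcomputable_mult: "rcomputable f F \<Longrightarrow> rcomputable f G \<Longrightarrow> rcomputable f (\<lambda>\<sigma>. F \<sigma> * G \<sigma>)"
proof (rule rcomputable_subst2[where h = "(*)"])
  have "rec_nat 0 (\<lambda>k r. r + y) x = x * y" for x y :: nat by (induction x) auto
  then show "rcomputable f (\<lambda>\<sigma>. \<sigma> 0 * \<sigma> 1)"
    by (intro rcomputable_cong[OF rcomputable_rec[OF rcomputable_const[of f 0] rcomputable_add[OF rcomputable_var[of f 3] rcomputable_var[of f 1]] rcomputable_var[of f 0], of 2 3]]) auto
qed

lemma rcomputable_power: "rcomputable f F \<Longrightarrow> rcomputable f G \<Longrightarrow> rcomputable f (\<lambda>\<sigma>. F \<sigma> ^ G \<sigma>)"
proof (rule rcomputable_subst2[where h = "(^)"])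
  have "rec_nat 1 (\<lambda>k r. r * y) x = y ^ x" for x y :: nat by (induction x) auto
  then show "rcomputable f (\<lambda>\<sigma>. \<sigma> 0 ^ \<sigma> 1)"
    by (intro rcomputable_cong[OF rcomputable_rec[OF rcomputable_const[of f 1] rcomputable_mult[OF rcomputable_var[of f 3] rcomputable_var[of f 0]] rcomputable_var[of f 1], of 2 3]]) auto
qed

lemma rcomputable_diff: "rcomputable f F \<Longrightarrow> rcomputable f G \<Longrightarrow> rcomputable f (\<lambda>\<sigma>. F \<sigma> - G \<sigma>)"
proof (rule rcomputable_subst2[where h = "(-)"])
  have "rec_nat y (\<lambda>k r. r - 1) x = y - x" for x y :: nat by (induction x) auto
  then show "rcomputable f (\<lambda>\<sigma>. \<sigma> 0 - \<sigma> 1)"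
    by (intro rcomputable_cong[OF rcomputable_rec[OF rcomputable_var[of f 0] rcomputable_pred[OF rcomputable_var[of f 3]] rcomputable_var[of f 1], of 2 3]]) auto
qed

lemma rcomputable_prod_encode: "rcomputable f F \<Longrightarrow> rcomputable f G \<Longrightarrow> rcomputable f (\<lambda>\<sigma>. prod_encode (F \<sigma>, G \<sigma>))"
proof (rule rcomputable_subst2[where h = "\<lambda>x y. prod_encode (x, y)"])
  have "rec_nat 0 (\<lambda>k r. r + Suc k) n = triangle n" for n by (induction n) auto
  then have "rcomputable f (\<lambda>\<sigma>. triangle (\<sigma> 0))"
    by (intro rcomputable_cong[OF rcomputable_rec[OF rcomputable_const[of f 0] rcomputable_add[OF rcomputable_var[of f 3] rcomputable_Suc[OF rcomputable_var[of f 2]]]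
          rcomputable_var[of f 0], of 2 3]]) auto
  then have "rcomputable f (\<lambda>\<sigma>. triangle (\<sigma> 0 + \<sigma> 1))"
    by (rule rcomputable_subst1) (intro rcomputable_add rcomputable_var)
  then show "rcomputable f (\<lambda>\<sigma>. prod_encode (\<sigma> 0, \<sigma> 1))"
    unfolding prod_encode_def prod.case by (intro rcomputable_add rcomputable_var)
qed

lemma rcomputable_if: "rcomputable f C \<Longrightarrow> rcomputable f F \<Longrightarrow> rcomputable f G \<Longrightarrow> rcomputable f (\<lambda>\<sigma>. if C \<sigma> = 0 then F \<sigma> else G \<sigma>)"
  by (rule rcomputable_cong[of f "\<lambda>\<sigma>. (1 - C \<sigma>) * F \<sigma> + (1 - (1 - C \<sigma>)) * G \<sigma>"])
     (auto intro!: rcomputable_add rcomputable_mult rcomputable_diff rcomputable_const)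

lemma rcomputable_table:
  "rcomputable f F \<Longrightarrow> rcomputable f (\<lambda>\<sigma>. if F \<sigma> = 0 then a else if F \<sigma> = 1 then b else if F \<sigma> = 2 then c else d)"
  by (rule rcomputable_cong[of f "\<lambda>\<sigma>. if F \<sigma> = 0 then a else if F \<sigma> - 1 = 0 then b else if F \<sigma> - 2 = 0 then c else d"])
     (auto intro!: rcomputable_if rcomputable_diff rcomputable_const)

lemma rec_nat_sum: "rec_nat 0 (\<lambda>k r. r + h k) n = (\<Sum>k<n. h k :: nat)"
  by (induction n) auto

text \<open>\<open>d j k\<close> will be the \<open>k\<close>-th letter of the coding of the
  \<open>j\<close>-th ideal point, so that \<open>u\<close> is a word over three letters read as a
  ternary number.\<close>

definition select :: "(nat \<Rightarrow> nat \<Rightarrow> nat) \<Rightarrow> nat \<Rightarrow> nat \<Rightarrow> nat" where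
  "select d L u = (LEAST j. (\<Sum>k<L. d j k * 3 ^ k) = u)"

text \<open>The index of the uniform distribution on the points with the numbers
  \<open>select d L u\<close>, \<open>u < 3 ^ L\<close>. Nonempty lists are coded as head and tail in \<open>ideal_list\<close>, but with
  an additional successor in \<open>list_encode\<close>.\<close>

definition uniform_index :: "(nat \<Rightarrow> nat \<Rightarrow> nat) \<Rightarrow> nat \<Rightarrow> nat" where
  "uniform_index d L = list_encode (rev (map (\<lambda>u. prod_encode (select d L u, 0)) [0..<3 ^ L])) - 1"

lemma turing_computable_uniform_index:
  assumes f: "turing_computable f"
    and p: "\<And>x. p x = (if x = 0 then p0 else if x = 1 then p1 else if x = 2 then p2 else p3)"
    and d: "\<And>j k. d j k = p (f (prod_encode (j, k)))"
    and surj: "\<And>L u. u < 3 ^ L \<Longrightarrow> \<exists>j. (\<Sum>k<L. d j k * 3 ^ k) = u"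
  shows "turing_computable (\<lambda>n. uniform_index d (\<alpha> * n + \<beta>))"
proof -
  have "rcomputable f (\<lambda>\<sigma>. d (\<sigma> 0) (\<sigma> 1))"
    unfolding d p by (intro rcomputable_table rcomputable_call rcomputable_prod_encode rcomputable_var)
  note rcomputable_d = rcomputable_subst2[OF this]
  have rcomputable_code: "rcomputable f (\<lambda>\<sigma>. \<Sum>k<\<sigma> 1. d (\<sigma> 0) k * 3 ^ k)"
  proof (rule rcomputable_cong)
    show "rcomputable f (\<lambda>\<sigma>. rec_nat ((\<lambda>_. 0) \<sigma>) (\<lambda>k r. (\<lambda>\<sigma>. \<sigma> 3 + d (\<sigma> 0) (\<sigma> 2) * 3 ^ \<sigma> 2) (\<sigma>(2 := k, 3 := r))) (\<sigma> 1))"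
      by (rule rcomputable_rec) (auto intro!: rcomputable_add rcomputable_mult rcomputable_power rcomputable_var rcomputable_const rcomputable_d)
    show "rec_nat ((\<lambda>_. 0) \<sigma>) (\<lambda>k r. (\<lambda>\<sigma>. \<sigma> 3 + d (\<sigma> 0) (\<sigma> 2) * 3 ^ \<sigma> 2) (\<sigma>(2 := k, 3 := r))) (\<sigma> 1) =
       (\<Sum>k<\<sigma> 1. d (\<sigma> 0) k * 3 ^ k)" for \<sigma> :: "nat \<Rightarrow> nat"
      by (simp add: rec_nat_sum)
  qed
  \<comment> \<open>The search must end for all arguments. The truncated factor
    \<open>3 ^ L - u\<close> vanishes for those \<open>u\<close> that code no word of length
    \<open>L\<close>; the sum of the two truncated differences vanishes exactly at equality.\<close>
  define J where "J L u = (LEAST j. (3 ^ L - u) * ((\<Sum>k<L. d j k * 3 ^ k) - u + (u - (\<Sum>k<L. d j k * 3 ^ k))) = 0)" for L u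
  have J: "J L u = select d L u" if "u < 3 ^ L" for L u
    unfolding J_def select_def using that by (intro arg_cong[of _ _ Least]) (auto simp: fun_eq_iff)
  have "rcomputable f (\<lambda>\<sigma>. J (\<sigma> 0) (\<sigma> 1))"
  proof (rule rcomputable_cong)
    let ?P = "\<lambda>\<sigma>. (3 ^ \<sigma> 0 - \<sigma> 1) * ((\<Sum>k<\<sigma> 0. d (\<sigma> 2) k * 3 ^ k) - \<sigma> 1 +
         (\<sigma> 1 - (\<Sum>k<\<sigma> 0. d (\<sigma> 2) k * 3 ^ k)))"
    have "rcomputable f (\<lambda>\<sigma>. \<Sum>k<\<sigma> 0. d (\<sigma> 2) k * 3 ^ k)"
      using rcomputable_subst2[OF rcomputable_code rcomputable_var[of f 2] rcomputable_var[of f 0]] .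
    then have P: "rcomputable f ?P"
      by (intro rcomputable_add rcomputable_mult rcomputable_diff rcomputable_power rcomputable_const rcomputable_var)
    show "rcomputable f (\<lambda>\<sigma>. LEAST k. ?P (\<sigma>(2 := k)) = 0)"
    proof (rule rcomputable_Least[OF P])
      fix \<sigma> :: "nat \<Rightarrow> nat"
      show "\<exists>k. ?P (\<sigma>(2 := k)) = 0"
      proof (cases "\<sigma> 1 < 3 ^ \<sigma> 0")
        case True
        from surj[OF this] obtain j where "(\<Sum>k<\<sigma> 0. d j k * 3 ^ k) = \<sigma> 1" by blast
        then show ?thesis by (intro exI[of _ j]) simp
      qed auto
    qed
    show "(LEAST k. ?P (\<sigma>(2 := k)) = 0) = J (\<sigma> 0) (\<sigma> 1)" for \<sigma> :: "nat \<Rightarrow> nat"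
      by (simp add: J_def)
  qed
  note rcomputable_J = rcomputable_subst2[OF this]
  \<comment> \<open>The recursion puts each new element in front, so the list comes out reversed;
    this is the origin of \<open>rev\<close> in \<open>uniform_index\<close>.\<close>
  define G where "G L n = rec_nat 0 (\<lambda>t r. Suc (prod_encode (prod_encode (J L t, 0), r))) n" for L n
  have "rcomputable f (\<lambda>\<sigma>. G (\<sigma> 0) (\<sigma> 1))"
  proof (rule rcomputable_cong)
    show "rcomputable f (\<lambda>\<sigma>. rec_nat ((\<lambda>_. 0) \<sigma>)
        (\<lambda>t r. (\<lambda>\<sigma>. Suc (prod_encode (prod_encode (J (\<sigma> 0) (\<sigma> 2), 0), \<sigma> 3))) (\<sigma>(2 := t, 3 := r))) (\<sigma> 1))"
      by (rule rcomputable_rec) (auto intro!: rcomputable_Suc rcomputable_prod_encode rcomputable_var rcomputable_const rcomputable_J)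
    show "rec_nat ((\<lambda>_. 0) \<sigma>)
        (\<lambda>t r. (\<lambda>\<sigma>. Suc (prod_encode (prod_encode (J (\<sigma> 0) (\<sigma> 2), 0), \<sigma> 3))) (\<sigma>(2 := t, 3 := r))) (\<sigma> 1) =
      G (\<sigma> 0) (\<sigma> 1)" for \<sigma> :: "nat \<Rightarrow> nat"
      by (simp add: G_def)
  qed
  note rcomputable_G = rcomputable_subst2[OF this]
  have G: "G L n = list_encode (rev (map (\<lambda>u. prod_encode (J L u, 0)) [0..<n]))" for L n
    by (induction n) (auto simp: G_def)
  have "G L (3 ^ L) - 1 = uniform_index d L" for L
  proof -
    have "map (\<lambda>u. prod_encode (J L u, 0)) [0..<3 ^ L] = map (\<lambda>u. prod_encode (select d L u, 0)) [0..<3 ^ L]"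
      by (auto simp: J)
    then show ?thesis unfolding G uniform_index_def by (rule arg_cong)
  qed
  moreover have "rcomputable f (\<lambda>\<sigma>. G (\<alpha> * \<sigma> 0 + \<beta>) (3 ^ (\<alpha> * \<sigma> 0 + \<beta>)) - 1)"
    by (intro rcomputable_pred rcomputable_G rcomputable_power rcomputable_add rcomputable_mult rcomputable_const rcomputable_var)
  ultimately have "rcomputable f (\<lambda>\<sigma>. uniform_index d (\<alpha> * \<sigma> 0 + \<beta>))" by simp
  then show ?thesis by (rule turing_computable_rcomputable[OF f])
qed

section \<open>Heights and matching brackets\<close>

definition opener :: "bracket \<Rightarrow> bool" where
  "opener c \<longleftrightarrow> c = LPar \<or> c = LBrk"

definition bstep :: "bracket \<Rightarrow> int" where
  "bstep c = (if opener c then 1 else -1)"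

definition matching :: "bracket \<Rightarrow> bracket \<Rightarrow> bool" where
  "matching a b \<longleftrightarrow> a = LPar \<and> b = RPar \<or> a = LBrk \<and> b = RBrk"

definition height :: "biseq \<Rightarrow> int \<Rightarrow> int \<Rightarrow> int" where
  "height x a b = (\<Sum>l\<in>{a..<b}. bstep (x l))"

text \<open>Partners by nesting alone, irrespective of type: the height counted from
  \<open>i\<close> returns to 0 for the first time with the bracket at \<open>j\<close>. This
  depends only on the pattern of opening and closing brackets, which both codings retain.\<close>

definition bpair :: "biseq \<Rightarrow> int \<Rightarrow> int \<Rightarrow> bool" where
  "bpair x i j \<longleftrightarrow> i < j \<and> (\<forall>k. i < k \<and> k \<le> j \<longrightarrow> height x i k \<ge> 1) \<and> height x i (j + 1) = 0"

text \<open>This condition concerns finite stretches only and therefore passes to the closure,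
  whereas a limit of concatenations may contain brackets that have no partner at all.\<close>

definition good :: "biseq \<Rightarrow> bool" where
  "good x \<longleftrightarrow> (\<forall>i j. bpair x i j \<longrightarrow> matching (x i) (x j))"

lemma matching_opener: "matching a b \<Longrightarrow> opener a \<and> \<not> opener b"
  by (auto simp: matching_def opener_def)

lemma height_refl [simp]: "height x a a = 0"
  by (simp add: height_def)

lemma height_split: "a \<le> b \<Longrightarrow> b \<le> c \<Longrightarrow> height x a c = height x a b + height x b c"
  unfolding height_def by (subst sum.union_disjoint[symmetric]) (auto intro!: sum.cong)

lemma height_Suc: "a \<le> b \<Longrightarrow> height x a (b + 1) = height x a b + bstep (x b)"
proof -
  assume "a \<le> b"
  then have "{a..<b + 1} = insert b {a..<b}" by auto
  then show ?thesis by (simp add: height_def)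
qed

lemma height_first: "a < b \<Longrightarrow> height x a b = bstep (x a) + height x (a + 1) b"
  using height_split[of a "a + 1" b x] height_Suc[of a a x] by simp

lemma height_cong: "(\<And>l. a \<le> l \<Longrightarrow> l < b \<Longrightarrow> bstep (x l) = bstep (y l)) \<Longrightarrow> height x a b = height y a b"
  unfolding height_def by (intro sum.cong) auto

lemma bpair_unique: "bpair x i j \<Longrightarrow> bpair x i j' \<Longrightarrow> j = j'"
  unfolding bpair_def by (smt (verit))

lemma bpair_opener: "bpair x i j \<Longrightarrow> opener (x i)"
  using height_Suc[of i i x] by (auto simp: bpair_def bstep_def split: if_splits dest: spec[of _ "i + 1"])

lemma bpair_cong:
  assumes "bpair x i j" "\<And>l. i \<le> l \<Longrightarrow> l \<le> j \<Longrightarrow> bstep (x l) = bstep (y l)"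
  shows "bpair y i j"
proof -
  have "height x i k = height y i k" if "k \<le> j + 1" for k
    using assms(2) that by (intro height_cong) auto
  then show ?thesis using assms(1) unfolding bpair_def by auto
qed

subsection \<open>Balanced words\<close>

text \<open>Splitting at the first bracket and its partner gives an induction along the nesting, in
  place of the recursion on lengths in \<open>dyck_words\<close>.\<close>

inductive bal :: "bracket list \<Rightarrow> bool" where
  Nil: "bal []"
| Pair: "matching a b \<Longrightarrow> bal u \<Longrightarrow> bal v \<Longrightarrow> bal (a # u @ b # v)"

lemma bal_append: "bal u \<Longrightarrow> bal v \<Longrightarrow> bal (u @ v)"
  by (induction rule: bal.induct) (auto intro: bal.intros)

lemma bal_wrap: "matching a b \<Longrightarrow> bal u \<Longrightarrow> bal (a # u @ [b])"
  using bal.Pair[OF _ _ bal.Nil] .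

lemma bal_concat: "(\<And>w. w \<in> set ws \<Longrightarrow> bal w) \<Longrightarrow> bal (concat ws)"
  by (induction ws) (auto intro: bal.Nil bal_append)

lemma bal_dyck_words: "w \<in> dyck_words n \<Longrightarrow> bal w"
proof (induction n arbitrary: w rule: less_induct)
  case (less n)
  consider "n = 0" | "n = 1" | "n \<ge> 2" by linarith
  then show ?case
  proof cases
    case 1
    then show ?thesis using less.prems by (simp add: dyck_words.simps)
  next
    case 2
    then have "w = [LPar, RPar] \<or> w = [LBrk, RBrk]" using less.prems by (simp add: dyck_words.simps)
    then show ?thesis
      using bal_wrap[OF _ bal.Nil, of LPar RPar] bal_wrap[OF _ bal.Nil, of LBrk RBrk]
      by (auto simp: matching_def)
  next
    case 3
    then obtain ws where ws: "ws \<in> lists (\<Union>k\<in>{1..<n}. dyck_words k)"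
      "w = LPar # concat ws @ [RPar] \<or> w = LBrk # concat ws @ [RBrk]"
      using less.prems by (subst (asm) dyck_words.simps) auto
    have "bal (concat ws)"
    proof (rule bal_concat)
      fix v assume "v \<in> set ws"
      then have "v \<in> (\<Union>k\<in>{1..<n}. dyck_words k)" using ws(1) by blast
      then show "bal v" using less.IH by auto
    qed
    then show ?thesis using ws(2) bal_wrap by (auto simp: matching_def)
  qed
qed

lemma bal_generators: "w \<in> dyck_generators \<Longrightarrow> bal w"
  by (auto simp: dyck_generators_def intro: bal_dyck_words)

text \<open>The claims on heights carry the induction: within the outer pair the heights of
  \<open>u\<close> are raised by 1 and so stay positive, as \<open>bpair\<close> demands.\<close>

lemma bal_heights:
  assumes "bal w" "\<And>i. i < length w \<Longrightarrow> x (a + int i) = w ! i"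
  shows "(\<forall>k. a \<le> k \<and> k \<le> a + int (length w) \<longrightarrow> height x a k \<ge> 0) \<and>
     height x a (a + int (length w)) = 0 \<and>
     (\<forall>i. a \<le> i \<and> i < a + int (length w) \<and> opener (x i) \<longrightarrow> (\<exists>j. bpair x i j \<and> matching (x i) (x j)))"
  using assms
proof (induction arbitrary: a rule: bal.induct)
  case Nil
  then show ?case by auto
next
  case (Pair p q u v)
  define m where "m = a + 1 + int (length u)"
  define b where "b = m + 1 + int (length v)"
  have b: "a + int (length (p # u @ q # v)) = b" by (simp add: b_def m_def)
  have xa: "x a = p" using Pair.prems[of 0] by simp
  have xm: "x m = q" using Pair.prems[of "Suc (length u)"] by (simp add: m_def nth_append add.assoc)
  have "x (a + 1 + int i) = u ! i" if "i < length u" for i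
    using Pair.prems[of "Suc i"] that by (simp add: nth_append add.assoc)
  note U = Pair.IH(1)[OF this, folded m_def]
  have "x (m + 1 + int i) = v ! i" if "i < length v" for i
    using Pair.prems[of "Suc (length u) + Suc i"] that by (simp add: m_def nth_append algebra_simps)
  note V = Pair.IH(2)[OF this, folded b_def]
  have am: "a + 1 \<le> m" and mb: "m + 1 \<le> b" by (simp_all add: m_def b_def)
  have steps: "bstep (x a) = 1" "bstep (x m) = -1"
    using matching_opener[OF Pair.hyps(1)] by (simp_all add: xa xm bstep_def)
  have h1: "height x a k = 1 + height x (a + 1) k" if "a < k" for k
    using height_first[OF that] steps by simp
  have hm: "height x a (m + 1) = 0"
    using height_Suc[of a m x] h1[of m] U steps am by simp
  have pair: "bpair x a m" unfolding bpair_def using am h1 U hm by auto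
  show ?case unfolding b
  proof (intro conjI allI impI)
    fix k assume k: "a \<le> k \<and> k \<le> b"
    show "0 \<le> height x a k"
    proof (cases "k \<le> m")
      case True
      then show ?thesis using h1[of k] U k by (cases "k = a") auto
    next
      case False
      then show ?thesis using height_split[of a "m + 1" k x] hm V k am by auto
    qed
  next
    show "height x a b = 0" using height_split[of a "m + 1" b x] hm V am mb by auto
  next
    fix i assume i: "a \<le> i \<and> i < b \<and> opener (x i)"
    have "i \<noteq> m" using steps i by (auto simp: bstep_def split: if_splits)
    then consider "i = a" | "a + 1 \<le> i" "i < m" | "m + 1 \<le> i" using i by linarith
    then show "\<exists>j. bpair x i j \<and> matching (x i) (x j)"
    proof cases
      case 1
      then show ?thesis using pair Pair.hyps(1) xa xm by blast
    next
      case 2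
      then show ?thesis using U i by blast
    next
      case 3
      then show ?thesis using V i by blast
    qed
  qed
qed

lemma bpair_good:
  assumes "\<And>i. opener (x i) \<Longrightarrow> \<exists>j. bpair x i j \<and> matching (x i) (x j)"
  shows "good x"
  unfolding good_def using assms bpair_unique bpair_opener by metis

text \<open>Steps of at least 1 make the cut points unbounded in both directions, so no integer
  escapes the blocks.\<close>

lemma increasing_unbounded:
  fixes p :: "int \<Rightarrow> int"
  assumes "\<And>i. p i < p (i + 1)"
  obtains i where "p i \<le> n" "n < p (i + 1)"
proof -
  have up: "p 0 + int k \<le> p (int k)" for k
  proof (induction k)
    case (Suc k)
    then show ?case using assms[of "int k"] by (simp add: add.commute)
  qed simp
  have down: "p (- int k) \<le> p 0 - int k" for k
  proof (induction k)
    case (Suc k)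
    then show ?case using assms[of "- int (Suc k)"] by simp
  qed simp
  have mono: "p i \<le> p j" if "i \<le> j" for i j
    using that by (induction j rule: int_ge_induct) (use assms order.trans less_imp_le in \<open>blast+\<close>)
  define A where "A = {i. p i \<le> n}"
  have "A \<subseteq> {..nat (n - p 0)}"
  proof
    fix i assume "i \<in> A"
    show "i \<in> {..int (nat (n - p 0))}"
    proof (rule ccontr)
      assume "i \<notin> {..int (nat (n - p 0))}"
      then have i: "i \<ge> int (nat (n - p 0) + 1)" by simp
      have "p 0 + int (nat (n - p 0) + 1) \<le> p i"
        using up[of "nat (n - p 0) + 1"] mono[OF i] by linarith
      with \<open>i \<in> A\<close> show False by (auto simp: A_def split: if_splits)
    qed
  qed
  moreover have "- int (nat (p 0 - n)) \<in> A"
    using down[of "nat (p 0 - n)"] by (auto simp: A_def)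
  ultimately obtain i where "i \<in> A" "i + 1 \<notin> A"
  proof -
    assume sub: "A \<subseteq> {..int (nat (n - p 0))}" and l: "- int (nat (p 0 - n)) \<in> A"
    define B where "B = A \<inter> {- int (nat (p 0 - n))..}"
    have fin: "finite B" by (rule finite_subset[of _ "{- int (nat (p 0 - n))..int (nat (n - p 0))}"]) (use sub in \<open>auto simp: B_def\<close>)
    have ne: "B \<noteq> {}" using l by (auto simp: B_def)
    have "Max B \<in> B" by (rule Max_in[OF fin ne])
    moreover have "Max B + 1 \<notin> B" using Max_ge[OF fin, of "Max B + 1"] by auto
    ultimately have "Max B \<in> A" "Max B + 1 \<notin> A" by (auto simp: B_def)
    then show thesis by (rule that)
  qed
  then show thesis using that by (auto simp: A_def)
qed

lemma factor_nth: "a + int i < b \<Longrightarrow> factor x a b ! i = x (a + int i)"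
  by (simp add: factor_def)

lemma length_factor: "length (factor x a b) = nat (b - a)"
  by (simp add: factor_def)

text \<open>Generators are balanced, so an opening bracket finds a partner of its type within its
  own block, and partners by nesting are unique.\<close>

lemma good_concatenation:
  assumes "x \<in> biinfinite_concatenations dyck_generators"
  shows "good x"
proof (rule bpair_good)
  fix i assume "opener (x i)"
  from assms obtain p :: "int \<Rightarrow> int" where "\<forall>i. p i < p (i + 1) \<and> factor x (p i) (p (i + 1)) \<in> dyck_generators"
    unfolding biinfinite_concatenations_def by blast
  then have p: "\<And>i. p i < p (i + 1)" "\<And>i. factor x (p i) (p (i + 1)) \<in> dyck_generators" by blast+
  obtain m where m: "p m \<le> i" "i < p (m + 1)" by (rule increasing_unbounded[where p = p and n = i, OF p(1)])
  let ?w = "factor x (p m) (p (m + 1))"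
  have len: "p m + int (length ?w) = p (m + 1)" using p(1)[of m] by (simp add: length_factor)
  have "x (p m + int i) = ?w ! i" if "i < length ?w" for i
    using that by (subst factor_nth) (use len in auto)
  from bal_heights[OF bal_generators[OF p(2)] this] m \<open>opener (x i)\<close>
  show "\<exists>j. bpair x i j \<and> matching (x i) (x j)" unfolding len by blast
qed

lemma open_cylinder: "finite K \<Longrightarrow> open {y :: biseq. \<forall>k\<in>K. y k = x k}"
proof -
  assume "finite K"
  have "open ((\<lambda>y :: biseq. y k) -` {x k})" for k
    by (intro open_vimage discrete_topology_class.open_discrete continuous_on_product_coordinates)
  then have "open (\<Inter>k\<in>K. (\<lambda>y :: biseq. y k) -` {x k})" using \<open>finite K\<close> by (intro open_INT) auto
  moreover have "(\<Inter>k\<in>K. (\<lambda>y :: biseq. y k) -` {x k}) = {y. \<forall>k\<in>K. y k = x k}" by auto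
  ultimately show ?thesis by simp
qed

lemma closure_agree:
  fixes A :: "biseq set"
  assumes "x \<in> closure A" "finite K"
  obtains y where "y \<in> A" "\<And>k. k \<in> K \<Longrightarrow> y k = x k"
proof -
  have "{y. \<forall>k\<in>K. y k = x k} \<inter> A \<noteq> {}"
    using assms(1) open_cylinder[OF assms(2), of x] unfolding closure_iff_nhds_not_empty by blast
  then show thesis using that by blast
qed

lemma good_dyck_shift: "x \<in> dyck_shift \<Longrightarrow> good x"
proof (unfold good_def, intro allI impI)
  fix i j assume x: "x \<in> dyck_shift" and ij: "bpair x i j"
  obtain y where y: "y \<in> biinfinite_concatenations dyck_generators" "\<And>k. k \<in> {i..j} \<Longrightarrow> y k = x k"
    using closure_agree[of x _ "{i..j}"] x unfolding dyck_shift_def by blast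
  have "bpair y i j" by (rule bpair_cong[OF ij]) (simp add: y(2))
  then have "matching (y i) (y j)" using good_concatenation[OF y(1)] by (simp add: good_def)
  then show "matching (x i) (x j)" using y(2) ij by (simp add: bpair_def)
qed

lemma shift_concatenation:
  "x \<in> biinfinite_concatenations G \<Longrightarrow> (\<lambda>k. x (k + n)) \<in> biinfinite_concatenations G"
proof -
  assume "x \<in> biinfinite_concatenations G"
  then obtain p :: "int \<Rightarrow> int" where p: "\<forall>i. p i < p (i + 1) \<and> factor x (p i) (p (i + 1)) \<in> G"
    unfolding biinfinite_concatenations_def by blast
  have "factor (\<lambda>k. x (k + n)) (p i - n) (p (i + 1) - n) = factor x (p i) (p (i + 1))" for i
    by (rule nth_equalityI) (auto simp: length_factor factor_nth)
  then show ?thesis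
    using p unfolding biinfinite_concatenations_def by (intro CollectI exI[of _ "\<lambda>i. p i - n"]) auto
qed

subsection \<open>Three-letter codings\<close>

text \<open>\<open>proj True\<close> forgets the type of closing brackets, \<open>proj False\<close> that of opening brackets.
  The forgotten type is that of the partner, which lies to the left and to the right,
  respectively; \<open>window d k t\<close> are the \<open>t\<close> positions next to \<open>k\<close> on that side.\<close>

definition proj :: "bool \<Rightarrow> bracket \<Rightarrow> nat" where
  "proj d c = (if opener c = d then (if c = LPar \<or> c = RPar then 0 else 1) else 2)"

definition weight :: "nat \<Rightarrow> int" where
  "weight a = (if a < 2 then 1 else -1)"

definition window :: "bool \<Rightarrow> int \<Rightarrow> nat \<Rightarrow> int set" where
  "window d k t = (if d then {k - int t..<k} else {k + 1..<k + 1 + int t})"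

text \<open>The signs are arranged so that on either side an excess of at least 1 puts the partner
  of a bracket with forgotten type at \<open>k\<close> into the window: letters with retained type
  count 1, the forgotten one counts -1.\<close>

definition excess :: "bool \<Rightarrow> biseq \<Rightarrow> int \<Rightarrow> nat \<Rightarrow> int" where
  "excess d x k t = (\<Sum>l\<in>window d k t. weight (proj d (x l)))"

lemma proj_less: "proj d c < 3"
  by (auto simp: proj_def)

lemma weight_proj: "weight (proj d c) = (if d then bstep c else - bstep c)"
  by (auto simp: weight_def proj_def bstep_def)

lemma excess_True: "excess True x k t = height x (k - int t) k"
  by (simp add: excess_def window_def height_def weight_proj)

lemma excess_False: "excess False x k t = - height x (k + 1) (k + 1 + int t)"
  by (simp add: excess_def window_def height_def weight_proj sum_negf)

lemma proj_bstep: "proj d a = proj d b \<Longrightarrow> bstep a = bstep b"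
  using weight_proj[of d a] weight_proj[of d b] by (auto split: if_splits)

lemma proj_eq: "proj d a = proj d b \<Longrightarrow> proj d a \<noteq> 2 \<Longrightarrow> a = b"
  by (cases a; cases b; cases d; simp add: proj_def opener_def)

lemma proj_2: "proj d a = 2 \<longleftrightarrow> opener a \<noteq> d"
  by (auto simp: proj_def)

lemma matching_unique: "matching a b \<Longrightarrow> matching a c \<Longrightarrow> b = c" "matching a c \<Longrightarrow> matching b c \<Longrightarrow> a = b"
  by (auto simp: matching_def)

text \<open>The partner of a closing bracket at \<open>k\<close> is the last position
  \<open>m\<close> from which the height up to \<open>k\<close> is positive. The height hypothesis
  keeps it in the stretch, the coding retains its type, and goodness passes this type on to
  \<open>k\<close>, in \<open>x\<close> and \<open>y\<close> alike.\<close>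

lemma determined_left:
  assumes "good x" "good y" "\<And>l. l \<in> {i..k} \<Longrightarrow> proj True (x l) = proj True (y l)"
    "i \<le> k" "height x i k \<ge> 1"
  shows "x k = y k"
proof (cases "opener (x k)")
  case True
  then show ?thesis using proj_eq[OF assms(3)[of k]] assms(4) proj_2 by auto
next
  case False
  define A where "A = {l \<in> {i..k}. height x l k \<ge> 1}"
  have fin: "finite A" by (rule finite_subset[of _ "{i..k}"]) (auto simp: A_def)
  have "i \<in> A" using assms(4,5) by (simp add: A_def)
  then have ne: "A \<noteq> {}" by blast
  define m where "m = Max A"
  have m: "i \<le> m" "m \<le> k" "height x m k \<ge> 1" using Max_in[OF fin ne] by (auto simp: A_def m_def)
  have mk: "m < k" using m by (cases "m = k") auto
  have after: "height x l k \<le> 0" if "m < l" "l \<le> k" for l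
  proof (rule ccontr)
    assume "\<not> height x l k \<le> 0"
    then have "l \<in> A" using that m by (auto simp: A_def)
    then show False using Max_ge[OF fin, of l] that(1) by (simp add: m_def)
  qed
  have one: "height x m k = 1"
    using height_first[OF mk, of x] after[of "m + 1"] mk m(3) by (auto simp: bstep_def split: if_splits)
  have "bpair x m k"
    unfolding bpair_def
  proof (intro conjI allI impI)
    fix l assume "m < l \<and> l \<le> k"
    then show "1 \<le> height x m l" using height_split[of m l k x] after[of l] one by auto
  next
    show "height x m (k + 1) = 0" using height_Suc[of m k x] one mk False by (simp add: bstep_def)
  qed (rule mk)
  moreover have "bpair y m k"
    by (rule bpair_cong[OF calculation]) (use m in \<open>auto intro!: proj_bstep assms(3)\<close>)
  ultimately have "matching (x m) (x k)" "matching (y m) (y k)"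
    using assms(1,2) by (auto simp: good_def)
  moreover have "x m = y m"
    using proj_eq[OF assms(3)[of m]] m mk matching_opener[OF calculation(1)] proj_2 by auto
  ultimately show ?thesis using matching_unique by metis
qed

text \<open>The mirror image of \<open>determined_left\<close>: the partner of an opening bracket at
  \<open>k\<close> is the first position after which the height counted from \<open>k + 1\<close> is
  negative.\<close>

lemma determined_right:
  assumes "good x" "good y" "\<And>l. l \<in> {k..i} \<Longrightarrow> proj False (x l) = proj False (y l)"
    "k \<le> i" "height x (k + 1) (i + 1) \<le> -1"
  shows "x k = y k"
proof (cases "opener (x k)")
  case False
  then show ?thesis using proj_eq[OF assms(3)[of k]] assms(4) proj_2 by auto
next
  case True
  define A where "A = {l \<in> {k..i}. height x (k + 1) (l + 1) \<le> -1}"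
  have fin: "finite A" by (rule finite_subset[of _ "{k..i}"]) (auto simp: A_def)
  have "i \<in> A" using assms(4,5) by (simp add: A_def)
  then have ne: "A \<noteq> {}" by blast
  define m where "m = Min A"
  have m: "k \<le> m" "m \<le> i" "height x (k + 1) (m + 1) \<le> -1" using Min_in[OF fin ne] by (auto simp: A_def m_def)
  have mk: "k < m" using m by (cases "m = k") auto
  have before: "height x (k + 1) l \<ge> 0" if "k < l" "l \<le> m" for l
  proof (rule ccontr)
    assume "\<not> height x (k + 1) l \<ge> 0"
    then have "l - 1 \<in> A" using that m by (auto simp: A_def)
    then show False using Min_le[OF fin, of "l - 1"] that(2) by (auto simp: m_def)
  qed
  have one: "height x k l = 1 + height x (k + 1) l" if "k < l" for l
    using height_first[OF that, of x] True by (simp add: bstep_def)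
  have "bpair x k m"
    unfolding bpair_def
  proof (intro conjI allI impI)
    fix l assume "k < l \<and> l \<le> m"
    then show "1 \<le> height x k l" using one[of l] before[of l] by auto
  next
    have "height x (k + 1) (m + 1) = height x (k + 1) m + bstep (x m)"
      using mk by (intro height_Suc) auto
    then have "height x (k + 1) (m + 1) = -1"
      using before[of m] mk m(3) by (auto simp: bstep_def split: if_splits)
    then show "height x k (m + 1) = 0" using one[of "m + 1"] mk by simp
  qed (rule mk)
  moreover have "bpair y k m"
    by (rule bpair_cong[OF calculation]) (use m in \<open>auto intro!: proj_bstep assms(3)\<close>)
  ultimately have "matching (x k) (x m)" "matching (y k) (y m)"
    using assms(1,2) by (auto simp: good_def)
  moreover have "x m = y m"
    using proj_eq[OF assms(3)[of m]] m mk matching_opener[OF calculation(1)] proj_2 by auto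
  ultimately show ?thesis using matching_unique by metis
qed

lemma determined:
  assumes "good x" "good y" "\<And>l. l \<in> insert k (window d k t) \<Longrightarrow> proj d (x l) = proj d (y l)"
    "proj d (x k) = 2 \<Longrightarrow> excess d x k t \<ge> 1"
  shows "x k = y k"
proof (cases "proj d (x k) = 2")
  case False
  then show ?thesis using proj_eq[of d "x k" "y k"] assms(3)[of k] by simp
next
  case True
  with assms(4) have e: "excess d x k t \<ge> 1" by simp
  show ?thesis
  proof (cases d)
    case True
    have "{k - int t..k} = insert k (window d k t)" by (auto simp: window_def True)
    then show ?thesis
      using determined_left[OF assms(1,2), of "k - int t" k] assms(3) e True by (auto simp: excess_True)
  next
    case False
    have "{k..k + int t} = insert k (window d k t)" by (auto simp: window_def False)
    then show ?thesis
      using determined_right[OF assms(1,2), of k "k + int t"] assms(3) e False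
      by (auto simp: excess_False add.commute add.left_commute)
  qed
qed

section \<open>Brackets without partner\<close>

definition unmatched :: "bool \<Rightarrow> biseq \<Rightarrow> int \<Rightarrow> bool" where
  "unmatched d x k \<longleftrightarrow> proj d (x k) = 2 \<and> (\<forall>t. excess d x k t \<le> 0)"

text \<open>If \<open>i < k\<close>, the stretch from \<open>i\<close> up to \<open>k\<close> has
  height at most 0 as seen from the unmatched closing bracket; but without the opening bracket at
  \<open>i\<close> it has height at least 0, hence at least 1 with it.\<close>

lemma unmatched_order:
  assumes "unmatched False x i" "unmatched True x k"
  shows "k < i"
proof (rule ccontr)
  assume "\<not> k < i"
  have "opener (x i)" "\<not> opener (x k)" using assms by (auto simp: unmatched_def proj_2)
  then have "i < k" using \<open>\<not> k < i\<close> by (cases "i = k") auto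
  have "height x i k \<le> 0"
    using assms(2) \<open>i < k\<close> unfolding unmatched_def excess_True by (metis diff_diff_eq2 add_diff_cancel_left' int_nat_eq less_imp_le diff_ge_0_iff_ge)
  moreover have "height x (i + 1) k \<ge> 0"
  proof -
    have "k = i + 1 + int (nat (k - i - 1))" using \<open>i < k\<close> by simp
    then show ?thesis using assms(1) unfolding unmatched_def excess_False by (metis neg_le_0_iff_le)
  qed
  ultimately show False
    using height_first[OF \<open>i < k\<close>, of x] \<open>opener (x i)\<close> by (simp add: bstep_def)
qed

lemma excess_shift: "excess d (\<lambda>l. x (l + n)) k t = excess d x (k + n) t"
proof -
  have "bij_betw (\<lambda>l. l + n) (window d k t) (window d (k + n) t)"
    by (rule bij_betwI[of _ _ _ "\<lambda>l. l - n"]) (auto simp: window_def split: if_splits)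
  from sum.reindex_bij_betw[OF this, of "\<lambda>l. weight (proj d (x l))"] show ?thesis
    by (simp add: excess_def)
qed

lemma unmatched_shift: "unmatched d (\<lambda>l. x (l + n)) k \<longleftrightarrow> unmatched d x (k + n)"
  by (simp add: unmatched_def excess_shift)

subsection \<open>The growth of the language\<close>

abbreviation gen_words :: "bracket list set" where
  "gen_words \<equiv> concat ` lists dyck_generators"

lemma dyck_words_0: "dyck_words 0 = {}"
  by (subst dyck_words.simps) simp

lemma dyck_words_1: "dyck_words (Suc 0) = {[LPar, RPar], [LBrk, RBrk]}"
  by (subst dyck_words.simps) simp

lemma length_dyck_words: "w \<in> dyck_words n \<Longrightarrow> length w = 2 * n"
proof -
  assume w: "w \<in> dyck_words n"
  consider "n = 0" | "n = 1" | "n \<ge> 2" by linarith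
  then show ?thesis
  proof cases
    case 3
    then show ?thesis using w by (subst (asm) dyck_words.simps) auto
  qed (use w in \<open>auto simp: dyck_words_0 dyck_words_1\<close>)
qed

lemma dyck_words_in_generators: "w \<in> dyck_words n \<Longrightarrow> w \<in> dyck_generators"
  by (cases "n = 0") (auto simp: dyck_generators_def dyck_words_0)

lemma generatorE:
  assumes "w \<in> dyck_generators"
  obtains n where "n \<ge> 1" "w \<in> dyck_words n"
  using assms by (auto simp: dyck_generators_def)

lemma gen_words_append: "u \<in> gen_words \<Longrightarrow> v \<in> gen_words \<Longrightarrow> u @ v \<in> gen_words"
proof -
  assume "u \<in> gen_words" "v \<in> gen_words"
  then obtain us vs where "us \<in> lists dyck_generators" "u = concat us" "vs \<in> lists dyck_generators" "v = concat vs"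
    by blast
  then have "us @ vs \<in> lists dyck_generators" "u @ v = concat (us @ vs)" by auto
  then show ?thesis by blast
qed

lemma generator_gen_word: "w \<in> dyck_generators \<Longrightarrow> w \<in> gen_words"
  by (rule image_eqI[of _ _ "[w]"]) auto

lemma Nil_gen_word: "[] \<in> gen_words"
  by (rule image_eqI[of _ _ "[]"]) auto

text \<open>\<open>dyck_words\<close> is graded by length, so the level is read off from the length
  of \<open>w\<close>, which is even. The parts of \<open>w\<close> are no longer than
  \<open>w\<close> and lie on lower levels.\<close>

lemma wrap_generator:
  assumes "matching a b" "w \<in> gen_words"
  shows "a # w @ [b] \<in> dyck_generators"
proof -
  from assms(2) obtain ws where ws: "w = concat ws" "set ws \<subseteq> dyck_generators" by auto
  have ab: "a = LPar \<and> b = RPar \<or> a = LBrk \<and> b = RBrk" using assms(1) by (simp add: matching_def)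
  show ?thesis
  proof (cases "w = []")
    case True
    then have "a # w @ [b] \<in> dyck_words 1" using ab by (auto simp: dyck_words_1)
    then show ?thesis by (rule dyck_words_in_generators)
  next
    case False
    have "even (length (concat vs))" if "set vs \<subseteq> dyck_generators" for vs
      using that by (induction vs) (auto elim!: generatorE dest!: length_dyck_words)
    from this[OF ws(2)] have ev: "even (length w)" using ws(1) by simp
    define n where "n = length w div 2 + 1"
    have n: "n \<ge> 2" "length w = 2 * n - 2"
    proof -
      have "length w \<noteq> 1" using ev by auto
      moreover have "length w \<noteq> 0" using False by simp
      ultimately have "2 \<le> length w" by linarith
      then show "n \<ge> 2" by (simp add: n_def div_greater_zero_iff Suc_le_eq)
    qed (use ev in \<open>auto simp: n_def elim!: evenE\<close>)
    have "ws \<in> lists (\<Union>k\<in>{1..<n}. dyck_words k)"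
    proof (unfold in_lists_conv_set, intro ballI)
      fix v assume v: "v \<in> set ws"
      from subsetD[OF ws(2) v] obtain k where k: "k \<ge> 1" "v \<in> dyck_words k" by (rule generatorE)
      have "length v \<le> length w"
        using v member_le_sum_list[of "length v" "map length ws"] by (simp add: ws(1) length_concat)
      then have "k < n" using length_dyck_words[OF k(2)] n by simp
      then show "v \<in> (\<Union>k\<in>{1..<n}. dyck_words k)" using k by auto
    qed
    then have "w \<in> {w \<in> concat ` lists (\<Union>k\<in>{1..<n}. dyck_words k). length w = 2 * n - 2}"
      using n(2) ws(1) by blast
    moreover have "dyck_words n = (\<Union>w \<in> {w \<in> concat ` lists (\<Union>k\<in>{1..<n}. dyck_words k). length w = 2 * n - 2}.
              {LPar # w @ [RPar], LBrk # w @ [RBrk]})"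
      using n(1) by (subst dyck_words.simps) auto
    ultimately have "a # w @ [b] \<in> dyck_words n" using ab by blast
    then show ?thesis by (rule dyck_words_in_generators)
  qed
qed

text \<open>\<open>stack st w\<close>: after reading \<open>w\<close>, exactly the opening brackets in \<open>st\<close>, innermost first,
  are not yet closed.\<close>

fun stack :: "bracket list \<Rightarrow> bracket list \<Rightarrow> bool" where
  "stack [] w \<longleftrightarrow> w \<in> gen_words"
| "stack (a # st) w \<longleftrightarrow> (\<exists>u v. w = u @ a # v \<and> stack st u \<and> v \<in> gen_words)"

lemma stack_append: "stack st w \<Longrightarrow> v \<in> gen_words \<Longrightarrow> stack st (w @ v)"
proof (cases st)
  case Nil
  assume "stack st w" "v \<in> gen_words"
  then show ?thesis using Nil gen_words_append by simp
next
  case (Cons a st')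
  assume *: "stack st w" "v \<in> gen_words"
  then obtain u u' where "w = u @ a # u'" "stack st' u" "u' \<in> gen_words" using Cons by auto
  then show ?thesis unfolding Cons stack.simps
    by (intro exI[of _ u] exI[of _ "u' @ v"]) (use gen_words_append *(2) in auto)
qed

lemma stack_push: "stack st w \<Longrightarrow> stack (a # st) (w @ [a])"
  unfolding stack.simps by (intro exI[of _ w] exI[of _ "[]"]) (use Nil_gen_word in auto)

lemma stack_pop: "stack (a # st) w \<Longrightarrow> matching a b \<Longrightarrow> stack st (w @ [b])"
proof -
  assume *: "stack (a # st) w" "matching a b"
  then obtain u v where uv: "w = u @ a # v" "stack st u" "v \<in> gen_words" by auto
  have "stack st (u @ (a # v @ [b]))"
    by (rule stack_append[OF uv(2) generator_gen_word[OF wrap_generator[OF *(2) uv(3)]]])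
  then show ?thesis by (simp add: uv(1))
qed

text \<open>An opening bracket put in front of everything becomes the outermost open one. It will be
  the partner of a closing letter that meets an empty stack.\<close>

lemma stack_bottom: "stack st w \<Longrightarrow> stack (st @ [a]) (a # w)"
proof (induction st arbitrary: w)
  case Nil
  then have "a # w = [] @ a # w \<and> stack [] [] \<and> w \<in> gen_words" using Nil_gen_word by simp
  then show ?case unfolding append_Nil[of "[a]"] stack.simps(2) by blast
next
  case (Cons b st)
  then obtain u v where uv: "w = u @ b # v" "stack st u" "v \<in> gen_words" by auto
  then have "a # w = (a # u) @ b # v \<and> stack (st @ [a]) (a # u) \<and> v \<in> gen_words"
    using Cons.IH[OF uv(2)] by simp
  then show ?case unfolding append_Cons[of b st] stack.simps(2) by blast
qed

text \<open>A letter with a type opens a bracket of this type, and the letter 2 closes the innermost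
  open bracket in the matching way. If none is open, an opening bracket is added in front of the
  prefix \<open>p\<close>.\<close>

lemma decode_word:
  assumes "set u \<subseteq> {..<3}"
  shows "\<exists>p w st. map (proj True) w = u \<and> stack st (p @ w) \<and> (\<forall>a\<in>set st. opener a)"
  using assms
proof (induction u rule: rev_induct)
  case Nil
  show ?case by (intro exI[of _ "[]"]) (use Nil_gen_word in auto)
next
  case (snoc a u)
  then obtain p w st where IH: "map (proj True) w = u" "stack st (p @ w)" "\<forall>a\<in>set st. opener a" by auto
  have push: ?case if "proj True b = a" "opener b" for b
    by (rule exI[of _ p], rule exI[of _ "w @ [b]"], rule exI[of _ "b # st"])
       (use IH that stack_push[OF IH(2), of b] in auto)
  consider "a = 0" | "a = 1" | "a = 2" using snoc.prems by force
  then show ?case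
  proof cases
    case 1
    then show ?thesis using push[of LPar] by (simp add: proj_def opener_def)
  next
    case 2
    then show ?thesis using push[of LBrk] by (simp add: proj_def opener_def)
  next
    case 3
    show ?thesis
    proof (cases st)
      case Nil
      then have "stack [LPar] (LPar # p @ w)" using stack_bottom[OF IH(2), of LPar] by simp
      from stack_pop[OF this, of RPar] have "stack [] ((LPar # p) @ (w @ [RPar]))"
        by (simp add: matching_def)
      then show ?thesis
        using IH(1) 3 by - (rule exI[of _ "LPar # p"], rule exI[of _ "w @ [RPar]"], rule exI[of _ "[]"],
          simp, simp add: proj_def opener_def)
    next
      case (Cons b st')
      then have "opener b" using IH(3) by simp
      then obtain c where c: "matching b c" by (auto simp: matching_def opener_def)
      have "proj True c = 2" using matching_opener[OF c] by (simp add: proj_2)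
      then show ?thesis
        using IH(1,3) 3 stack_pop[OF IH(2)[unfolded Cons] c] Cons
        by - (rule exI[of _ p], rule exI[of _ "w @ [c]"], rule exI[of _ st'], simp)
    qed
  qed
qed

lemma close_stack:
  assumes "stack st w" "\<forall>a\<in>set st. opener a"
  shows "\<exists>q. w @ q \<in> gen_words"
  using assms
proof (induction st arbitrary: w)
  case Nil
  then show ?case by (intro exI[of _ "[]"]) simp
next
  case (Cons a st)
  then have "opener a" by simp
  then obtain c where c: "matching a c" by (auto simp: matching_def opener_def)
  obtain q where "(w @ [c]) @ q \<in> gen_words"
    using Cons.IH[OF stack_pop[OF Cons.prems(1) c]] Cons.prems(2) by auto
  then show ?case by (intro exI[of _ "[c] @ q"]) simp
qed

lemma periodic_in_dyck_shift:
  assumes "g \<in> dyck_generators"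
  shows "(\<lambda>k. g ! nat (k mod int (length g))) \<in> dyck_shift"
proof -
  let ?x = "\<lambda>k. g ! nat (k mod int (length g))" and ?l = "int (length g)"
  have pos: "0 < ?l"
    using assms by (auto elim!: generatorE dest!: length_dyck_words)
  have "factor ?x (i * ?l) ((i + 1) * ?l) = g" for i
  proof (rule nth_equalityI)
    show "length (factor ?x (i * ?l) ((i + 1) * ?l)) = length g"
      by (simp add: length_factor algebra_simps)
    fix n assume "n < length (factor ?x (i * ?l) ((i + 1) * ?l))"
    then have n: "n < length g" by (simp add: length_factor algebra_simps)
    then show "factor ?x (i * ?l) ((i + 1) * ?l) ! n = g ! n"
      by (subst factor_nth) (auto simp: algebra_simps)
  qed
  then have "?x \<in> biinfinite_concatenations dyck_generators"
    unfolding biinfinite_concatenations_def using pos assms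
    by (intro CollectI exI[of _ "\<lambda>i. i * ?l"]) (auto simp: algebra_simps)
  then show ?thesis unfolding dyck_shift_def using closure_subset by blast
qed

lemma language_code:
  assumes "length u = n" "set u \<subseteq> {..<3}"
  shows "u \<in> map (proj True) ` language dyck_shift n"
proof -
  obtain p w st where pw: "map (proj True) w = u" "stack st (p @ w)" "\<forall>a\<in>set st. opener a"
    using decode_word[OF assms(2)] by blast
  obtain q where "(p @ w) @ q \<in> gen_words" using close_stack[OF pw(2,3)] by blast
  \<comment> \<open>The outer pair turns the concatenation into a single generator, whose periodic
    repetition shows \<open>w\<close> behind the first bracket and \<open>p\<close>.\<close>
  then have g: "LPar # ((p @ w) @ q) @ [RPar] \<in> dyck_generators" (is "?g \<in> _")
    by (intro wrap_generator) (auto simp: matching_def)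
  let ?x = "\<lambda>k. ?g ! nat (k mod int (length ?g))"
  let ?a = "int (length p) + 1"
  have len: "length w = n" using pw(1) assms(1) by auto
  have "factor ?x ?a (?a + int n) = w"
  proof (rule nth_equalityI)
    fix i assume "i < length (factor ?x ?a (?a + int n))"
    then have i: "i < length w" by (simp add: length_factor len)
    have "(?a + int i) mod int (length ?g) = ?a + int i"
      using i by (intro mod_pos_pos_trivial) auto
    moreover have "nat (?a + int i) = Suc (length p + i)" by simp
    ultimately have "factor ?x ?a (?a + int n) ! i = ?g ! Suc (length p + i)"
      using i len by (subst factor_nth) (auto simp del: append_assoc)
    also have "\<dots> = w ! i" using i by (simp add: nth_append)
    finally show "factor ?x ?a (?a + int n) ! i = w ! i" .
  qed (simp add: length_factor len)
  then have "w \<in> language dyck_shift n"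
    using periodic_in_dyck_shift[OF g] unfolding language_def mem_Collect_eq by metis
  then show ?thesis using pw(1) by blast
qed

lemma finite_bracket: "finite (UNIV :: bracket set)"
proof -
  have "(UNIV :: bracket set) = {LPar, RPar, LBrk, RBrk}" using bracket.exhaust by blast
  then show ?thesis by (metis finite.intros)
qed

lemma finite_language: "finite (language X n)"
proof (rule finite_subset)
  show "language X n \<subseteq> {w. set w \<subseteq> UNIV \<and> length w = n}"
    by (auto simp: language_def length_factor)
qed (rule finite_lists_length_eq[OF finite_bracket])

lemma card_language_ge: "3 ^ n \<le> card (language dyck_shift n)"
proof -
  have "{u. set u \<subseteq> {..<3::nat} \<and> length u = n} \<subseteq> map (proj True) ` language dyck_shift n"
    using language_code by blast
  then have "card {u. set u \<subseteq> {..<3::nat} \<and> length u = n} \<le> card (map (proj True) ` language dyck_shift n)"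
    by (intro card_mono finite_imageI finite_language)
  also have "\<dots> \<le> card (language dyck_shift n)" by (rule card_image_le[OF finite_language])
  finally show ?thesis by (simp add: card_lists_length_eq)
qed

lemma card_language_add: "card (language X (m + n)) \<le> card (language X m) * card (language X n)"
proof -
  have "language X (m + n) \<subseteq> (\<lambda>(u, v). u @ v) ` (language X m \<times> language X n)"
  proof
    fix w assume "w \<in> language X (m + n)"
    then obtain x a where x: "x \<in> X" "w = factor x a (a + int (m + n))" by (auto simp: language_def)
    have "w = factor x a (a + int m) @ factor x (a + int m) (a + int m + int n)"
      unfolding x(2) by (rule nth_equalityI) (auto simp: length_factor nth_append factor_nth algebra_simps)
    then show "w \<in> (\<lambda>(u, v). u @ v) ` (language X m \<times> language X n)"
      using x(1) unfolding language_def by blast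
  qed
  then have "card (language X (m + n)) \<le> card ((\<lambda>(u, v). u @ v) ` (language X m \<times> language X n))"
    by (intro card_mono finite_imageI finite_cartesian_product finite_language)
  also have "\<dots> \<le> card (language X m \<times> language X n)"
    by (intro card_image_le finite_cartesian_product finite_language)
  finally show ?thesis by (simp add: card_cartesian_product)
qed

text \<open>Fekete's lemma. Both entropies are defined by \<open>lim\<close>, whose value is
  informative only for convergent sequences.\<close>

lemma subadditive_convergent:
  fixes a :: "nat \<Rightarrow> real"
  assumes sub: "\<And>m n. a (m + n) \<le> a m + a n" and nonneg: "\<And>n. 0 \<le> a n"
  shows "convergent (\<lambda>n. a n / real n)"
proof -
  define A where "A = (\<lambda>n. a n / real n) ` {1..}"
  define L where "L = Inf A"
  have bdd: "bdd_below A" unfolding A_def using nonneg by (intro bdd_belowI[of _ 0]) auto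
  have lower: "L \<le> a n / real n" if "n \<ge> 1" for n
    unfolding L_def by (rule cInf_lower[OF _ bdd]) (use that in \<open>auto simp: A_def\<close>)
  have mult: "a (q * m) \<le> a 0 + real q * a m" for q m
  proof (induction q)
    case (Suc q)
    then show ?case using sub[of m "q * m"] by (simp add: algebra_simps)
  qed simp
  have "(\<lambda>n. a n / real n) \<longlonglongrightarrow> L"
  proof (rule LIMSEQ_I)
    fix e :: real assume "0 < e"
    then obtain m where m: "m \<ge> 1" "a m / real m < L + e / 2"
      using cInf_lessD[of A "L + e / 2"] by (auto simp: A_def L_def)
    \<comment> \<open>What division of \<open>n\<close> by \<open>m\<close> leaves over: a remainder
      of at most \<open>m\<close> steps of cost \<open>a 1\<close> each, and two terms
      \<open>a 0\<close>.\<close>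
    define C where "C = 2 * a 0 + real m * a 1"
    have up: "a n / real n \<le> a m / real m + C / real n" if n: "n \<ge> 1" for n
    proof -
      have "a n \<le> a (n div m * m) + a (n mod m)" using sub[of "n div m * m" "n mod m"] by simp
      also have "a (n mod m) \<le> a 0 + real (n mod m) * a 1" using mult[of "n mod m" 1] by simp
      also have "real (n mod m) * a 1 \<le> real m * a 1"
        using m(1) nonneg[of 1] by (intro mult_right_mono) (auto intro: less_imp_le)
      also have "a (n div m * m) \<le> a 0 + real (n div m) * a m" by (rule mult)
      also have "real (n div m) * a m \<le> real n / real m * a m"
      proof (rule mult_right_mono)
        have "real (n div m * m) \<le> real n" by (simp only: of_nat_le_iff div_times_less_eq_dividend)
        then show "real (n div m) \<le> real n / real m" using m(1) by (simp add: pos_le_divide_eq)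
      qed (rule nonneg)
      finally have "a n \<le> real n * (a m / real m) + C" by (simp add: C_def)
      then have "a n / real n \<le> (real n * (a m / real m) + C) / real n"
        by (rule divide_right_mono) simp
      then show ?thesis using n by (simp add: add_divide_distrib)
    qed
    have "(\<lambda>n. C / real n) \<longlonglongrightarrow> 0" by (rule lim_const_over_n)
    then obtain N where N: "\<And>n. n \<ge> N \<Longrightarrow> norm (C / real n - 0) < e / 2"
      using LIMSEQ_D[of "\<lambda>n. C / real n" 0 "e / 2"] \<open>0 < e\<close> by auto
    show "\<exists>no. \<forall>n\<ge>no. norm (a n / real n - L) < e"
    proof (intro exI[of _ "max N 1"] allI impI)
      fix n assume n: "max N 1 \<le> n"
      then have "norm (C / real n - 0) < e / 2" by (intro N) simp
      then have "C / real n < e / 2" unfolding real_norm_def diff_0_right by linarith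
      moreover have "1 \<le> n" using n by simp
      ultimately have "a n / real n - L < e" "L \<le> a n / real n"
        using up[of n] lower[of n] m(2) by linarith+
      then show "norm (a n / real n - L) < e" by simp
    qed
  qed
  then show ?thesis by (rule convergentI)
qed

lemma top_entropy_ge: "ln 3 \<le> top_entropy dyck_shift"
proof -
  let ?a = "\<lambda>n. ln (real (card (language dyck_shift n)))"
  have ge: "3 ^ n \<le> real (card (language dyck_shift n))" for n
    using card_language_ge[of n] by (metis of_nat_le_iff of_nat_numeral of_nat_power)
  have pos: "1 \<le> real (card (language dyck_shift n))" for n
    using ge[of n] one_le_power[of "3::real" n] by linarith
  have "convergent (\<lambda>n. ?a n / real n)"
  proof (rule subadditive_convergent)
    fix m n
    have "real (card (language dyck_shift (m + n))) \<le> real (card (language dyck_shift m)) * real (card (language dyck_shift n))"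
      using card_language_add[of dyck_shift m n] by (metis of_nat_le_iff of_nat_mult)
    moreover have "0 < real (card (language dyck_shift k))" for k using pos[of k] by linarith
    ultimately show "?a (m + n) \<le> ?a m + ?a n"
      by (subst ln_mult_pos[symmetric]) (auto intro: ln_mono)
  qed (use pos in \<open>auto intro: ln_ge_zero\<close>)
  then have lim: "(\<lambda>n. ?a n / real n) \<longlonglongrightarrow> top_entropy dyck_shift"
    by (simp add: top_entropy_def convergent_LIMSEQ_iff)
  show ?thesis
  proof (rule LIMSEQ_le_const[OF lim], intro exI[of _ 1] allI impI)
    fix n :: nat assume n: "1 \<le> n"
    have "real n * ln 3 = ln (3 ^ n)" by (simp add: ln_realpow)
    also have "\<dots> \<le> ?a n" using ge[of n] by (intro ln_mono) (use pos[of n] in \<open>auto intro: less_le_trans[of 0 1]\<close>)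
    finally show "ln 3 \<le> ?a n / real n" using n by (simp add: pos_le_divide_eq mult.commute)
  qed
qed

section \<open>Entropy of finite-valued functions\<close>

text \<open>The entropy of the partition into level sets. With functions in place of partitions, a
  join is a pair and a coarser partition is a composition.\<close>

definition ent :: "'a measure \<Rightarrow> ('a \<Rightarrow> 'b) \<Rightarrow> real" where
  "ent M f = (\<Sum>v\<in>f ` space M. - (measure M (f -` {v} \<inter> space M) * ln (measure M (f -` {v} \<inter> space M))))"

lemma ent_cong: "(\<And>x. x \<in> space M \<Longrightarrow> f x = g x) \<Longrightarrow> ent M f = ent M g"
proof -
  assume *: "\<And>x. x \<in> space M \<Longrightarrow> f x = g x"
  then have "f ` space M = g ` space M" "\<And>v. f -` {v} \<inter> space M = g -` {v} \<inter> space M" by auto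
  then show ?thesis unfolding ent_def by simp
qed

lemma ent_superset:
  assumes "finite S" "f ` space M \<subseteq> S"
  shows "ent M f = (\<Sum>v\<in>S. - (measure M (f -` {v} \<inter> space M) * ln (measure M (f -` {v} \<inter> space M))))"
  unfolding ent_def
proof (rule sum.mono_neutral_left[OF assms], intro ballI)
  fix v assume "v \<in> S - f ` space M"
  then have "f -` {v} \<inter> space M = {}" by auto
  then show "- (measure M (f -` {v} \<inter> space M) * ln (measure M (f -` {v} \<inter> space M))) = 0" by simp
qed

text \<open>The base \<open>exp 1\<close> turns \<open>log\<close> into \<open>ln\<close>; the chain
  rule and the data processing inequality for simple functions become available.\<close>

lemma (in prob_space) ent_entropy:
  assumes "simple_function M f"
  shows "ent M f = entropy (exp 1) (count_space (f ` space M)) f"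
proof -
  interpret information_space M "exp 1" by standard (simp add: one_less_exp_iff)
  show ?thesis
    unfolding entropy_simple_distributed[OF simple_distributedI[OF assms measure_nonneg refl]]
    by (simp add: ent_def log_def sum_negf)
qed

lemma (in prob_space) ent_Pair_le:
  assumes "simple_function M f" "simple_function M g"
  shows "ent M (\<lambda>x. (f x, g x)) \<le> ent M f + ent M g"
proof -
  interpret information_space M "exp 1" by standard (simp add: one_less_exp_iff)
  show ?thesis
    using entropy_chain_rule[OF assms] conditional_entropy_less_eq_entropy[OF assms(2,1)]
    by (simp add: ent_entropy assms simple_function_Pair)
qed

text \<open>If \<open>f\<close> determines \<open>g\<close>, then \<open>g\<close> factors through
  \<open>f\<close> by a choice of preimages, and the data processing inequality applies.\<close>

lemma (in prob_space) ent_mono: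
  assumes "simple_function M f"
    "\<And>x y. x \<in> space M \<Longrightarrow> y \<in> space M \<Longrightarrow> f x = f y \<Longrightarrow> g x = g y"
  shows "ent M g \<le> ent M f"
proof -
  interpret information_space M "exp 1" by standard (simp add: one_less_exp_iff)
  define h where "h v = g (SOME x. x \<in> space M \<and> f x = v)" for v
  have h: "g x = (h \<circ> f) x" if "x \<in> space M" for x
  proof -
    have "(SOME y. y \<in> space M \<and> f y = f x) \<in> space M \<and> f (SOME y. y \<in> space M \<and> f y = f x) = f x"
      by (rule someI[of _ x]) (use that in simp)
    then show ?thesis using assms(2)[OF that] by (simp add: h_def)
  qed
  have hf: "simple_function M (h \<circ> f)" by (rule simple_function_compose[OF assms(1)])
  have "ent M g = ent M (h \<circ> f)" by (rule ent_cong) (rule h)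
  also have "\<dots> \<le> ent M f"
    unfolding ent_entropy[OF hf] ent_entropy[OF assms(1)] by (rule entropy_data_processing[OF assms(1)])
  finally show ?thesis .
qed

lemma neg_mult_ln_le: "0 \<le> (p::real) \<Longrightarrow> p \<le> 1 \<Longrightarrow> - (p * ln p) \<le> 1 - p"
proof (cases "p = 0")
  case False
  assume "0 \<le> p"
  then have p: "0 < p" using False by simp
  then have "ln (1 / p) \<le> 1 / p - 1" by (intro ln_le_minus_one) simp
  then have "p * (- ln p) \<le> p * (1 / p - 1)"
    using p by (intro mult_left_mono) (simp_all add: ln_div)
  then show ?thesis using p by (simp add: right_diff_distrib)
qed simp

text \<open>The linear bound at \<open>sqrt p\<close>, multiplied by \<open>2 * sqrt p\<close>: an
  explicit modulus of continuity of the entropy function at 0.\<close>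

lemma neg_mult_ln_le_sqrt: "0 \<le> (p::real) \<Longrightarrow> p \<le> 1 \<Longrightarrow> - (p * ln p) \<le> 2 * sqrt p"
proof -
  assume p: "0 \<le> p" "p \<le> 1"
  have "- (sqrt p * ln (sqrt p)) \<le> 1 - sqrt p" using p by (intro neg_mult_ln_le) auto
  then have "2 * sqrt p * (- (sqrt p * ln (sqrt p))) \<le> 2 * sqrt p * (1 - sqrt p)"
    using p by (intro mult_left_mono) auto
  moreover have "2 * sqrt p * (- (sqrt p * ln (sqrt p))) = - (p * ln p)"
  proof -
    have "2 * sqrt p * (- (sqrt p * ln (sqrt p))) = - ((sqrt p * sqrt p) * ln p)"
      using p by (cases "p = 0") (simp_all add: ln_sqrt)
    then show ?thesis using p by simp
  qed
  moreover have "2 * sqrt p * (1 - sqrt p) \<le> 2 * sqrt p * 1"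
    using p by (intro mult_left_mono) auto
  ultimately show ?thesis by linarith
qed

text \<open>Takes the part of Fano's inequality: there are at most \<open>card S\<close> exceptional
  values, each of probability at most \<open>\<delta>\<close>, and the default value
  \<open>c\<close> contributes no more than its missing mass.\<close>

lemma (in prob_space) ent_almost_constant:
  assumes "simple_function M f" "finite S" "f ` space M \<subseteq> insert c S" "prob {x \<in> space M. f x \<noteq> c} \<le> \<delta>"
  shows "ent M f \<le> \<delta> + real (card S) * (2 * sqrt \<delta>)"
proof -
  let ?p = "\<lambda>v. prob (f -` {v} \<inter> space M)"
  have sets: "f -` V \<inter> space M \<in> sets M" for V using simple_functionD(2)[OF assms(1)] .
  have "ent M f = (\<Sum>v\<in>insert c (S - {c}). - (?p v * ln (?p v)))"
    using assms(2,3) by (intro ent_superset) auto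
  also have "\<dots> = - (?p c * ln (?p c)) + (\<Sum>v\<in>S - {c}. - (?p v * ln (?p v)))"
    using assms(2) by (subst sum.insert) auto
  also have "- (?p c * ln (?p c)) \<le> 1 - ?p c" by (intro neg_mult_ln_le) auto
  also have "1 - ?p c = prob {x \<in> space M. f x \<noteq> c}"
  proof -
    have "{x \<in> space M. f x \<noteq> c} = space M - (f -` {c} \<inter> space M)" by auto
    then show ?thesis by (simp add: prob_compl[OF sets])
  qed
  also have "prob {x \<in> space M. f x \<noteq> c} \<le> \<delta>" by (rule assms(4))
  also have "(\<Sum>v\<in>S - {c}. - (?p v * ln (?p v))) \<le> (\<Sum>v\<in>S - {c}. 2 * sqrt \<delta>)"
  proof (rule sum_mono)
    fix v assume v: "v \<in> S - {c}"
    have "{x \<in> space M. f x \<noteq> c} = f -` (- {c}) \<inter> space M" by auto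
    then have "?p v \<le> prob {x \<in> space M. f x \<noteq> c}"
      using v sets[of "- {c}"] by (intro finite_measure_mono) auto
    then have "?p v \<le> \<delta>" using assms(4) by linarith
    have "- (?p v * ln (?p v)) \<le> 2 * sqrt (?p v)" by (intro neg_mult_ln_le_sqrt) auto
    also have "\<dots> \<le> 2 * sqrt \<delta>" using \<open>?p v \<le> \<delta>\<close> by simp
    finally show "- (?p v * ln (?p v)) \<le> 2 * sqrt \<delta>" .
  qed
  also have "(\<Sum>v\<in>S - {c}. 2 * sqrt \<delta>) = real (card (S - {c})) * (2 * sqrt \<delta>)" by simp
  also have "\<dots> \<le> real (card S) * (2 * sqrt \<delta>)"
  proof (rule mult_right_mono)
    show "real (card (S - {c})) \<le> real (card S)" using assms(2) by (simp add: card_mono)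
    have "0 \<le> \<delta>" using assms(4) measure_nonneg[of M] by (meson order_trans)
    then show "0 \<le> 2 * sqrt \<delta>" by simp
  qed
  finally show ?thesis by simp
qed

text \<open>Gibbs' inequality is strict away from the uniform distribution, because
  \<open>ln t = t - 1\<close> only for \<open>t = 1\<close>.\<close>

lemma (in prob_space) ent_maximal_uniform:
  assumes "simple_function M f" "finite S" "f ` space M \<subseteq> S" "ln (card S) \<le> ent M f" "v \<in> S"
  shows "prob (f -` {v} \<inter> space M) = 1 / card S"
proof -
  define K where "K = real (card S)"
  let ?p = "\<lambda>v. prob (f -` {v} \<inter> space M)"
  have K: "0 < K" unfolding K_def using assms(2,5) by (auto simp: card_gt_0_iff)
  have sum1: "(\<Sum>v\<in>S. ?p v) = 1"
  proof -
    have "(\<Sum>v\<in>S. ?p v) = prob (\<Union>v\<in>S. f -` {v} \<inter> space M)"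
      using assms(1,2) by (intro finite_measure_finite_Union[symmetric])
        (auto simp: simple_functionD disjoint_family_on_def)
    also have "(\<Union>v\<in>S. f -` {v} \<inter> space M) = space M" using assms(3) by auto
    finally show ?thesis by (simp add: prob_space)
  qed
  \<comment> \<open>The defect of Gibbs' inequality at \<open>v\<close>. The defects are nonnegative
    and add up to \<open>ln K - ent M f\<close>, which is at most 0 by hypothesis.\<close>
  define d where "d v = 1 / K - ?p v + ?p v * ln (?p v) + ?p v * ln K" for v
  have d_nonneg: "0 \<le> d v" for v
  proof (cases "?p v = 0")
    case False
    then have p: "0 < ?p v" using measure_nonneg[of M] by (simp add: less_le)
    have "ln (1 / (?p v * K)) \<le> 1 / (?p v * K) - 1" using p K by (intro ln_le_minus_one) simp
    then have "?p v * ln (1 / (?p v * K)) \<le> ?p v * (1 / (?p v * K) - 1)" using p by (intro mult_left_mono) auto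
    moreover have "ln (1 / (?p v * K)) = - ln (?p v) - ln K" using p K by (simp add: ln_div ln_mult)
    moreover have "?p v * (1 / (?p v * K) - 1) = 1 / K - ?p v" using p K by (simp add: right_diff_distrib)
    ultimately have "?p v * (- ln (?p v) - ln K) \<le> 1 / K - ?p v" by simp
    then show ?thesis by (simp add: d_def algebra_simps)
  qed (use K in \<open>simp add: d_def\<close>)
  have "(\<Sum>v\<in>S. d v) = 1 - 1 - ent M f + ln K"
    unfolding d_def ent_superset[OF assms(2,3)] sum.distrib sum_subtractf sum1 sum_negf
    using K by (simp add: K_def sum_distrib_right[symmetric] sum1)
  also have "\<dots> \<le> 0" using assms(4) by (simp add: K_def)
  finally have "(\<Sum>v\<in>S. d v) = 0" using sum_nonneg[of S d] d_nonneg by (simp add: order_antisym)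
  then have d0: "d v = 0" using sum_nonneg_eq_0_iff[of S d] d_nonneg assms(2,5) by auto
  have "?p v \<noteq> 0" using d0 K by (auto simp: d_def)
  then have p: "0 < ?p v" using measure_nonneg[of M] by (simp add: less_le)
  have "ln (1 / (?p v * K)) = - ln (?p v) - ln K" using p K by (simp add: ln_div ln_mult)
  moreover have "- ln (?p v) - ln K = 1 / (?p v * K) - 1"
    using d0 p K unfolding d_def by (simp add: field_simps)
  ultimately have "1 / (?p v * K) = 1"
    using p K by (intro ln_eq_minus_one) auto
  then show ?thesis using p K by (simp add: K_def field_simps)
qed

section \<open>Entropy of the shift\<close>

locale shift_system = prob_space M for M :: "biseq measure" +
  assumes measurable_shift [measurable]: "shift \<in> measurable M M"
    and shift_invariant: "A \<in> sets M \<Longrightarrow> emeasure M (shift -` A \<inter> space M) = emeasure M A"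
begin

lemma measurable_shift_pow [measurable]: "(shift ^^ n) \<in> measurable M M"
  by (induction n) (auto simp: o_def intro: measurable_compose)

lemma shift_pow_space: "x \<in> space M \<Longrightarrow> (shift ^^ n) x \<in> space M"
  by (rule measurable_space[OF measurable_shift_pow])

lemma shift_pow_invariant:
  "A \<in> sets M \<Longrightarrow> prob ((shift ^^ n) -` A \<inter> space M) = prob A"
proof (induction n arbitrary: A)
  case 0
  then show ?case using sets.sets_into_space by (simp add: Int_absorb2)
next
  case (Suc n)
  have eq: "(shift ^^ Suc n) -` A \<inter> space M = (shift ^^ n) -` (shift -` A \<inter> space M) \<inter> space M"
    using shift_pow_space[of _ n] by auto
  have "shift -` A \<inter> space M \<in> sets M" using Suc.prems by measurable
  then have "prob ((shift ^^ Suc n) -` A \<inter> space M) = prob (shift -` A \<inter> space M)"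
    unfolding eq by (rule Suc.IH)
  also have "\<dots> = prob A" using shift_invariant[OF Suc.prems] by (simp add: measure_def)
  finally show ?case .
qed

lemma simple_shift_pow: "simple_function M f \<Longrightarrow> simple_function M (\<lambda>x. f ((shift ^^ n) x))"
  by (rule simple_function_comp[OF measurable_shift_pow])

lemma ent_shift_pow:
  assumes "simple_function M f"
  shows "ent M (\<lambda>x. f ((shift ^^ n) x)) = ent M f"
proof -
  have fin: "finite (f ` space M)" using assms by (rule simple_functionD)
  have "(\<lambda>x. f ((shift ^^ n) x)) -` {v} \<inter> space M = (shift ^^ n) -` (f -` {v} \<inter> space M) \<inter> space M" for v
    using shift_pow_space[of _ n] by auto
  then have "prob ((\<lambda>x. f ((shift ^^ n) x)) -` {v} \<inter> space M) = prob (f -` {v} \<inter> space M)" for v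
    using shift_pow_invariant[of "f -` {v} \<inter> space M" n] simple_functionD(2)[OF assms] by simp
  then show ?thesis
    unfolding ent_def[of M f]
    by (subst ent_superset[OF fin]) (use shift_pow_space[of _ n] in auto)
qed

section \<open>Subadditivity of the entropy of itineraries\<close>

definition itinerary :: "(biseq \<Rightarrow> 'b) \<Rightarrow> nat \<Rightarrow> biseq \<Rightarrow> 'b list" where
  "itinerary f n x = map (\<lambda>i. f ((shift ^^ i) x)) [0..<n]"

lemma itinerary_add: "itinerary f (m + n) x = itinerary f m x @ itinerary f n ((shift ^^ m) x)"
  by (rule nth_equalityI) (auto simp: itinerary_def nth_append funpow_add[symmetric, unfolded o_def, THEN fun_cong] simp flip: funpow_add[unfolded o_def fun_eq_iff, rule_format])

lemma simple_itinerary: "simple_function M f \<Longrightarrow> simple_function M (itinerary f n)"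
proof (induction n)
  case 0
  have "itinerary f 0 = (\<lambda>_. [])" by (auto simp: itinerary_def)
  then show ?case by simp
next
  case (Suc n)
  have eq: "itinerary f (Suc n) = (\<lambda>(u, v). u @ [v]) \<circ> (\<lambda>x. (itinerary f n x, f ((shift ^^ n) x)))"
    by (auto simp: itinerary_def)
  show ?case
    unfolding eq using Suc by (intro simple_function_compose simple_function_Pair simple_shift_pow)
qed

lemma ent_itinerary_add:
  assumes "simple_function M f"
  shows "ent M (itinerary f (m + n)) \<le> ent M (itinerary f m) + ent M (itinerary f n)"
proof -
  note s = simple_itinerary[OF assms]
  have "ent M (itinerary f (m + n)) \<le> ent M (\<lambda>x. (itinerary f m x, itinerary f n ((shift ^^ m) x)))"
    by (rule ent_mono[OF simple_function_Pair[OF s simple_shift_pow[OF s]]]) (simp add: itinerary_add)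
  also have "\<dots> \<le> ent M (itinerary f m) + ent M (\<lambda>x. itinerary f n ((shift ^^ m) x))"
    by (rule ent_Pair_le[OF s simple_shift_pow[OF s]])
  finally show ?thesis by (simp add: ent_shift_pow[OF s])
qed

lemma ent_itinerary_0: "ent M (itinerary f 0) = 0"
proof -
  have "ent M (itinerary f 0) = (\<Sum>v\<in>{[]}. - (prob (itinerary f 0 -` {v} \<inter> space M) * ln (prob (itinerary f 0 -` {v} \<inter> space M))))"
    by (rule ent_superset) (auto simp: itinerary_def)
  moreover have "itinerary f 0 -` {[]} \<inter> space M = space M" by (auto simp: itinerary_def)
  ultimately show ?thesis by (simp add: prob_space)
qed

lemma ent_itinerary_mult:
  assumes "simple_function M f"
  shows "ent M (itinerary f (q * k)) \<le> real q * ent M (itinerary f k)"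
proof (induction q)
  case (Suc q)
  then show ?case using ent_itinerary_add[OF assms, of k "q * k"] by (simp add: algebra_simps)
qed (simp add: ent_itinerary_0)

lemma ent_itinerary_1:
  assumes "simple_function M f"
  shows "ent M (itinerary f 1) \<le> ent M f"
  by (rule ent_mono[OF assms]) (simp add: itinerary_def)

lemma ent_nonneg: "simple_function M f \<Longrightarrow> 0 \<le> ent M f"
  unfolding ent_def
proof (rule sum_nonneg)
  fix v
  let ?p = "prob (f -` {v} \<inter> space M)"
  have "?p * ln ?p \<le> 0"
  proof (cases "?p = 0")
    case False
    then have "0 < ?p" by (simp add: zero_less_measure_iff)
    then show ?thesis by (intro mult_nonneg_nonpos) (auto simp: ln_le_zero_iff)
  qed simp
  then show "0 \<le> - (?p * ln ?p)" by simp
qed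

section \<open>Finite partitions as functions\<close>

definition cell :: "biseq set set \<Rightarrow> biseq \<Rightarrow> biseq set" where
  "cell P x = (THE A. A \<in> P \<and> x \<in> A)"

lemma cell_eq:
  assumes "finite_partition M P" "A \<in> P" "x \<in> A"
  shows "cell P x = A"
proof -
  have "disjoint P" using assms(1) by (auto simp: finite_partition_def partition_on_def)
  then show ?thesis unfolding cell_def using assms(2,3) by (intro the_equality) (auto simp: disjoint_def)
qed

lemma cell_in:
  assumes "finite_partition M P" "x \<in> space M"
  shows "cell P x \<in> P" "x \<in> cell P x"
proof -
  obtain A where "A \<in> P" "x \<in> A"
    using assms by (auto simp: finite_partition_def partition_on_def)
  then show "cell P x \<in> P" "x \<in> cell P x" using cell_eq[OF assms(1)] by auto
qed

lemma simple_cell: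
  assumes "finite_partition M P"
  shows "simple_function M (cell P)"
  unfolding simple_function_def
proof (intro conjI ballI)
  have sub: "cell P ` space M \<subseteq> P" using cell_in(1)[OF assms] by auto
  then show "finite (cell P ` space M)" using assms finite_subset by (auto simp: finite_partition_def)
  fix A assume "A \<in> cell P ` space M"
  then have A: "A \<in> P" using sub by auto
  then have "A \<in> sets M" using assms by (auto simp: finite_partition_def)
  moreover have "cell P -` {A} \<inter> space M = A"
    using cell_eq[OF assms A] cell_in[OF assms] sets.sets_into_space[OF \<open>A \<in> sets M\<close>] by auto
  ultimately show "cell P -` {A} \<inter> space M \<in> sets M" by simp
qed

text \<open>The nonempty members of the join are the level sets of the itinerary, each occurring
  once; a further empty member has the summand 0.\<close>

lemma partition_entropy_join:
  assumes "finite_partition M P"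
  shows "partition_entropy M (iterated_join M P n) = ent M (itinerary (cell P) n)"
proof -
  let ?f = "itinerary (cell P) n"
  let ?g = "\<lambda>v. ?f -` {v} \<inter> space M"
  have len: "length (?f x) = n" for x by (simp add: itinerary_def)
  have nth: "?f x ! i = cell P ((shift ^^ i) x)" if "i < n" for x i using that by (simp add: itinerary_def)
  have g: "?g (?f x) = space M \<inter> (\<Inter>i<n. (shift ^^ i) -` (?f x ! i))" if "x \<in> space M" for x
  proof (intro equalityI subsetI)
    fix y assume y: "y \<in> ?g (?f x)"
    then have "?f y = ?f x" "y \<in> space M" by auto
    then show "y \<in> space M \<inter> (\<Inter>i<n. (shift ^^ i) -` (?f x ! i))"
      using nth cell_in(2)[OF assms shift_pow_space] by (auto) (metis)
  next
    fix y assume y: "y \<in> space M \<inter> (\<Inter>i<n. (shift ^^ i) -` (?f x ! i))"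
    have "?f y ! i = ?f x ! i" if i: "i < n" for i
    proof -
      have "?f x ! i \<in> P" using \<open>x \<in> space M\<close> by (simp add: nth[OF i] cell_in(1)[OF assms] shift_pow_space)
      then show ?thesis using y i nth cell_eq[OF assms] by auto
    qed
    then have "?f y = ?f x" by (intro nth_equalityI) (auto simp: len)
    then show "y \<in> ?g (?f x)" using y by auto
  qed
  have sub: "?g ` ?f ` space M \<subseteq> iterated_join M P n"
  proof
    fix B assume "B \<in> ?g ` ?f ` space M"
    then obtain x where x: "x \<in> space M" "B = ?g (?f x)" by auto
    then show "B \<in> iterated_join M P n"
      unfolding iterated_join_def x(2) g[OF x(1)]
      by (intro CollectI exI[of _ "\<lambda>i. ?f x ! i"]) (auto simp: nth cell_in(1)[OF assms] shift_pow_space)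
  qed
  have rest: "B = {}" if B: "B \<in> iterated_join M P n - ?g ` ?f ` space M" for B
  proof (rule ccontr)
    assume "B \<noteq> {}"
    obtain A where A: "B = space M \<inter> (\<Inter>i<n. (shift ^^ i) -` A i)" "\<forall>i<n. A i \<in> P"
      using B by (auto simp: iterated_join_def)
    obtain x where x: "x \<in> B" using \<open>B \<noteq> {}\<close> by blast
    then have xs: "x \<in> space M" using A(1) by auto
    have "A i = ?f x ! i" if "i < n" for i
      using x A that nth cell_eq[OF assms, of "A i" "(shift ^^ i) x"] by auto
    then have "B = ?g (?f x)" unfolding g[OF xs] A(1) by auto
    then show False using B xs by auto
  qed
  have fin: "finite (iterated_join M P n)"
  proof (rule finite_subset)
    show "iterated_join M P n \<subseteq> insert {} (?g ` ?f ` space M)" using rest by blast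
    show "finite (insert {} (?g ` ?f ` space M))"
      using simple_functionD(1)[OF simple_itinerary[OF simple_cell[OF assms]]] by simp
  qed
  have inj: "inj_on ?g (?f ` space M)" by (auto simp: inj_on_def)
  have "partition_entropy M (iterated_join M P n) = (\<Sum>A\<in>?g ` ?f ` space M. - measure M A * ln (measure M A))"
    unfolding partition_entropy_def
    by (rule sum.mono_neutral_right[OF fin sub]) (use rest in fastforce)
  also have "\<dots> = ent M ?f" unfolding ent_def by (subst sum.reindex[OF inj]) simp
  finally show ?thesis .
qed

lemma entropy_wrt_limit:
  assumes "finite_partition M P"
  shows "(\<lambda>n. ent M (itinerary (cell P) n) / real n) \<longlonglongrightarrow> entropy_wrt M P"
proof -
  have "convergent (\<lambda>n. ent M (itinerary (cell P) n) / real n)"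
    by (rule subadditive_convergent)
       (intro ent_itinerary_add ent_nonneg simple_itinerary simple_cell[OF assms])+
  then show ?thesis
    unfolding entropy_wrt_def partition_entropy_join[OF assms] by (simp add: convergent_LIMSEQ_iff)
qed

end

section \<open>Invariant measures on the Dyck shift\<close>

text \<open>With a countable base of the alphabet, the Borel sets of the product topology are
  generated by the coordinates.\<close>

instance bracket :: second_countable_topology
proof
  have "countable (UNIV :: bracket set set)"
    using finite_bracket by (intro countable_finite) (simp add: Finite_Set.finite_set)
  moreover have "open = generate_topology (UNIV :: bracket set set)"
    by (auto simp: fun_eq_iff open_bracket_def intro: generate_topology.Basis)
  ultimately show "\<exists>B :: bracket set set. countable B \<and> open = generate_topology B" by blast
qed

lemma shift_pow: "(shift ^^ n) x = (\<lambda>k. x (k + int n))"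
  by (induction n) (auto simp: shift_def fun_eq_iff algebra_simps)

lemma continuous_shift: "continuous_on UNIV shift"
  unfolding shift_def by (intro continuous_on_coordinatewise_then_product continuous_on_product_coordinates)

lemma shift_dyck_shift: "x \<in> dyck_shift \<Longrightarrow> shift x \<in> dyck_shift"
proof -
  assume "x \<in> dyck_shift"
  moreover have "shift ` closure (biinfinite_concatenations dyck_generators) \<subseteq> dyck_shift"
    unfolding dyck_shift_def
  proof (rule image_closure_subset[OF continuous_on_subset[OF continuous_shift]])
    show "shift ` biinfinite_concatenations dyck_generators \<subseteq> closure (biinfinite_concatenations dyck_generators)"
      using shift_concatenation[of _ dyck_generators 1] closure_subset by (fastforce simp: shift_def)
  qed auto
  ultimately show ?thesis unfolding dyck_shift_def by blast
qed

lemma borel_biseq_generated: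
  "sets (borel :: biseq measure) = sigma_sets UNIV {{f. f i \<in> C} | i C. True}"
proof -
  have "sets (borel :: bracket measure) = UNIV"
    by (auto simp: open_bracket_def intro!: borel_open)
  then show ?thesis
    unfolding sets_PiM_equal_borel[symmetric] sets_PiM_single by (simp add: PiE_UNIV_domain)
qed

locale dyck_system =
  fixes M :: "biseq measure"
  assumes invariant: "invariant_prob_on dyck_shift M"
begin

lemma sets_M: "sets M = sets (restrict_space borel dyck_shift)"
  using invariant by (simp add: invariant_prob_on_def borel_prob_on_def subshift_algebra_def)

lemma space_M: "space M = dyck_shift"
  using sets_eq_imp_space_eq[OF sets_M] by (simp add: space_restrict_space)

sublocale shift_system M
proof -
  interpret prob_space M using invariant by (simp add: invariant_prob_on_def borel_prob_on_def)
  have "shift \<in> measurable (restrict_space borel dyck_shift) (restrict_space borel dyck_shift)"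
    by (rule measurable_restrict_space3)
       (use continuous_shift shift_dyck_shift in \<open>auto intro: borel_measurable_continuous_onI\<close>)
  then have "shift \<in> measurable M M" using measurable_cong_sets[OF sets_M sets_M] by simp
  then show "shift_system M"
    by unfold_locales (use invariant in \<open>auto simp: invariant_prob_on_def\<close>)
qed

lemma good: "x \<in> space M \<Longrightarrow> good x"
  by (simp add: space_M good_dyck_shift)

text \<open>Such a set is cut out of the shift space by a union of cylinders over \<open>J\<close>.
  The union is indexed by all points of \<open>B\<close>, but cylinders are open, so it is
  measurable.\<close>

lemma local_sets:
  assumes "finite J" "B \<subseteq> space M"
    "\<And>x y. x \<in> space M \<Longrightarrow> y \<in> space M \<Longrightarrow> (\<And>l. l \<in> J \<Longrightarrow> x l = y l) \<Longrightarrow> x \<in> B \<Longrightarrow> y \<in> B"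
  shows "B \<in> sets M"
proof -
  let ?U = "\<Union>x\<in>B. {y. \<forall>l\<in>J. y l = x l}"
  have "open ?U" using open_cylinder[OF assms(1)] by blast
  then have "?U \<in> sets borel" by (rule borel_open)
  moreover have "B = ?U \<inter> dyck_shift"
  proof (rule set_eqI, rule iffI)
    fix y assume "y \<in> B"
    then show "y \<in> ?U \<inter> dyck_shift" using assms(2) by (auto simp: space_M)
  next
    fix y assume y: "y \<in> ?U \<inter> dyck_shift"
    then obtain x where "x \<in> B" "\<And>l. l \<in> J \<Longrightarrow> x l = y l" by auto
    then show "y \<in> B" using assms(2) assms(3)[of x y] y by (auto simp: space_M)
  qed
  ultimately show ?thesis unfolding sets_M sets_restrict_space by blast
qed

lemma simple_local:
  assumes "finite J" "finite (f ` space M)"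
    "\<And>x y. x \<in> space M \<Longrightarrow> y \<in> space M \<Longrightarrow> (\<And>l. l \<in> J \<Longrightarrow> x l = y l) \<Longrightarrow> f x = f y"
  shows "simple_function M f"
  unfolding simple_function_def
proof (intro conjI ballI assms(2))
  fix v
  show "f -` {v} \<inter> space M \<in> sets M"
  proof (rule local_sets[OF assms(1)])
    fix x y assume "x \<in> space M" "y \<in> space M" "\<And>l. l \<in> J \<Longrightarrow> x l = y l" "x \<in> f -` {v} \<inter> space M"
    then show "y \<in> f -` {v} \<inter> space M" using assms(3)[of x y] by simp
  qed simp
qed

lemma excess_local:
  "(\<And>l. l \<in> window d k t \<Longrightarrow> proj d (x l) = proj d (y l)) \<Longrightarrow> excess d x k t = excess d y k t"
  unfolding excess_def by (intro sum.cong) auto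

lemma sets_unmatched [measurable]: "{x \<in> space M. unmatched d x k} \<in> sets M"
proof -
  have "{x \<in> space M. proj d (x k) = 2 \<and> excess d x k t \<le> 0} \<in> sets M" for t
  proof (rule local_sets[of "insert k (window d k t)"])
    fix x y assume "\<And>l. l \<in> insert k (window d k t) \<Longrightarrow> x l = y l" "y \<in> space M"
      "x \<in> {x \<in> space M. proj d (x k) = 2 \<and> excess d x k t \<le> 0}"
    then show "y \<in> {x \<in> space M. proj d (x k) = 2 \<and> excess d x k t \<le> 0}"
      using excess_local[of d k t x y] by auto
  qed (auto simp: window_def)
  then have "(\<Inter>t. {x \<in> space M. proj d (x k) = 2 \<and> excess d x k t \<le> 0}) \<in> sets M" by blast
  moreover have "(\<Inter>t. {x \<in> space M. proj d (x k) = 2 \<and> excess d x k t \<le> 0}) = {x \<in> space M. unmatched d x k}"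
    by (auto simp: unmatched_def)
  ultimately show ?thesis by simp
qed

lemma shift_unmatched: "unmatched d ((shift ^^ n) x) k \<longleftrightarrow> unmatched d x (k + int n)"
  by (simp add: shift_pow unmatched_shift)

text \<open>The positions of the first unmatched opening bracket would be uniformly distributed
  over the integers.\<close>

lemma unmatched_both_null:
  "prob {x \<in> space M. (\<exists>k. unmatched True x k) \<and> (\<exists>k. unmatched False x k)} = 0"
proof -
  define F where "F k = {x \<in> space M. unmatched False x k \<and> (\<forall>l<k. \<not> unmatched False x l)}" for k
  have meas [measurable]: "F k \<in> sets M" for k unfolding F_def by measurable
  have vim: "(shift ^^ n) -` F k \<inter> space M = F (k + int n)" for n k
  proof -
    have "(\<forall>l<k. \<not> unmatched False x (l + int n)) \<longleftrightarrow> (\<forall>l<k + int n. \<not> unmatched False x l)" for x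
      by (metis add.commute add_less_cancel_left diff_add_cancel)
    then show ?thesis using shift_pow_space[of _ n] by (auto simp: F_def shift_unmatched)
  qed
  have eq: "prob (F (k + int n)) = prob (F k)" for k n
    using shift_pow_invariant[OF meas, of n k] by (simp add: vim)
  have disj: "disjoint_family_on F A" for A
    unfolding disjoint_family_on_def F_def by (auto, metis linorder_neqE)
  have "real n * prob (F 0) \<le> 1" for n
  proof -
    have "real n * prob (F 0) = (\<Sum>k<n. prob (F (int k)))" using eq[of 0] by simp
    also have "\<dots> = prob (\<Union>k<n. F (int k))"
      using disj[of UNIV] by (intro finite_measure_finite_Union[symmetric])
        (auto simp: disjoint_family_on_def)
    finally show ?thesis by simp
  qed
  then have F0: "prob (F 0) = 0"
    using reals_Archimedean3[of "prob (F 0)"] measure_nonneg[of M "F 0"] by (metis less_le not_less)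
  have F: "prob (F k) = 0" for k
  proof (cases "k \<ge> 0")
    case True
    then show ?thesis using eq[of 0 "nat k"] F0 by simp
  next
    case False
    then show ?thesis using eq[of k "nat (- k)"] F0 by simp
  qed
  have "{x \<in> space M. (\<exists>k. unmatched True x k) \<and> (\<exists>k. unmatched False x k)} \<subseteq> (\<Union>k. F k)"
  proof
    fix x assume "x \<in> {x \<in> space M. (\<exists>k. unmatched True x k) \<and> (\<exists>k. unmatched False x k)}"
    then obtain i k where x: "x \<in> space M" "unmatched True x k" "unmatched False x i" by auto
    \<comment> \<open>The unmatched closing bracket at \<open>k\<close> lies to the left of all
      unmatched opening ones, so there is a first among them.\<close>
    define n where "n = (LEAST n. unmatched False x (k + int n))"
    have "unmatched False x (k + int (nat (i - k)))" using unmatched_order[OF x(3,2)] x(3) by simp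
    then have n: "unmatched False x (k + int n)" unfolding n_def by (rule LeastI)
    have "\<not> unmatched False x l" if "l < k + int n" for l
    proof
      assume l: "unmatched False x l"
      then have "k < l" by (rule unmatched_order[OF _ x(2)])
      then have "unmatched False x (k + int (nat (l - k)))" using l by simp
      then have "n \<le> nat (l - k)" unfolding n_def by (rule Least_le)
      then show False using that \<open>k < l\<close> by simp
    qed
    then show "x \<in> (\<Union>k. F k)" using x(1) n by (auto simp: F_def)
  qed
  then have "prob {x \<in> space M. (\<exists>k. unmatched True x k) \<and> (\<exists>k. unmatched False x k)} \<le> prob (\<Union>k. F k)"
    by (intro finite_measure_mono) auto
  also have "prob (\<Union>k. F k) = 0"
  proof -
    have "F k \<in> null_sets M" for k using F[of k] by (intro null_setsI) (auto simp: emeasure_eq_measure)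
    then have "(\<Union>k. F k) \<in> null_sets M" by (intro null_sets_UN)
    then show ?thesis by (simp add: null_sets_def measure_def)
  qed
  finally show ?thesis using measure_nonneg[of M] by (simp add: order_antisym)
qed

text \<open>That some bracket of the kind forgotten by \<open>proj d\<close> is unmatched is a
  shift-invariant event, so its probability is 0 or 1. It cannot be 1 for both values of
  \<open>d\<close>, because both events together have probability 0.\<close>

lemma ergodic_matched:
  assumes "ergodic M"
  obtains d where "\<And>k. prob {x \<in> space M. unmatched d x k} = 0"
proof -
  define U where "U d = {x \<in> space M. \<exists>k. unmatched d x k}" for d
  have [measurable]: "U d \<in> sets M" for d unfolding U_def by measurable
  have inv: "shift -` U d \<inter> space M = U d" for d
  proof -
    have "(\<exists>k. unmatched d (shift x) k) \<longleftrightarrow> (\<exists>k. unmatched d x k)" for x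
    proof -
      have "unmatched d (shift x) k \<longleftrightarrow> unmatched d x (k + 1)" for k
        using shift_unmatched[of d 1 x k] by simp
      then show ?thesis by (metis diff_add_cancel)
    qed
    moreover have "x \<in> space M \<Longrightarrow> shift x \<in> space M" for x using measurable_space[OF measurable_shift] .
    ultimately show ?thesis by (auto simp: U_def)
  qed
  have 01: "prob (U d) = 0 \<or> prob (U d) = 1" for d
    using assms[unfolded ergodic_def, rule_format, OF _ inv] by simp
  have "\<not> (prob (U True) = 1 \<and> prob (U False) = 1)"
  proof
    assume *: "prob (U True) = 1 \<and> prob (U False) = 1"
    then have "AE x in M. x \<in> U True" "AE x in M. x \<in> U False" by (auto simp: prob_eq_1)
    then have "AE x in M. x \<in> U True \<inter> U False" by eventually_elim auto
    then have "prob (U True \<inter> U False) = 1" by (subst prob_eq_1) auto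
    moreover have "U True \<inter> U False = {x \<in> space M. (\<exists>k. unmatched True x k) \<and> (\<exists>k. unmatched False x k)}"
      by (auto simp: U_def)
    ultimately show False using unmatched_both_null by simp
  qed
  then obtain d where d: "prob (U d) = 0" using 01 by blast
  have "prob {x \<in> space M. unmatched d x k} = 0" for k
  proof -
    have "prob {x \<in> space M. unmatched d x k} \<le> prob (U d)"
      by (intro finite_measure_mono) (auto simp: U_def)
    then show ?thesis using d measure_nonneg[of M] by (simp add: order_antisym)
  qed
  then show thesis by (rule that)
qed

end

section \<open>Events decided by finite windows of the coding\<close>

locale matched_system = dyck_system +
  fixes d :: bool
  assumes matched: "prob {x \<in> space M. unmatched d x k} = 0"
begin

definition agree :: "nat \<Rightarrow> biseq \<Rightarrow> biseq \<Rightarrow> bool" where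
  "agree m x y \<longleftrightarrow> (\<forall>l\<in>{-int m..int m}. proj d (x l) = proj d (y l))"

definition windowed :: "nat \<Rightarrow> biseq set \<Rightarrow> bool" where
  "windowed m B \<longleftrightarrow> B \<subseteq> space M \<and> (\<forall>x\<in>space M. \<forall>y\<in>space M. agree m x y \<longrightarrow> x \<in> B \<longrightarrow> y \<in> B)"

lemma agree_sym: "agree m x y \<Longrightarrow> agree m y x"
  by (simp add: agree_def)

lemma agree_mono: "agree n x y \<Longrightarrow> m \<le> n \<Longrightarrow> agree m x y"
  by (auto simp: agree_def)

lemma windowed_mono: "windowed m B \<Longrightarrow> m \<le> n \<Longrightarrow> windowed n B"
  unfolding windowed_def using agree_mono by blast

lemma windowed_sets: "windowed m B \<Longrightarrow> B \<in> sets M"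
proof (rule local_sets[of "{-int m..int m}"])
  assume B: "windowed m B"
  then show "B \<subseteq> space M" by (simp add: windowed_def)
  fix x y assume *: "x \<in> space M" "y \<in> space M" "\<And>l. l \<in> {-int m..int m} \<Longrightarrow> x l = y l" "x \<in> B"
  have "agree m x y" using *(3) by (simp add: agree_def)
  then show "y \<in> B" using B *(1,2,4) by (auto simp: windowed_def)
qed simp

text \<open>Once all measurable sets have this property, the coding generates the sigma-algebra up
  to null sets. Finite windows take the place of an almost sure inverse of the coding, which would
  depend on unboundedly many letters.\<close>

definition approximable :: "biseq set \<Rightarrow> bool" where
  "approximable A \<longleftrightarrow> A \<in> sets M \<and> (\<forall>\<delta>>0. \<exists>m B. windowed m B \<and> prob ((A - B) \<union> (B - A)) < \<delta>)"

text \<open>The event that the \<open>t\<close> nearest letters on the relevant side do not reveal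
  the partner of position \<open>i\<close>. It is itself decided by a window, and it decreases to
  the null event that \<open>i\<close> is unmatched.\<close>

definition undecided :: "int \<Rightarrow> nat \<Rightarrow> biseq set" where
  "undecided i t = {x \<in> space M. proj d (x i) = 2 \<and> (\<forall>s\<le>t. excess d x i s \<le> 0)}"

lemma agree_window:
  assumes "agree (nat \<bar>i\<bar> + t + 1) x y" "s \<le> t" "l \<in> insert i (window d i s)"
  shows "proj d (x l) = proj d (y l)"
proof -
  have "i - int t \<le> l \<and> l \<le> i + int t" using assms(2,3) by (cases d) (auto simp: window_def)
  then have "l \<in> {-int (nat \<bar>i\<bar> + t + 1)..int (nat \<bar>i\<bar> + t + 1)}" by auto
  then show ?thesis using assms(1) unfolding agree_def by blast
qed

lemma undecided_local:
  assumes "x \<in> undecided i t" "y \<in> space M" "agree (nat \<bar>i\<bar> + t + 1) x y"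
  shows "y \<in> undecided i t"
proof -
  have "excess d x i s = excess d y i s" if "s \<le> t" for s
    by (rule excess_local) (rule agree_window[OF assms(3) that], simp)
  moreover have "proj d (x i) = proj d (y i)" by (rule agree_window[OF assms(3), of t]) auto
  ultimately show ?thesis using assms(1,2) by (auto simp: undecided_def)
qed

lemma windowed_undecided: "windowed (nat \<bar>i\<bar> + t + 1) (undecided i t)"
  unfolding windowed_def
proof (intro conjI ballI impI)
  show "undecided i t \<subseteq> space M" by (auto simp: undecided_def)
qed (rule undecided_local)

lemma decided:
  assumes "x \<in> space M" "y \<in> space M" "x \<notin> undecided i t" "agree (nat \<bar>i\<bar> + t + 1) x y"
  shows "x i = y i"
proof -
  have "\<exists>s\<le>t. proj d (x i) = 2 \<longrightarrow> excess d x i s \<ge> 1"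
    using assms(1,3) by (force simp: undecided_def)
  then obtain s where s: "s \<le> t" "proj d (x i) = 2 \<longrightarrow> excess d x i s \<ge> 1" by blast
  show ?thesis
    by (rule determined[OF good[OF assms(1)] good[OF assms(2)], of i d s])
       (use s agree_window[OF assms(4) s(1)] in auto)
qed

lemma undecided_tendsto: "(\<lambda>t. prob (undecided i t)) \<longlonglongrightarrow> 0"
proof -
  have "(\<lambda>t. prob (undecided i t)) \<longlonglongrightarrow> prob (\<Inter>t. undecided i t)"
  proof (rule finite_Lim_measure_decseq)
    show "range (undecided i) \<subseteq> sets M" using windowed_sets[OF windowed_undecided] by blast
  qed (auto simp: undecided_def decseq_def)
  moreover have "(\<Inter>t. undecided i t) = {x \<in> space M. unmatched d x i}"
    by (auto simp: undecided_def unmatched_def)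
  ultimately show ?thesis by (simp add: matched)
qed

text \<open>Off \<open>undecided i t\<close> the bracket at \<open>i\<close> is a function of
  finitely many letters, and all errors lie in that event.\<close>

lemma approximable_coordinate: "approximable {x \<in> space M. x i \<in> C}"
  unfolding approximable_def
proof (intro conjI allI impI)
  show "{x \<in> space M. x i \<in> C} \<in> sets M" by (rule local_sets[of "{i}"]) auto
  fix \<delta> :: real assume "\<delta> > 0"
  then obtain t where t: "prob (undecided i t) < \<delta>"
    using LIMSEQ_D[OF undecided_tendsto[of i], of \<delta>] by auto
  let ?m = "nat \<bar>i\<bar> + t + 1"
  let ?B = "{x \<in> space M. x \<notin> undecided i t \<and> x i \<in> C}"
  have "windowed ?m ?B"
    unfolding windowed_def
  proof (intro conjI ballI impI)
    fix x y assume *: "x \<in> space M" "y \<in> space M" "agree ?m x y" "x \<in> ?B"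
    then have "y \<notin> undecided i t" using undecided_local[OF _ *(1) agree_sym[OF *(3)]] by blast
    moreover have "x i = y i" using * by (intro decided) auto
    ultimately show "y \<in> ?B" using *(2,4) by simp
  qed blast
  moreover have "prob (({x \<in> space M. x i \<in> C} - ?B) \<union> (?B - {x \<in> space M. x i \<in> C})) \<le> prob (undecided i t)"
    using windowed_sets[OF windowed_undecided] by (intro finite_measure_mono) auto
  ultimately show "\<exists>m B. windowed m B \<and> prob (({x \<in> space M. x i \<in> C} - B) \<union> (B - {x \<in> space M. x i \<in> C})) < \<delta>"
    using t by (intro exI[of _ ?m] exI[of _ ?B]) auto
qed

lemma windowed_compl: "windowed m B \<Longrightarrow> windowed m (space M - B)"
  unfolding windowed_def using agree_sym by blast

lemma approximable_compl: "approximable A \<Longrightarrow> approximable (space M - A)"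
  unfolding approximable_def
proof (intro conjI allI impI)
  fix \<delta> :: real
  assume A: "A \<in> sets M \<and> (\<forall>\<delta>>0. \<exists>m B. windowed m B \<and> prob ((A - B) \<union> (B - A)) < \<delta>)" and "\<delta> > 0"
  then obtain m B where B: "windowed m B" "prob ((A - B) \<union> (B - A)) < \<delta>" by blast
  have "(space M - A - (space M - B)) \<union> (space M - B - (space M - A)) = (A - B) \<union> (B - A)"
    using A B(1) sets.sets_into_space by (auto simp: windowed_def)
  then show "\<exists>m B. windowed m B \<and> prob ((space M - A - B) \<union> (B - (space M - A))) < \<delta>"
    using windowed_compl[OF B(1)] B(2) by (intro exI[of _ m] exI[of _ "space M - B"]) simp
qed auto

lemma approximable_UN:
  assumes "\<And>n :: nat. approximable (A n)"
  shows "approximable (\<Union>n. A n)"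
  unfolding approximable_def
proof (intro conjI allI impI)
  have [measurable]: "A n \<in> sets M" for n using assms by (simp add: approximable_def)
  show "(\<Union>n. A n) \<in> sets M" by measurable
  fix \<delta> :: real assume \<delta>: "\<delta> > 0"
  let ?R = "\<lambda>N. (\<Union>n. A n) - (\<Union>n<N. A n)"
  have "(\<lambda>N. prob (?R N)) \<longlonglongrightarrow> prob (\<Inter>N. ?R N)"
    by (rule finite_Lim_measure_decseq) (auto simp: decseq_def)
  moreover have "(\<Inter>N. ?R N) = {}" by auto
  ultimately have "(\<lambda>N. prob (?R N)) \<longlonglongrightarrow> 0" by (simp only: measure_empty)
  then obtain N where N: "prob (?R N) < \<delta> / 2"
    using LIMSEQ_D[of "\<lambda>N. prob (?R N)" 0 "\<delta> / 2"] \<delta> by auto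
  define \<epsilon> where "\<epsilon> = \<delta> / (2 * (real N + 1))"
  have \<epsilon>: "\<epsilon> > 0" "real N * \<epsilon> < \<delta> / 2" using \<delta> by (auto simp: \<epsilon>_def field_simps)
  have "\<exists>m B. windowed m B \<and> prob ((A n - B) \<union> (B - A n)) < \<epsilon>" for n
    using assms[of n] \<epsilon>(1) by (auto simp: approximable_def)
  then obtain m B where B: "\<And>n. windowed (m n) (B n)" "\<And>n. prob ((A n - B n) \<union> (B n - A n)) < \<epsilon>" by metis
  have [measurable]: "B n \<in> sets M" for n using windowed_sets[OF B(1)] .
  define m' where "m' = (\<Sum>n<N. m n)"
  have "windowed m' (B n)" if "n < N" for n
    by (rule windowed_mono[OF B(1)]) (use that in \<open>auto simp: m'_def intro: member_le_sum\<close>)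
  then have "windowed m' (\<Union>n<N. B n)" unfolding windowed_def by blast
  moreover have "prob (((\<Union>n. A n) - (\<Union>n<N. B n)) \<union> ((\<Union>n<N. B n) - (\<Union>n. A n))) < \<delta>"
  proof -
    have "((\<Union>n. A n) - (\<Union>n<N. B n)) \<union> ((\<Union>n<N. B n) - (\<Union>n. A n)) \<subseteq>
        ?R N \<union> (\<Union>n<N. (A n - B n) \<union> (B n - A n))" by auto
    then have "prob (((\<Union>n. A n) - (\<Union>n<N. B n)) \<union> ((\<Union>n<N. B n) - (\<Union>n. A n))) \<le>
        prob (?R N \<union> (\<Union>n<N. (A n - B n) \<union> (B n - A n)))"
      by (intro finite_measure_mono) auto
    also have "\<dots> \<le> prob (?R N) + prob (\<Union>n<N. (A n - B n) \<union> (B n - A n))"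
      by (intro measure_Un_le) auto
    also have "prob (\<Union>n<N. (A n - B n) \<union> (B n - A n)) \<le> (\<Sum>n<N. prob ((A n - B n) \<union> (B n - A n)))"
      by (intro finite_measure_subadditive_finite) auto
    also have "\<dots> \<le> real N * \<epsilon>"
      using sum_bounded_above[of "{..<N}" "\<lambda>n. prob ((A n - B n) \<union> (B n - A n))" \<epsilon>] B(2) by (simp add: less_imp_le)
    finally show ?thesis using N \<epsilon>(2) by linarith
  qed
  ultimately show "\<exists>m B. windowed m B \<and> prob (((\<Union>n. A n) - B) \<union> (B - (\<Union>n. A n))) < \<delta>" by blast
qed

lemma approximable_sets:
  assumes "A \<in> sets M"
  shows "approximable A"
proof -
  have "approximable (A \<inter> space M)" if "A \<in> sigma_sets UNIV {{f. f i \<in> C} | i C. True}" for A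
    using that
  proof (induction rule: sigma_sets.induct)
    case (Basic a)
    then obtain i C where "a = {f. f i \<in> C}" by auto
    then have "a \<inter> space M = {x \<in> space M. x i \<in> C}" by auto
    then show ?case using approximable_coordinate by simp
  next
    case Empty
    show ?case using approximable_coordinate[of 0 "{}"] by simp
  next
    case (Compl a)
    have "(UNIV - a) \<inter> space M = space M - a \<inter> space M" by auto
    then show ?case using approximable_compl[OF Compl.IH] by simp
  next
    case (Union a)
    have "\<Union> (range a) \<inter> space M = (\<Union>n. a n \<inter> space M)" by auto
    then show ?case using approximable_UN[of "\<lambda>n. a n \<inter> space M"] Union.IH by simp
  qed
  moreover obtain B where "B \<in> sets borel" "A = B \<inter> space M"
    using assms by (auto simp: sets_M sets_restrict_space space_M)
  ultimately show ?thesis unfolding borel_biseq_generated by simp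
qed

text \<open>The approximating sets \<open>B A\<close> may overlap or leave points uncovered, so
  \<open>Q\<close> chooses one of them, or the empty set by default. Outside the symmetric
  differences exactly one set applies, and it is the right one.\<close>

lemma approximable_partition:
  assumes "finite_partition M P" "\<delta> > 0"
  obtains m Q where "\<And>x y. x \<in> space M \<Longrightarrow> y \<in> space M \<Longrightarrow> agree m x y \<Longrightarrow> Q x = Q y"
    "Q ` space M \<subseteq> insert {} P" "prob {x \<in> space M. cell P x \<noteq> Q x} \<le> \<delta>"
proof -
  have fin: "finite P" and PM: "A \<in> P \<Longrightarrow> A \<in> sets M" for A using assms(1) by (auto simp: finite_partition_def)
  define \<epsilon> where "\<epsilon> = \<delta> / (real (card P) + 1)"
  have \<epsilon>: "\<epsilon> > 0" "real (card P) * \<epsilon> \<le> \<delta>" using assms(2) by (auto simp: \<epsilon>_def field_simps)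
  have "\<exists>m B. windowed m B \<and> prob ((A - B) \<union> (B - A)) < \<epsilon>" if "A \<in> P" for A
    using approximable_sets[OF PM[OF that]] \<epsilon>(1) by (auto simp: approximable_def)
  then obtain m B where B: "\<And>A. A \<in> P \<Longrightarrow> windowed (m A) (B A)" "\<And>A. A \<in> P \<Longrightarrow> prob ((A - B A) \<union> (B A - A)) < \<epsilon>" by metis
  define m' where "m' = (\<Sum>A\<in>P. m A)"
  have m': "windowed m' (B A)" if "A \<in> P" for A
    by (rule windowed_mono[OF B(1)[OF that]]) (use that fin in \<open>auto simp: m'_def intro: member_le_sum\<close>)
  define Q where "Q x = (if {A \<in> P. x \<in> B A} = {} then {} else SOME A. A \<in> {A \<in> P. x \<in> B A})" for x
  have Q: "Q x = Q y" if "x \<in> space M" "y \<in> space M" "agree m' x y" for x y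
  proof -
    have "{A \<in> P. x \<in> B A} = {A \<in> P. y \<in> B A}"
      using m' that agree_sym unfolding windowed_def by blast
    then show ?thesis unfolding Q_def by (simp only:)
  qed
  have QP: "Q ` space M \<subseteq> insert {} P"
  proof -
    have "Q x \<in> insert {} P" for x
      unfolding Q_def using some_in_eq[of "{A \<in> P. x \<in> B A}"] by (auto split: if_splits)
    then show ?thesis by blast
  qed
  have "prob {x \<in> space M. cell P x \<noteq> Q x} \<le> prob (\<Union>A\<in>P. (A - B A) \<union> (B A - A))"
  proof (rule finite_measure_mono)
    show "(\<Union>A\<in>P. (A - B A) \<union> (B A - A)) \<in> sets M"
      using fin PM windowed_sets[OF B(1)] by (intro sets.finite_UN sets.Un sets.Diff) auto
    show "{x \<in> space M. cell P x \<noteq> Q x} \<subseteq> (\<Union>A\<in>P. (A - B A) \<union> (B A - A))"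
    proof (rule subsetI, rule ccontr)
      fix x assume x: "x \<in> {x \<in> space M. cell P x \<noteq> Q x}" and "x \<notin> (\<Union>A\<in>P. (A - B A) \<union> (B A - A))"
      then have "{A \<in> P. x \<in> B A} = {A \<in> P. x \<in> A}" by auto
      also have "\<dots> = {cell P x}"
        using cell_eq[OF assms(1)] cell_in[OF assms(1)] x by auto
      finally have "Q x = cell P x" by (simp add: Q_def)
      then show False using x by simp
    qed
  qed
  also have "\<dots> \<le> (\<Sum>A\<in>P. prob ((A - B A) \<union> (B A - A)))"
    using fin PM windowed_sets[OF B(1)] by (intro finite_measure_subadditive_finite) auto
  also have "\<dots> \<le> real (card P) * \<epsilon>"
    using sum_bounded_above[of P "\<lambda>A. prob ((A - B A) \<union> (B A - A))" \<epsilon>] B(2) by (simp add: less_imp_le)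
  also have "\<dots> \<le> \<delta>" by (rule \<epsilon>(2))
  finally show thesis using that[OF Q QP] by blast
qed

section \<open>Entropy of the shift in terms of the coding\<close>

definition letter :: "biseq \<Rightarrow> nat" where
  "letter x = proj d (x 0)"

lemma simple_letter: "simple_function M letter"
proof (rule simple_local[of "{0}"])
  have "letter ` space M \<subseteq> {..<3}" by (auto simp: letter_def proj_less)
  then show "finite (letter ` space M)" by (rule finite_subset) simp
qed (auto simp: letter_def)

lemma itinerary_letter: "itinerary letter n x = map (\<lambda>i. proj d (x (int i))) [0..<n]"
  by (simp add: itinerary_def letter_def shift_pow)

lemma simple_windowed:
  assumes "\<And>x y. x \<in> space M \<Longrightarrow> y \<in> space M \<Longrightarrow> agree m x y \<Longrightarrow> Q x = Q y" "finite (Q ` space M)"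
  shows "simple_function M Q"
  by (rule simple_local[of "{-int m..int m}", OF _ assms(2)]) (auto intro!: assms(1) simp: agree_def)

text \<open>\<open>n\<close> consecutive windows of radius \<open>m\<close> see
  \<open>n + 2 * m\<close> letters. Invariance allows a shift by \<open>m\<close>, after which the
  leftmost of them stands at position 0, where itineraries start.\<close>

lemma ent_itinerary_windowed:
  assumes Q: "\<And>x y. x \<in> space M \<Longrightarrow> y \<in> space M \<Longrightarrow> agree m x y \<Longrightarrow> Q x = Q y" "finite (Q ` space M)"
  shows "ent M (itinerary Q n) \<le> ent M (itinerary letter (n + 2 * m))"
proof -
  note s = simple_itinerary[OF simple_windowed[OF Q]]
  have "ent M (itinerary Q n) = ent M (\<lambda>x. itinerary Q n ((shift ^^ m) x))"
    by (rule ent_shift_pow[OF s, symmetric])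
  also have "\<dots> \<le> ent M (itinerary letter (n + 2 * m))"
  proof (rule ent_mono[OF simple_itinerary[OF simple_letter]])
    fix x y assume xy: "x \<in> space M" "y \<in> space M"
      and e: "itinerary letter (n + 2 * m) x = itinerary letter (n + 2 * m) y"
    have p: "proj d (x (int j)) = proj d (y (int j))" if "j < n + 2 * m" for j
      using arg_cong[OF e, of "\<lambda>v. v ! j"] that by (simp add: itinerary_letter)
    have "Q ((shift ^^ (i + m)) x) = Q ((shift ^^ (i + m)) y)" if "i < n" for i
    proof (rule Q(1)[OF shift_pow_space[OF xy(1)] shift_pow_space[OF xy(2)]], unfold agree_def, intro ballI)
      fix l assume "l \<in> {-int m..int m}"
      then have "nat (l + int (i + m)) < n + 2 * m" "int (nat (l + int (i + m))) = l + int (i + m)"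
        using that by auto
      then show "proj d ((shift ^^ (i + m)) x l) = proj d ((shift ^^ (i + m)) y l)"
        using p[of "nat (l + int (i + m))"] by (simp add: shift_pow)
    qed
    then show "itinerary Q n ((shift ^^ m) x) = itinerary Q n ((shift ^^ m) y)"
      by (simp add: itinerary_def funpow_add)
  qed
  finally show ?thesis .
qed

text \<open>The function \<open>Q\<close>, which a window decides, and the correction
  \<open>D\<close> together determine \<open>cell P\<close>. Along an orbit, \<open>Q\<close> costs
  the entropy of the letters up to a constant, and \<open>D\<close> at most \<open>e\<close> per
  step, since it is \<open>None\<close> with high probability.\<close>

lemma entropy_wrt_le:
  assumes P: "finite_partition M P" and k: "k \<ge> 1"
  shows "entropy_wrt M P \<le> ent M (itinerary letter k) / real k"
proof (rule field_le_epsilon)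
  fix e :: real assume "e > 0"
  define r where "r = real (card P)"
  \<comment> \<open>With error probability \<open>s\<^sup>2\<close>, the entropy of \<open>D\<close>
    is at most \<open>s\<^sup>2 + r * (2 * s)\<close>. Since \<open>s \<le> 1\<close>, this is at
    most \<open>s * (1 + 2 * r)\<close>, hence at most \<open>e\<close>.\<close>
  define s where "s = min 1 e / (1 + 2 * r)"
  have r: "0 \<le> r" by (simp add: r_def)
  have se: "s * (1 + 2 * r) = min 1 e" using r by (simp add: s_def)
  have "0 < s" using \<open>e > 0\<close> r by (simp add: s_def)
  moreover from this have "s * 1 \<le> s * (1 + 2 * r)" using r by (intro mult_left_mono) auto
  ultimately have s: "0 < s" "s \<le> 1" "s * (1 + 2 * r) \<le> e" unfolding se by auto
  have fin: "finite P" using P by (simp add: finite_partition_def)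
  obtain m Q where Q: "\<And>x y. x \<in> space M \<Longrightarrow> y \<in> space M \<Longrightarrow> agree m x y \<Longrightarrow> Q x = Q y"
    "Q ` space M \<subseteq> insert {} P" "prob {x \<in> space M. cell P x \<noteq> Q x} \<le> s\<^sup>2"
    by (rule approximable_partition[OF P, of "s\<^sup>2"]) (use s in auto)
  have finQ: "finite (Q ` space M)" using Q(2) fin finite_subset by blast
  note sQ = simple_windowed[OF Q(1) finQ]
  define D where "D x = (if cell P x = Q x then None else Some (cell P x))" for x
  have D_eq: "D = (\<lambda>(u, v). if u = v then None else Some u) \<circ> (\<lambda>x. (cell P x, Q x))" by (auto simp: D_def)
  have sD: "simple_function M D"
    unfolding D_eq by (rule simple_function_compose[OF simple_function_Pair[OF simple_cell[OF P] sQ]])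
  have "ent M D \<le> s\<^sup>2 + real (card (Some ` P)) * (2 * sqrt (s\<^sup>2))"
  proof (rule ent_almost_constant[OF sD])
    show "D ` space M \<subseteq> insert None (Some ` P)" using cell_in(1)[OF P] by (auto simp: D_def)
    have "{x \<in> space M. D x \<noteq> None} = {x \<in> space M. cell P x \<noteq> Q x}" by (auto simp: D_def)
    then show "prob {x \<in> space M. D x \<noteq> None} \<le> s\<^sup>2" using Q(3) by simp
  qed (use fin in simp)
  also have "\<dots> = s * s + r * (2 * s)" using s fin by (simp add: r_def card_image power2_eq_square)
  also have "\<dots> \<le> s * 1 + r * (2 * s)" using s by (intro add_right_mono mult_left_mono) auto
  also have "\<dots> \<le> e" using s(3) by (simp add: algebra_simps)
  finally have De: "ent M D \<le> e" .
  \<comment> \<open>The cost of the letters by which the windows stick out at both ends. It does not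
    grow with \<open>q\<close> and disappears in the limit.\<close>
  define C where "C = ent M (itinerary letter (2 * m))"
  have main: "ent M (itinerary (cell P) (q * k)) \<le> real q * ent M (itinerary letter k) + C + real (q * k) * e" for q
  proof -
    let ?n = "q * k"
    note sq = simple_itinerary[OF sQ] and sd = simple_itinerary[OF sD]
    have "ent M (itinerary (cell P) ?n) \<le> ent M (\<lambda>x. (itinerary Q ?n x, itinerary D ?n x))"
    proof (rule ent_mono[OF simple_function_Pair[OF sq sd]])
      fix x y assume "(itinerary Q ?n x, itinerary D ?n x) = (itinerary Q ?n y, itinerary D ?n y)"
      then have "Q ((shift ^^ i) x) = Q ((shift ^^ i) y)" "D ((shift ^^ i) x) = D ((shift ^^ i) y)" if "i < ?n" for i
        using that by (auto simp: itinerary_def)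
      then have "cell P ((shift ^^ i) x) = cell P ((shift ^^ i) y)" if "i < ?n" for i
        using that unfolding D_def by (metis option.distinct(1) option.inject)
      then show "itinerary (cell P) ?n x = itinerary (cell P) ?n y" by (simp add: itinerary_def)
    qed
    also have "\<dots> \<le> ent M (itinerary Q ?n) + ent M (itinerary D ?n)" by (rule ent_Pair_le[OF sq sd])
    also have "ent M (itinerary Q ?n) \<le> ent M (itinerary letter (?n + 2 * m))"
      by (rule ent_itinerary_windowed[OF Q(1) finQ])
    also have "\<dots> \<le> ent M (itinerary letter ?n) + C"
      unfolding C_def by (rule ent_itinerary_add[OF simple_letter])
    also have "ent M (itinerary letter ?n) \<le> real q * ent M (itinerary letter k)"
      by (rule ent_itinerary_mult[OF simple_letter])
    also have "ent M (itinerary D ?n) \<le> real ?n * ent M (itinerary D 1)"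
      using ent_itinerary_mult[OF sD, of ?n 1] by simp
    also have "\<dots> \<le> real ?n * e"
      using ent_itinerary_1[OF sD] De by (intro mult_left_mono) auto
    finally show ?thesis by simp
  qed
  \<comment> \<open>Along the multiples of \<open>k\<close> the itinerary splits into blocks of
    length \<open>k\<close> without remainder.\<close>
  have "strict_mono (\<lambda>q. q * k)" using k by (auto simp: strict_mono_def)
  from LIMSEQ_subseq_LIMSEQ[OF entropy_wrt_limit[OF P] this]
  have l: "(\<lambda>q. ent M (itinerary (cell P) (q * k)) / real (q * k)) \<longlonglongrightarrow> entropy_wrt M P"
    by (simp add: o_def)
  have "(\<lambda>q. C / real k / real q) \<longlonglongrightarrow> 0" by (rule lim_const_over_n)
  then have "(\<lambda>q. ent M (itinerary letter k) / real k + C / real k / real q + e) \<longlonglongrightarrow> ent M (itinerary letter k) / real k + 0 + e"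
    by (intro tendsto_intros)
  then have l2: "(\<lambda>q. ent M (itinerary letter k) / real k + C / real k / real q + e) \<longlonglongrightarrow> ent M (itinerary letter k) / real k + e"
    by simp
  show "entropy_wrt M P \<le> ent M (itinerary letter k) / real k + e"
  proof (rule LIMSEQ_le[OF l l2], intro exI[of _ 1] allI impI)
    fix q :: nat assume q: "1 \<le> q"
    have "ent M (itinerary (cell P) (q * k)) / real (q * k) \<le>
        (real q * ent M (itinerary letter k) + C + real (q * k) * e) / real (q * k)"
      by (rule divide_right_mono[OF main]) simp
    also have "\<dots> = ent M (itinerary letter k) / real k + C / real k / real q + e"
      using q k by (simp add: field_simps)
    finally show "ent M (itinerary (cell P) (q * k)) / real (q * k) \<le>
        ent M (itinerary letter k) / real k + C / real k / real q + e" .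
  qed
qed

text \<open>\<open>entropy_wrt_le\<close> holds for each \<open>k\<close> and not only in the limit.
  So the words of each single length reach the maximal entropy \<open>k * ln 3\<close>, and the
  equality case of Gibbs' inequality applies.\<close>

lemma uniform_itinerary:
  assumes "ereal (ln 3) \<le> measure_entropy M" "length u = k" "set u \<subseteq> {..<3}"
  shows "prob {x \<in> space M. itinerary letter k x = u} = (1 / 3) ^ k"
proof (cases "k = 0")
  case True
  then show ?thesis using assms(2) by (simp add: itinerary_def prob_space)
next
  case False
  then have k: "k \<ge> 1" by simp
  let ?S = "{v. set v \<subseteq> {..<3::nat} \<and> length v = k}"
  have card: "card ?S = 3 ^ k" by (simp add: card_lists_length_eq)
  have "measure_entropy M \<le> ereal (ent M (itinerary letter k) / real k)"
    unfolding measure_entropy_def by (intro SUP_least) (auto intro: entropy_wrt_le[OF _ k])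
  then have "ln 3 \<le> ent M (itinerary letter k) / real k"
    using assms(1) by (metis ereal_less_eq(3) order_trans)
  then have "real k * ln 3 \<le> ent M (itinerary letter k)" using k by (simp add: pos_le_divide_eq mult.commute)
  then have "ln (real (card ?S)) \<le> ent M (itinerary letter k)" by (simp add: card ln_realpow)
  moreover have "itinerary letter k ` space M \<subseteq> ?S" by (auto simp: itinerary_letter proj_less)
  ultimately have "prob (itinerary letter k -` {u} \<inter> space M) = 1 / real (card ?S)"
    using assms(2,3) finite_lists_length_eq[of "{..<3::nat}" k]
    by (intro ent_maximal_uniform simple_itinerary simple_letter) auto
  moreover have "itinerary letter k -` {u} \<inter> space M = {x \<in> space M. itinerary letter k x = u}" by auto
  ultimately show ?thesis unfolding card by (simp add: power_one_over)
qed

end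

section \<open>Approximation by ideal measures\<close>

subsection \<open>Ternary digits and positions\<close>

lemma digits_less: "(\<And>k. a k < 3) \<Longrightarrow> (\<Sum>k<L. a k * 3 ^ k) < (3::nat) ^ L"
proof (induction L)
  case (Suc L)
  have "a L \<le> 2" using Suc.prems[of L] by simp
  then have "a L * 3 ^ L \<le> 2 * 3 ^ L" by (rule mult_right_mono) simp
  moreover have "(\<Sum>k<L. a k * 3 ^ k) < 3 ^ L" using Suc by simp
  ultimately have "(\<Sum>k<L. a k * 3 ^ k) + a L * 3 ^ L < 3 ^ L + 2 * 3 ^ L" by (rule add_less_le_mono[rotated])
  then show ?case by simp
qed simp

lemma digits_unique:
  assumes "\<And>k. a k < 3" "\<And>k. b k < 3" "(\<Sum>k<L. a k * 3 ^ k) = (\<Sum>k<L. b k * (3::nat) ^ k)" "k < L"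
  shows "a k = b k"
  using assms(3,4)
proof (induction L)
  case (Suc L)
  let ?A = "\<Sum>k<L. a k * 3 ^ k" and ?B = "\<Sum>k<L. b k * (3::nat) ^ k"
  have less: "?A < 3 ^ L" "?B < 3 ^ L" using digits_less[of a L] digits_less[of b L] assms(1,2) by auto
  have "a L = (?A + a L * 3 ^ L) div 3 ^ L" using less(1) by simp
  also have "\<dots> = (?B + b L * 3 ^ L) div 3 ^ L" using Suc.prems(1) by simp
  also have "\<dots> = b L" using less(2) by simp
  finally have "a L = b L" .
  then show ?case using Suc by (cases "k = L") auto
qed simp

lemma digits_exist: "u < (3::nat) ^ L \<Longrightarrow> \<exists>a. (\<forall>k. a k < 3) \<and> (\<Sum>k<L. a k * 3 ^ k) = u"
proof (induction L arbitrary: u)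
  case 0
  then show ?case by (intro exI[of _ "\<lambda>_. 0"]) simp
next
  case (Suc L)
  obtain a where a: "\<And>k. a k < 3" "(\<Sum>k<L. a k * 3 ^ k) = u mod 3 ^ L"
    using Suc.IH[of "u mod 3 ^ L"] by auto
  have "u div 3 ^ L < 3" using Suc.prems by (simp add: less_mult_imp_div_less)
  moreover have "(\<Sum>k<L. (a(L := u div 3 ^ L)) k * 3 ^ k) = (\<Sum>k<L. a k * 3 ^ k)" by (intro sum.cong) auto
  ultimately show ?case using a by (intro exI[of _ "a(L := u div 3 ^ L)"]) (auto simp: mod_div_mult_eq)
qed

text \<open>The enumeration runs through 0, -1, 1, -2, 2 and so on, so its first
  \<open>2 * N + 1\<close> positions fill the symmetric window. This is why codes of odd length
  occur below.\<close>

lemma int_encode_less: "int_encode l < 2 * N + 1 \<longleftrightarrow> - int N \<le> l \<and> l \<le> int N"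
  by (auto simp: int_encode_def sum_encode_def)

subsection \<open>The metric\<close>

lemma biseq_dist_le_1: "biseq_dist x y \<le> 1"
  by (simp add: biseq_dist_def power_le_one)

lemma biseq_dist_nonneg: "0 \<le> biseq_dist x y"
  by (simp add: biseq_dist_def)

lemma biseq_dist_le:
  assumes "\<And>i. \<bar>i\<bar> \<le> int m \<Longrightarrow> x i = y i"
  shows "biseq_dist x y \<le> (1 / 2) ^ (m + 1)"
proof (cases "x = y")
  case False
  let ?P = "\<lambda>n. \<exists>k. n = nat \<bar>k\<bar> \<and> x k \<noteq> y k"
  from False obtain k where "x k \<noteq> y k" by blast
  then have "?P (nat \<bar>k\<bar>)" by blast
  then have "?P (LEAST n. ?P n)" by (rule LeastI)
  then obtain k where k: "(LEAST n. ?P n) = nat \<bar>k\<bar>" "x k \<noteq> y k" by blast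
  have "\<not> \<bar>k\<bar> \<le> int m" using assms[of k] k(2) by blast
  then have "m + 1 \<le> (LEAST n. ?P n)" unfolding k(1) by linarith
  then show ?thesis using False by (simp add: biseq_dist_def power_decreasing del: power_Suc)
qed (simp add: biseq_dist_def)

text \<open>Test functions are Lipschitz for \<open>biseq_dist\<close>, while the Borel sets come
  from the product topology. Cylinders have small diameter, so test functions are continuous and
  hence measurable.\<close>

lemma lipschitz_continuous:
  fixes f :: "biseq \<Rightarrow> real"
  assumes "\<forall>x\<in>X. \<forall>y\<in>X. \<bar>f x - f y\<bar> \<le> biseq_dist x y"
  shows "continuous_on X f"
  unfolding continuous_on_def
proof (intro ballI tendstoI)
  fix x and e :: real
  assume x: "x \<in> X" and "e > 0"
  then obtain m where m: "(1 / 2) ^ m < e" using real_arch_pow_inv[of e "1 / 2"] by auto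
  show "\<forall>\<^sub>F y in at x within X. dist (f y) (f x) < e"
    unfolding eventually_at_topological
  proof (intro exI[of _ "{y. \<forall>k\<in>{-int m..int m}. y k = x k}"] conjI ballI impI)
    fix y assume y: "y \<in> {y. \<forall>k\<in>{-int m..int m}. y k = x k}" "y \<in> X"
    have "\<bar>f y - f x\<bar> \<le> biseq_dist y x" using assms x y(2) by blast
    also have "\<dots> \<le> (1 / 2) ^ (m + 1)" using y(1) by (intro biseq_dist_le) (auto simp: abs_le_iff)
    also have "\<dots> \<le> (1 / 2) ^ m" by (simp add: power_decreasing)
    finally show "dist (f y) (f x) < e" using m by (simp add: dist_real_def)
  qed (auto intro: open_cylinder)
qed

subsection \<open>The exponential moment of the excess\<close>

text \<open>The factors of Chernoff's method. Two letters have weight 1 and one has weight -1, so a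
  base \<open>r\<close> gives the moment \<open>(2 * r + 1 / r) / 3\<close>. The value 2/3 is a
  rational near the optimal \<open>1 / sqrt 2\<close> and yields 17/18; being below 1, it gives
  words of nonpositive weight a factor of at least 1.\<close>

definition tilt :: "nat \<Rightarrow> real" where
  "tilt a = (2 / 3) powi weight a"

lemma prod_list_tilt: "prod_list (map tilt u) = (2 / 3) powi sum_list (map weight u)"
  by (induction u) (auto simp: tilt_def power_int_add)

lemma prod_list_tilt_ge_1: "sum_list (map weight u) \<le> 0 \<Longrightarrow> 1 \<le> prod_list (map tilt u)"
proof -
  assume "sum_list (map weight u) \<le> 0"
  then obtain n where n: "sum_list (map weight u) = - int n" by (metis nonpos_int_cases)
  have "(2 / 3 :: real) powi (- int n) = (3 / 2) ^ n"
    by (simp add: power_int_minus power_divide)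
  then show ?thesis unfolding prod_list_tilt n by simp
qed

lemma prod_list_tilt_nonneg: "0 \<le> prod_list (map tilt u)"
  unfolding prod_list_tilt by simp

lemma sum_tilt: "(\<Sum>u | set u \<subseteq> {..<3} \<and> length u = t. prod_list (map tilt u)) = (17 / 6) ^ t"
proof (induction t)
  case 0
  have "{u :: nat list. set u \<subseteq> {..<3} \<and> length u = 0} = {[]}" by auto
  then show ?case by simp
next
  case (Suc t)
  let ?L = "\<lambda>t. {u :: nat list. set u \<subseteq> {..<3} \<and> length u = t}"
  have "?L (Suc t) = (\<lambda>(a, v). a # v) ` ({..<3} \<times> ?L t)"
    by (auto simp: length_Suc_conv image_iff)
  moreover have "inj_on (\<lambda>(a, v). a # v) ({..<3} \<times> ?L t)" by (auto simp: inj_on_def)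
  ultimately have "(\<Sum>u\<in>?L (Suc t). prod_list (map tilt u)) =
      (\<Sum>(a, v)\<in>{..<3} \<times> ?L t. tilt a * prod_list (map tilt v))"
    by (simp add: sum.reindex case_prod_unfold)
  also have "\<dots> = (\<Sum>a<3. tilt a) * (\<Sum>v\<in>?L t. prod_list (map tilt v))"
    by (simp add: sum.cartesian_product[symmetric] sum_product)
  also have "(\<Sum>a<3. tilt a) = 17 / 6"
    by (simp add: numeral_3_eq_3 tilt_def weight_def power_int_minus)
  finally show ?case using Suc by simp
qed

section \<open>Uniformly distributed codings\<close>

locale uniform_system = matched_system +
  assumes entropy_ge: "ereal (ln 3) \<le> measure_entropy M"
begin

definition word :: "int \<Rightarrow> nat \<Rightarrow> biseq \<Rightarrow> nat list" where
  "word a k x = map (\<lambda>j. proj d (x (a + int j))) [0..<k]"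

lemma sets_word: "{x \<in> space M. word a k x = u} \<in> sets M"
proof (rule local_sets[of "{a..<a + int k}"])
  fix x y assume "\<And>l. l \<in> {a..<a + int k} \<Longrightarrow> x l = y l" "y \<in> space M" "x \<in> {x \<in> space M. word a k x = u}"
  moreover from this(1) have "word a k x = word a k y" by (simp add: word_def)
  ultimately show "y \<in> {x \<in> space M. word a k x = u}" by simp
qed auto

lemma word_shift: "word a k ((shift ^^ n) x) = word (a + int n) k x"
  by (auto simp: word_def shift_pow algebra_simps)

lemma word_uniform:
  assumes "length u = k" "set u \<subseteq> {..<3}"
  shows "prob {x \<in> space M. word a k x = u} = (1 / 3) ^ k"
proof -
  have sh: "prob {x \<in> space M. word (a + int n) k x = u} = prob {x \<in> space M. word a k x = u}" for a n
  proof -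
    have "(shift ^^ n) -` {x \<in> space M. word a k x = u} \<inter> space M = {x \<in> space M. word (a + int n) k x = u}"
      using shift_pow_space[of _ n] by (auto simp: word_shift)
    then show ?thesis using shift_pow_invariant[OF sets_word, of n a k u] by simp
  qed
  have "word 0 k = itinerary letter k" by (auto simp: word_def itinerary_letter fun_eq_iff)
  then have 0: "prob {x \<in> space M. word 0 k x = u} = (1 / 3) ^ k"
    using uniform_itinerary[OF entropy_ge assms] by simp
  show ?thesis
  proof (cases "a \<ge> 0")
    case True
    then show ?thesis using sh[of 0 "nat a"] 0 by simp
  next
    case False
    then show ?thesis using sh[of a "nat (- a)"] 0 by simp
  qed
qed

lemma excess_word: "excess d x i t = sum_list (map weight (word (if d then i - int t else i + 1) t x))"
proof -
  define a where "a = (if d then i - int t else i + 1)"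
  have "bij_betw (\<lambda>j. a + int j) {..<t} (window d i t)"
    by (rule bij_betwI[of _ _ _ "\<lambda>l. nat (l - a)"]) (auto simp: window_def a_def)
  from sum.reindex_bij_betw[OF this, of "\<lambda>l. weight (proj d (x l))"]
  have "excess d x i t = (\<Sum>j<t. weight (proj d (x (a + int j))))" by (simp add: excess_def)
  also have "\<dots> = sum_list (map weight (word a t x))"
    by (simp add: word_def o_def interv_sum_list_conv_sum_set_nat atLeast0LessThan)
  finally show ?thesis by (simp add: a_def)
qed

text \<open>The event is enlarged to a condition on one word of length \<open>t\<close>, namely
  nonpositive total weight. Each word has probability \<open>(1 / 3) ^ t\<close>; inserting the
  tilting factors and summing over all words leaves the moment \<open>(17 / 6) ^ t\<close>.\<close>

lemma prob_undecided: "prob (undecided i t) \<le> (17 / 18) ^ t"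
proof -
  define a where "a = (if d then i - int t else i + 1)"
  let ?L = "{u :: nat list. set u \<subseteq> {..<3} \<and> length u = t}"
  let ?B = "{u \<in> ?L. sum_list (map weight u) \<le> 0}"
  have fin: "finite ?L" by (rule finite_lists_length_eq) simp
  have finB: "finite ?B" by (rule finite_subset[OF _ fin]) blast
  have "undecided i t \<subseteq> (\<Union>u\<in>?B. {x \<in> space M. word a t x = u})"
  proof
    fix x assume x: "x \<in> undecided i t"
    then have "excess d x i t \<le> 0" by (simp add: undecided_def)
    then have "sum_list (map weight (word a t x)) \<le> 0"
      unfolding excess_word a_def .
    moreover have "word a t x \<in> ?L" by (auto simp: word_def proj_less)
    ultimately show "x \<in> (\<Union>u\<in>?B. {x \<in> space M. word a t x = u})" using x by (auto simp: undecided_def)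
  qed
  then have "prob (undecided i t) \<le> prob (\<Union>u\<in>?B. {x \<in> space M. word a t x = u})"
    by (intro finite_measure_mono sets.finite_UN sets_word finB)
  also have "\<dots> \<le> (\<Sum>u\<in>?B. prob {x \<in> space M. word a t x = u})"
    by (intro measure_UNION_le sets_word finB)
  also have "\<dots> = (\<Sum>u\<in>?B. (1 / 3) ^ t)" by (intro sum.cong) (auto simp: word_uniform)
  also have "\<dots> \<le> (\<Sum>u\<in>?B. (1 / 3) ^ t * prod_list (map tilt u))"
    by (intro sum_mono) (auto simp: mult_le_cancel_left1 intro: prod_list_tilt_ge_1)
  also have "\<dots> \<le> (\<Sum>u\<in>?L. (1 / 3) ^ t * prod_list (map tilt u))"
    by (rule sum_mono2[OF fin]) (auto intro!: mult_nonneg_nonneg prod_list_tilt_nonneg)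
  also have "\<dots> = (1 / 3) ^ t * (17 / 6) ^ t" by (simp add: sum_distrib_left[symmetric] sum_tilt)
  also have "\<dots> = (17 / 18) ^ t" by (simp add: power_mult_distrib[symmetric])
  finally show ?thesis .
qed

text \<open>Positions are numbered as in the input of the machine for the ideal points, so the
  digits of \<open>s j\<close> are obtained from that machine without any arithmetic on
  integers.\<close>

definition digit :: "biseq \<Rightarrow> nat \<Rightarrow> nat" where
  "digit x k = proj d (x (int_decode k))"

definition code :: "nat \<Rightarrow> biseq \<Rightarrow> nat" where
  "code L x = (\<Sum>k<L. digit x k * 3 ^ k)"

lemma digit_less: "digit x k < 3"
  by (simp add: digit_def proj_less)

lemma code_less: "code L x < 3 ^ L"
  unfolding code_def by (rule digits_less[OF digit_less])

lemma code_eq_digits: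
  assumes "\<And>k. a k < 3"
  shows "code L x = (\<Sum>k<L. a k * 3 ^ k) \<longleftrightarrow> (\<forall>k<L. digit x k = a k)"
  unfolding code_def using digits_unique[of "digit x" a L, OF digit_less assms] by auto

lemma code_eq_agree: "code (2 * N + 1) x = code (2 * N + 1) y \<longleftrightarrow> agree N x y"
proof -
  have "code (2 * N + 1) x = code (2 * N + 1) y \<longleftrightarrow> (\<forall>k<2 * N + 1. digit x k = digit y k)"
    using code_eq_digits[of "digit y", OF digit_less, of "2 * N + 1" x] unfolding code_def by blast
  also have "\<dots> \<longleftrightarrow> agree N x y"
    unfolding agree_def digit_def
    using int_encode_less[of _ N] by (metis atLeastAtMost_iff int_decode_inverse int_encode_inverse)
  finally show ?thesis .
qed

lemma windowed_code: "windowed N {x \<in> space M. code (2 * N + 1) x \<in> C}"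
  unfolding windowed_def
proof (intro conjI ballI impI)
  fix x y assume *: "y \<in> space M" "agree N x y" "x \<in> {x \<in> space M. code (2 * N + 1) x \<in> C}"
  then have "code (2 * N + 1) x = code (2 * N + 1) y" by (simp only: code_eq_agree)
  then show "y \<in> {x \<in> space M. code (2 * N + 1) x \<in> C}" using * by simp
qed blast

lemma prob_digits:
  assumes "\<And>k. a k < 3"
  shows "prob {x \<in> space M. \<forall>k<2 * N + 1. digit x k = a k} = (1 / 3) ^ (2 * N + 1)"
proof -
  let ?u = "map (\<lambda>j. a (int_encode (- int N + int j))) [0..<2 * N + 1]"
  have "(\<forall>k<2 * N + 1. digit x k = a k) \<longleftrightarrow> word (- int N) (2 * N + 1) x = ?u" for x
  proof
    assume *: "\<forall>k<2 * N + 1. digit x k = a k"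
    have "proj d (x (- int N + int j)) = a (int_encode (- int N + int j))" if "j < 2 * N + 1" for j
    proof -
      have "int_encode (- int N + int j) < 2 * N + 1" unfolding int_encode_less using that by auto
      then have "digit x (int_encode (- int N + int j)) = a (int_encode (- int N + int j))" using * by blast
      then show ?thesis by (simp add: digit_def)
    qed
    then show "word (- int N) (2 * N + 1) x = ?u" by (simp add: word_def del: upt_Suc)
  next
    assume *: "word (- int N) (2 * N + 1) x = ?u"
    show "\<forall>k<2 * N + 1. digit x k = a k"
    proof (intro allI impI)
      fix k assume "k < 2 * N + 1"
      then have l: "- int N \<le> int_decode k" "int_decode k \<le> int N" using int_encode_less[of "int_decode k" N] by auto
      define j where "j = nat (int_decode k + int N)"
      have j: "j < 2 * N + 1" "- int N + int j = int_decode k" using l by (auto simp: j_def)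
      have "word (- int N) (2 * N + 1) x ! j = ?u ! j" using * by simp
      then show "digit x k = a k" using j by (simp add: word_def digit_def del: upt_Suc)
    qed
  qed
  moreover have "prob {x \<in> space M. word (- int N) (2 * N + 1) x = ?u} = (1 / 3) ^ (2 * N + 1)"
    by (rule word_uniform) (use assms in auto)
  ultimately show ?thesis by simp
qed

lemma prob_code:
  assumes "u < 3 ^ (2 * N + 1)"
  shows "prob {x \<in> space M. code (2 * N + 1) x = u} = (1 / 3) ^ (2 * N + 1)"
proof -
  obtain a where a: "\<And>k. a k < 3" "(\<Sum>k<2 * N + 1. a k * 3 ^ k) = u"
    using digits_exist[OF assms] by blast
  have "{x \<in> space M. code (2 * N + 1) x = u} = {x \<in> space M. \<forall>k<2 * N + 1. digit x k = a k}"
    unfolding a(2)[symmetric] code_eq_digits[of a, OF a(1)] ..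
  then show ?thesis using prob_digits[OF a(1), of N] by simp
qed

section \<open>Selected ideal points and the distance of measures\<close>

context
  fixes s :: "nat \<Rightarrow> biseq"
  assumes s_space: "range s \<subseteq> space M" and s_dense: "space M \<subseteq> closure (range s)"
begin

text \<open>Every word has positive probability, so some point of the shift space shows it, and by
  density so does an ideal point. Hence the search in \<open>select\<close> succeeds.\<close>

lemma code_surj:
  assumes "u < 3 ^ L"
  shows "\<exists>j. code L (s j) = u"
proof -
  obtain a where a: "\<And>k. a k < 3" "(\<Sum>k<L. a k * 3 ^ k) = u"
    using digits_exist[OF assms] by blast
  \<comment> \<open>Uniformity is at hand for odd numbers of digits; with \<open>2 * L + 1\<close>
    digits prescribed, the first \<open>L\<close> are among them.\<close>
  have "prob {x \<in> space M. \<forall>k<2 * L + 1. digit x k = a k} \<noteq> 0" unfolding prob_digits[OF a(1)] by simp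
  then have "{x \<in> space M. \<forall>k<2 * L + 1. digit x k = a k} \<noteq> {}" by (metis measure_empty)
  then obtain x where x: "x \<in> space M" "\<And>k. k < 2 * L + 1 \<Longrightarrow> digit x k = a k" by blast
  obtain y where y: "y \<in> range s" "\<And>l. l \<in> int_decode ` {..<L} \<Longrightarrow> y l = x l"
    using closure_agree[of x "range s" "int_decode ` {..<L}"] x(1) s_dense by blast
  then have "code L y = u" using code_eq_digits[of a, OF a(1), of L y] a(2) x(2) by (auto simp: digit_def)
  then show ?thesis using y(1) by auto
qed

text \<open>The transport map: a point moves to the selected ideal point with the same code.\<close>

definition approx :: "nat \<Rightarrow> biseq \<Rightarrow> biseq" where
  "approx L x = s (select (\<lambda>j. digit (s j)) L (code L x))"

lemma code_select: "u < 3 ^ L \<Longrightarrow> code L (s (select (\<lambda>j. digit (s j)) L u)) = u"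
  unfolding select_def code_def[symmetric] by (rule LeastI_ex[OF code_surj])

lemma approx_agree: "agree N x (approx (2 * N + 1) x)"
  unfolding code_eq_agree[symmetric] approx_def by (simp only: code_select[OF code_less])

lemma measurable_approx: "approx (2 * N + 1) \<in> measurable M M"
proof (rule measurableI)
  show "approx (2 * N + 1) x \<in> space M" for x using s_space by (auto simp: approx_def)
  fix A assume "A \<in> sets M"
  have eq: "approx (2 * N + 1) -` A \<inter> space M =
      {x \<in> space M. code (2 * N + 1) x \<in> {u. s (select (\<lambda>j. digit (s j)) (2 * N + 1) u) \<in> A}}"
    by (auto simp: approx_def)
  show "approx (2 * N + 1) -` A \<inter> space M \<in> sets M"
    unfolding eq by (rule windowed_sets[OF windowed_code])
qed

lemma ideal_list_uniform_index:
  "ideal_list (uniform_index D L) = rev (map (\<lambda>u. (select D L u, 0)) [0..<3 ^ L])"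
proof -
  let ?ys = "rev (map (\<lambda>u. prod_encode (select D L u, 0)) [0..<3 ^ L])"
  have "?ys \<noteq> []" by simp
  then obtain h t where ht: "?ys = h # t" by (cases ?ys) auto
  have "uniform_index D L = prod_encode (h, list_encode t)" unfolding uniform_index_def ht by simp
  then have "ideal_list (uniform_index D L) = map prod_decode ?ys" unfolding ht by (simp add: ideal_list_def)
  then show ?thesis by (simp add: rev_map o_def)
qed

text \<open>The code of a random point is uniform on \<open>3 ^ (2 * N + 1)\<close> values and
  determines the image under \<open>approx\<close>. So each selected point receives exactly the
  weight that the ideal measure gives it.\<close>

lemma ideal_measure_uniform_index:
  "ideal_measure dyck_shift s (uniform_index (\<lambda>j. digit (s j)) (2 * N + 1)) = distr M M (approx (2 * N + 1))"
proof -
  let ?L = "2 * N + 1" and ?A = "subshift_algebra dyck_shift"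
  define K :: nat where "K = 3 ^ ?L"
  define J where "J = select (\<lambda>j. digit (s j)) ?L"
  have A: "space ?A = space M" "sets ?A = sets M"
    using sets_M sets_eq_imp_space_eq[OF sets_M] by (simp_all add: subshift_algebra_def)
  \<comment> \<open>The second components are 0, so each list entry has weight
    \<open>a + 1 = 1\<close>.\<close>
  have total: "(\<Sum>(j, a)\<leftarrow>rev (map (\<lambda>u. (J u, 0)) [0..<K]). a + 1) = K"
    by (simp add: rev_map[symmetric] o_def sum_list_rev sum_list_triv)
  have eq: "(\<Sum>(j, a)\<leftarrow>rev (map (\<lambda>u. (J u, 0)) [0..<K]). ennreal (real (a + 1) / real K) * emeasure (return ?A (s j)) B) =
     emeasure (distr M M (approx ?L)) B" if B: "B \<in> sets M" for B
  proof -
    define U where "U = {u. u < K \<and> s (J u) \<in> B}"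
    have "(\<Sum>(j, a)\<leftarrow>rev (map (\<lambda>u. (J u, 0)) [0..<K]). ennreal (real (a + 1) / real K) * emeasure (return ?A (s j)) B) =
       (\<Sum>u<K. ennreal (1 / real K) * indicator B (s (J u)))"
      using B A by (simp add: rev_map[symmetric] o_def sum_list_rev interv_sum_list_conv_sum_set_nat atLeast0LessThan)
    also have "\<dots> = (\<Sum>u\<in>U. ennreal (1 / real K))"
      unfolding U_def by (intro sum.mono_neutral_cong_right) (auto split: split_indicator_asm)
    also have "\<dots> = (\<Sum>u\<in>U. emeasure M {x \<in> space M. code ?L x = u})"
    proof (rule sum.cong[OF refl])
      fix u assume "u \<in> U"
      then show "ennreal (1 / real K) = emeasure M {x \<in> space M. code ?L x = u}"
        using prob_code[of u N] by (simp add: U_def K_def emeasure_eq_measure power_one_over)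
    qed
    also have "\<dots> = emeasure M (\<Union>u\<in>U. {x \<in> space M. code ?L x = u})"
    proof (rule sum_emeasure)
      show "(\<lambda>u. {x \<in> space M. code ?L x = u}) ` U \<subseteq> sets M"
        using windowed_sets[OF windowed_code, of N "{u}" for u] by auto
    qed (auto simp: disjoint_family_on_def U_def)
    also have "(\<Union>u\<in>U. {x \<in> space M. code ?L x = u}) = approx ?L -` B \<inter> space M"
      using code_less[of ?L] by (auto simp: U_def approx_def J_def K_def)
    also have "emeasure M (approx ?L -` B \<inter> space M) = emeasure (distr M M (approx ?L)) B"
      by (rule emeasure_distr[OF measurable_approx B, symmetric])
    finally show ?thesis .
  qed
  have "ideal_measure dyck_shift s (uniform_index (\<lambda>j. digit (s j)) ?L) =
    measure_of (space M) (sets M) (\<lambda>B. \<Sum>(j, a)\<leftarrow>rev (map (\<lambda>u. (J u, 0)) [0..<K]).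
       ennreal (real (a + 1) / real K) * emeasure (return ?A (s j)) B)"
    unfolding ideal_measure_def ideal_list_uniform_index Let_def A J_def[symmetric] K_def[symmetric] total ..
  also have "\<dots> = measure_of (space M) (sets M) (emeasure (distr M M (approx ?L)))"
  proof (rule measure_of_eq[OF sets.space_closed])
    fix B assume "B \<in> sigma_sets (space M) (sets M)"
    then have "B \<in> sets M" by (simp add: sets.sigma_sets_eq)
    then show "(\<Sum>(j, a)\<leftarrow>rev (map (\<lambda>u. (J u, 0)) [0..<K]). ennreal (real (a + 1) / real K) * emeasure (return ?A (s j)) B) =
      emeasure (distr M M (approx ?L)) B" by (rule eq)
  qed
  also have "\<dots> = distr M M (approx ?L)"
    using measure_of_of_measure[of "distr M M (approx ?L)"] by simp
  finally show ?thesis .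
qed

text \<open>As the ideal measure is the image under \<open>approx\<close>, the two integrals of a
  Lipschitz function differ by at most the mean displacement of a point.\<close>

lemma wasserstein_uniform_index:
  "wasserstein dyck_shift M (ideal_measure dyck_shift s (uniform_index (\<lambda>j. digit (s j)) (54 * n + 109))) < (1 / 2) ^ n"
proof -
  \<comment> \<open>One additional bit turns the final estimate into a strict inequality.\<close>
  define m where "m = n + 1"
  \<comment> \<open>13 letters halve the bound, as \<open>(17 / 18) ^ 13 \<le> 1 / 2\<close>. Of the
    \<open>2 * m + 2\<close> halvings, \<open>m + 1\<close> pay for the union over
    \<open>2 * m + 1 \<le> 2 ^ (m + 1)\<close> positions, and \<open>m + 1\<close> remain.\<close>
  define t where "t = 13 * (2 * m + 2)"
  \<comment> \<open>Position \<open>i\<close> needs a window of radius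
    \<open>nat \<bar>i\<bar> + t + 1\<close>, and all positions up to \<open>m\<close> in absolute
    value are to be decided.\<close>
  define N where "N = t + m + 1"
  have L: "54 * n + 109 = 2 * N + 1" by (simp add: N_def t_def m_def)
  let ?T = "approx (2 * N + 1)"
  define Bad where "Bad = (\<Union>i\<in>{-int m..int m}. undecided i t)"
  have Bad: "Bad \<in> sets M" unfolding Bad_def
    using windowed_sets[OF windowed_undecided] by (intro sets.finite_UN) auto
  have close: "biseq_dist x (?T x) \<le> (1 / 2) ^ (m + 1)" if x: "x \<in> space M" "x \<notin> Bad" for x
  proof (rule biseq_dist_le)
    fix i assume i: "\<bar>i\<bar> \<le> int m"
    have "nat \<bar>i\<bar> + t + 1 \<le> N" using i by (simp add: N_def)
    then have "agree (nat \<bar>i\<bar> + t + 1) x (?T x)" using agree_mono[OF approx_agree] by blast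
    moreover have "x \<notin> undecided i t" using x(2) i by (auto simp: Bad_def abs_le_iff)
    ultimately show "x i = ?T x i"
      using decided[OF x(1) measurable_space[OF measurable_approx x(1)]] by blast
  qed
  have pBad: "prob Bad \<le> (1 / 2) ^ (m + 1)"
  proof -
    have "prob Bad \<le> (\<Sum>i\<in>{-int m..int m}. prob (undecided i t))"
      unfolding Bad_def using windowed_sets[OF windowed_undecided] by (intro measure_UNION_le) auto
    also have "\<dots> \<le> (\<Sum>i\<in>{-int m..int m}. (17 / 18) ^ t)" by (intro sum_mono prob_undecided)
    also have "\<dots> = real (2 * m + 1) * (17 / 18) ^ t" by (simp add: nat_add_distrib nat_mult_distrib)
    also have "\<dots> \<le> 2 ^ (m + 1) * (1 / 2) ^ (2 * m + 2)"
    proof (rule mult_mono)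
      have "(2 :: nat) ^ (m + 1) = 2 * 2 ^ m" by simp
      then have "2 * m + 1 \<le> 2 ^ (m + 1)" using less_exp[of m] by linarith
      then show "real (2 * m + 1) \<le> 2 ^ (m + 1)" by (metis of_nat_le_iff of_nat_numeral of_nat_power)
      have "(17 / 18 :: real) ^ 13 \<le> 1 / 2" by (simp add: power_divide)
      then have "((17 / 18 :: real) ^ 13) ^ (2 * m + 2) \<le> (1 / 2) ^ (2 * m + 2)" by (rule power_mono) simp
      then show "(17 / 18 :: real) ^ t \<le> (1 / 2) ^ (2 * m + 2)" unfolding t_def by (simp only: power_mult)
    qed auto
    also have "(2::real) ^ (m + 1) * (1 / 2) ^ (2 * m + 2) = (1 / 2) ^ (m + 1)"
    proof -
      have "(1 / 2 :: real) ^ (2 * m + 2) = (1 / 2) ^ (m + 1) * (1 / 2) ^ (m + 1)"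
        unfolding power_add[symmetric] by (rule arg_cong) simp
      moreover have "(2::real) ^ (m + 1) * (1 / 2) ^ (m + 1) = 1"
        unfolding power_mult_distrib[symmetric] by simp
      ultimately show ?thesis by (simp only: mult.assoc[symmetric] mult_1_left)
    qed
    finally show ?thesis .
  qed
  have "\<bar>integral\<^sup>L M f - integral\<^sup>L (distr M M ?T) f\<bar> \<le> (1 / 2) ^ m"
    if f: "\<forall>x\<in>dyck_shift. \<forall>y\<in>dyck_shift. \<bar>f x - f y\<bar> \<le> biseq_dist x y" for f :: "biseq \<Rightarrow> real"
  proof -
    have "f \<in> borel_measurable (restrict_space borel dyck_shift)"
      by (rule borel_measurable_continuous_on_restrict[OF lipschitz_continuous[OF f]])
    then have fM [measurable]: "f \<in> borel_measurable M" by (simp only: measurable_cong_sets[OF sets_M refl])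
    note measurable_approx[of N, measurable]
    \<comment> \<open>Distances are at most 1, so a test function stays within 1 of its value at a
      single point and is integrable.\<close>
    obtain x0 where x0: "x0 \<in> space M" using not_empty by blast
    have bound: "\<bar>f x\<bar> \<le> \<bar>f x0\<bar> + 1" if "x \<in> space M" for x
      using f that x0 biseq_dist_le_1[of x x0] unfolding space_M by (smt (verit))
    have int: "integrable M f"
      by (rule integrable_const_bound[of _ "\<bar>f x0\<bar> + 1"]) (use bound in auto)
    have intT: "integrable M (\<lambda>x. f (?T x))"
    proof (rule integrable_const_bound[of _ "\<bar>f x0\<bar> + 1"])
      show "AE x in M. norm (f (?T x)) \<le> \<bar>f x0\<bar> + 1"
        using bound measurable_space[OF measurable_approx] by (intro AE_I2) simp
    qed measurable
    have "integral\<^sup>L (distr M M ?T) f = (\<integral>x. f (?T x) \<partial>M)"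
      by (rule integral_distr[OF measurable_approx fM])
    then have "\<bar>integral\<^sup>L M f - integral\<^sup>L (distr M M ?T) f\<bar> = \<bar>\<integral>x. f x - f (?T x) \<partial>M\<bar>"
      using int intT by simp
    also have "\<dots> \<le> (\<integral>x. \<bar>f x - f (?T x)\<bar> \<partial>M)" by (rule integral_abs_bound)
    \<comment> \<open>Off \<open>Bad\<close> a point moves by at most
      \<open>(1 / 2) ^ (m + 1)\<close>; on \<open>Bad\<close> the displacement is bounded by the
      diameter 1.\<close>
    also have "\<dots> \<le> (\<integral>x. (1 / 2) ^ (m + 1) + indicator Bad x \<partial>M)"
    proof (rule integral_mono)
      show "integrable M (\<lambda>x. \<bar>f x - f (?T x)\<bar>)" using int intT by simp
      show "integrable M (\<lambda>x. (1 / 2) ^ (m + 1) + indicator Bad x :: real)"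
        using Bad by (simp add: less_top[symmetric])
      fix x assume x: "x \<in> space M"
      have "\<bar>f x - f (?T x)\<bar> \<le> biseq_dist x (?T x)"
        using f x measurable_space[OF measurable_approx x] unfolding space_M by blast
      also have "\<dots> \<le> (1 / 2) ^ (m + 1) + indicator Bad x"
      proof (cases "x \<in> Bad")
        case True
        then show ?thesis using biseq_dist_le_1[of x "?T x"] by (simp add: add_increasing)
      next
        case False
        then show ?thesis using close[OF x] by simp
      qed
      finally show "\<bar>f x - f (?T x)\<bar> \<le> (1 / 2) ^ (m + 1) + indicator Bad x" .
    qed
    also have "\<dots> = (1 / 2) ^ (m + 1) + prob Bad"
      using Bad by (simp add: less_top[symmetric] prob_space)
    also have "\<dots> \<le> (1 / 2) ^ m" using pBad by simp
    finally show ?thesis .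
  qed
  note bound = this
  have "wasserstein dyck_shift M (distr M M ?T) \<le> (1 / 2) ^ m"
    unfolding wasserstein_def
  proof (rule cSUP_least)
    show "{f :: biseq \<Rightarrow> real. \<forall>x\<in>dyck_shift. \<forall>y\<in>dyck_shift. \<bar>f x - f y\<bar> \<le> biseq_dist x y} \<noteq> {}"
    proof
      assume "{f :: biseq \<Rightarrow> real. \<forall>x\<in>dyck_shift. \<forall>y\<in>dyck_shift. \<bar>f x - f y\<bar> \<le> biseq_dist x y} = {}"
      then have "\<not> (\<forall>x\<in>dyck_shift. \<forall>y\<in>dyck_shift. \<bar>f x - f y\<bar> \<le> biseq_dist x y)" for f :: "biseq \<Rightarrow> real"
        by (simp only: Collect_empty_eq) blast
      from this[of "\<lambda>_. 0"] show False by (simp add: biseq_dist_nonneg)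
    qed
  qed (rule bound, simp)
  also have "(1 / 2 :: real) ^ m < (1 / 2) ^ n" by (simp add: m_def)
  finally show ?thesis unfolding L ideal_measure_uniform_index .
qed

end

end

section \<open>Computability of the ergodic measures of maximal entropy\<close>

theorem corollary1p4:
  fixes s :: "nat \<Rightarrow> biseq" and \<mu> :: "biseq measure"
  assumes "ideal_points dyck_shift s"
    and "max_entropy_measure dyck_shift \<mu>"
    and "ergodic \<mu>"
  shows "computable_measure dyck_shift s \<mu>"
proof -
  interpret dyck_system \<mu>
    by unfold_locales (use assms(2) in \<open>simp add: max_entropy_measure_def\<close>)
  \<comment> \<open>The value of \<open>d\<close> is not computed. Only the existence of a machine
    for the given measure is claimed, so the program may depend on it.\<close>
  obtain d where d: "\<And>k. prob {x \<in> space \<mu>. unmatched d x k} = 0"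
    using ergodic_matched[OF assms(3)] by blast
  interpret uniform_system \<mu> d
    by unfold_locales (use d assms(2) top_entropy_ge in \<open>simp_all add: max_entropy_measure_def\<close>)
  have s: "range s \<subseteq> space \<mu>" "space \<mu> \<subseteq> closure (range s)"
    using assms(1) by (simp_all add: ideal_points_def space_M)
  obtain f where f: "turing_computable f" "\<And>i m. f (prod_encode (i, int_encode m)) = bracket_code (s i m)"
    using assms(1) by (auto simp: ideal_points_def)
  \<comment> \<open>The table that turns the code of a bracket into its letter under
    \<open>proj d\<close>; its last case is that of the code 3.\<close>
  define p where "p x = (if x = 0 then proj d LPar else if x = 1 then proj d RPar
    else if x = 2 then proj d LBrk else proj d RBrk)" for x :: nat
  have "p (bracket_code c) = proj d c" for c by (cases c) (simp_all add: p_def)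
  then have digit: "digit (s j) k = p (f (prod_encode (j, k)))" for j k
    using f(2)[of j "int_decode k"] by (simp add: digit_def)
  have "turing_computable (\<lambda>n. uniform_index (\<lambda>j. digit (s j)) (54 * n + 109))"
  proof (rule turing_computable_uniform_index[OF f(1) p_def digit])
    fix L u :: nat assume "u < 3 ^ L"
    then show "\<exists>j. (\<Sum>k<L. digit (s j) k * 3 ^ k) = u"
      using code_surj[OF s] by (simp add: code_def)
  qed
  moreover have "borel_prob_on dyck_shift \<mu>"
    using invariant by (simp add: invariant_prob_on_def)
  ultimately show ?thesis
    unfolding computable_measure_def using wasserstein_uniform_index[OF s] by blast
qed

end
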